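(* Let $m$ be a non-negative integer and let $p$ be a prime such that $p>2m+3$. Then $$\beta_p(2m+1)\equiv \frac{(-1)^{(p+1)/2}\,m(4^m-1)}{16^{m}(2m+1)}\,B_{p-2m-1}\pmod{p},$$ $$\overline{\zeta}_p(2m+2)\equiv -\frac{2m^2+3m+2}{2^{2m+3}(2m+3)}\,p\,B_{p-2m-3}\pmod{p^2}.$$
   Context: For an integer $n\ge0$ and $r\ge 0$, $\overline{H}_n(\{2\}^r)=\sum_{0\le k_1<\cdots<k_r<n}\frac{1}{(2k_1+1)^{2}\cdots (2k_r+1)^{2}}$, with $\overline{H}_n(\{2\}^0)=1$ and $\overline{H}_n(\{2\}^r)=0$ if $n<r$. The finite analogues are defined by $$\beta_p(2m+1)=\frac{3}{4}\sum_{k=0}^{(p-3)/2}\frac{(-1)^m\binom{2k}{k}\overline{H}_k(\{2\}^m)}{16^k(2k+1)}+\sum_{j=1}^m\sum_{k=0}^{(p-3)/2}\frac{(-1)^{m-j}\binom{2k}{k}\overline{H}_k(\{2\}^{m-j})}{16^k(2k+1)^{2j+1}},$$ $$\overline{\zeta}_p(2m+2)=\frac{5}{4}\sum_{k=0}^{(p-3)/2}\frac{(-1)^{k+m}\binom{2k}{k}\overline{H}_k(\{2\}^m)}{16^k(2k+1)^2}+\sum_{j=1}^m\sum_{k=0}^{(p-3)/2}\frac{(-1)^{k+m-j}\binom{2k}{k}\overline{H}_k(\{2\}^{m-j})}{16^k(2k+1)^{2j+2}}.$$ $B_k$ are the Bernoulli numbers defined by $\frac{x}{e^x-1}=\sum_{k\ge0}B_k\frac{x^k}{k!}$.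 For rational numbers $x,y$, $x\equiv y\pmod{p^k}$ means that $x-y$ has $p$-adic valuation at least $k$. *)

theory Defs
  imports "HOL-Computational_Algebra.Computational_Algebra"
begin

(* The Bernoulli numbers, read off from their exponential generating function
   x / (e^x - 1).  The denominator has zero constant term, but division of formal
   power series cancels the common factor x; see bernoulli_egf below. *)
definition bernoulli :: "nat \<Rightarrow> rat" where
  "bernoulli k = fact k * fps_nth (fps_X / (fps_exp 1 - 1)) k"

lemma bernoulli_egf:
  "Abs_fps (\<lambda>k. bernoulli k / fact k) * (fps_exp 1 - 1) = fps_X"
proof -
  have "subdegree (fps_exp 1 - 1 :: rat fps) = 1"
    by (rule subdegreeI) auto
  moreover have "(fps_exp 1 - 1 :: rat fps) \<noteq> 0"
    using calculation by auto
  ultimately have "(fps_exp 1 - 1 :: rat fps) dvd fps_X"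
    by (simp add: fps_dvd_iff)
  moreover have "Abs_fps (\<lambda>k. bernoulli k / fact k) = fps_X / (fps_exp 1 - 1)"
    by (simp add: fps_eq_iff bernoulli_def)
  ultimately show ?thesis
    by simp
qed

(* The multiple sum H-bar_n({2}^r): the index tuples k_1 < ... < k_r < n are the
   strictly increasing lists of length r with entries below n. *)
definition Hbar2 :: "nat \<Rightarrow> nat \<Rightarrow> rat" where
  "Hbar2 n r =
     (\<Sum>ks | length ks = r \<and> sorted_wrt (<) ks \<and> set ks \<subseteq> {..<n}.
        \<Prod>k\<leftarrow>ks. 1 / (2 * of_nat k + 1) ^ 2)"

lemma finite_Hbar2_indices:
  "finite {ks. length ks = r \<and> sorted_wrt (<) ks \<and> set ks \<subseteq> {..<n::nat}}"
  by (rule finite_subset[OF _ finite_lists_length_eq[of "{..<n}" r]]) auto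

(* beta_odd p m is the finite analogue beta_p(2m+1), and
   zeta_even p m is the finite analogue zeta-bar_p(2m+2). *)
definition beta_odd :: "nat \<Rightarrow> nat \<Rightarrow> rat" where
  "beta_odd p m =
     3 / 4 * (\<Sum>k = 0..(p - 3) div 2.
       (-1) ^ m * of_nat ((2 * k) choose k) * Hbar2 k m /
       (16 ^ k * (2 * of_nat k + 1)))
     + (\<Sum>j = 1..m. \<Sum>k = 0..(p - 3) div 2.
       (-1) ^ (m - j) * of_nat ((2 * k) choose k) * Hbar2 k (m - j) /
       (16 ^ k * (2 * of_nat k + 1) ^ (2 * j + 1)))"

definition zeta_even :: "nat \<Rightarrow> nat \<Rightarrow> rat" where
  "zeta_even p m =
     5 / 4 * (\<Sum>k = 0..(p - 3) div 2.
       (-1) ^ (k + m) * of_nat ((2 * k) choose k) * Hbar2 k m /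
       (16 ^ k * (2 * of_nat k + 1) ^ 2))
     + (\<Sum>j = 1..m. \<Sum>k = 0..(p - 3) div 2.
       (-1) ^ (k + m - j) * of_nat ((2 * k) choose k) * Hbar2 k (m - j) /
       (16 ^ k * (2 * of_nat k + 1) ^ (2 * j + 2)))"

(* The p-adic valuation of a nonzero rational number, with numerator and denominator in
   lowest terms; the value at 0 is meaningless, so the infinite valuation of 0 is
   handled separately in rat_cong. *)
definition padic_val :: "nat \<Rightarrow> rat \<Rightarrow> int" where
  "padic_val p x =
     int (multiplicity (int p) (fst (quotient_of x))) -
     int (multiplicity (int p) (snd (quotient_of x)))"

(* rat_cong p k x y is the congruence of the rationals x and y modulo p^k. *)
definition rat_cong :: "nat \<Rightarrow> nat \<Rightarrow> rat \<Rightarrow> rat \<Rightarrow> bool" where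
  "rat_cong p k x y \<longleftrightarrow> x = y \<or> padic_val p (x - y) \<ge> int k"

end

theory Submission
  imports Defs "HOL-Number_Theory.Cong"
begin

text \<open>
Both finite analogues become transparent as generating functions. Let \<open>N = (p - 1) / 2\<close> and
\<open>f\<^sub>k(X) = \<Prod>j<k. (1 - X / (2j+1)^2)\<close>; the coefficient of \<open>X^r\<close> in \<open>f\<^sub>k\<close> is \<open>(-1)^r\<close> times the
multiple sum of depth \<open>r\<close>. Hence the generating function of the odd values is
  \<open>\<Sum>k<N. C(2k,k) / (16^k (2k+1)) * f\<^sub>k(a^2) * (3/4 + a^2 / ((2k+1)^2 - a^2))\<close>,
and the even values have a similar one. The \<open>k\<close>-th term has a single pole in \<open>a^2\<close>, at \<open>(2k+1)^2\<close>,
and its residue is simple because \<open>C(2k,k) / 16^k * f\<^sub>k((2k+1)^2) = (-1)^k\<close> (lemma \<open>cbin_fpol_node\<close>).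
Splitting off the poles writes each value as a power sum over the odd numbers below \<open>p\<close> plus a
coefficient of a remainder polynomial (lemmas \<open>beta_sum_eq\<close> and \<open>zeta_sum_eq\<close>).

The remainders satisfy first-order difference equations with explicit right-hand sides (lemmas \<open>beta_functional\<close> and \<open>zeta_functional\<close>): shifting \<open>a\<close> by one
in both directions turns the products \<open>\<Prod>j<k. ((2j+1)^2 - a^2)\<close> into products of
\<open>(2j)^2 - a^2\<close>, after which the sum over \<open>k\<close> telescopes. At the even integers \<open>a\<close> with
\<open>\<bar>a\<bar> < 2N\<close> the product part vanishes. The remainders have degree below \<open>p\<close> in \<open>a\<close>, so
these values determine them modulo \<open>p\<close>.

For the odd values, let \<open>V\<close> be the antiderivative of the remainder \<open>R\<close>. Modulo \<open>p\<close> the difference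
equation integrates to \<open>V(a+1) + V(a-1) = \<plusminus> \<Sum>j<N. a^(2j+1)\<close>, and the right-hand side is zero
at every residue other than \<open>1\<close> and \<open>-1\<close>. Therefore \<open>V(2t) = \<plusminus> (-1)^t / 2\<close> for \<open>0 < t < p\<close>, and
the coefficients of \<open>V\<close> are multiples of alternating power sums and hence, modulo \<open>p\<close>, of Bernoulli numbers
(lemma \<open>alt_psum_bernoulli\<close>). The pole part is a multiple of the same alternating power sum.

For the even values, let \<open>L\<close> be \<open>a\<close> times the remainder. The difference equation gives
\<open>L(q) = - 1 / (2q) - p h(q)\<close> modulo \<open>p^2\<close> at odd \<open>q\<close> with \<open>\<bar>q\<bar> < p\<close>, where \<open>h\<close> is an odd polynomial with Bernoulli
numbers as coefficients. So \<open>L\<close> is \<open>- a^(p-2) / 2\<close> modulo \<open>p\<close>, and the quotient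
\<open>(L + a^(p-2) / 2) / p + h\<close> takes the value \<open>(q^(p-1) - 1) / (2pq)\<close> modulo \<open>p\<close> at
odd \<open>q\<close> with \<open>\<bar>q\<bar> < p\<close>. Its coefficients, multiplied by \<open>p\<close>, are differences of power sums over the odd \<open>q < p\<close>, and Kummer's congruence
(lemma \<open>psum_kummer\<close>) reduces everything to one Bernoulli number.
\<close>

section \<open>Congruences between p-integral rationals\<close>

locale odd_prime =
  fixes p :: nat
  assumes prime: "prime p" and gt3: "p > 3"
begin

definition Zp :: "rat set" where
  "Zp = {x. \<exists>a b :: int. \<not> int p dvd b \<and> x = of_int a / of_int b}"

definition pcong :: "nat \<Rightarrow> rat \<Rightarrow> rat \<Rightarrow> bool" where
  "pcong k x y \<longleftrightarrow> (\<exists>z\<in>Zp. x - y = of_nat p ^ k * z)"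

lemma prime_int: "prime (int p)"
  using prime by simp

lemma p_pos: "p > 0" and p_nonzero [simp]: "(of_nat p :: rat) \<noteq> 0"
  using gt3 by auto

lemma odd_p: "odd p"
  using prime gt3 prime_odd_nat by force

lemma Zp_of_int [simp, intro]: "of_int a \<in> Zp"
  unfolding Zp_def using gt3 by (intro CollectI exI[of _ a] exI[of _ 1]) auto

lemma Zp_of_nat [simp, intro]: "of_nat a \<in> Zp"
  using Zp_of_int[of "int a"] by simp

lemma Zp_0 [simp, intro]: "0 \<in> Zp" and Zp_1 [simp, intro]: "1 \<in> Zp"
  and Zp_numeral [simp, intro]: "numeral n \<in> Zp"
  using Zp_of_nat[of 0] Zp_of_nat[of 1] Zp_of_nat[of "numeral n"] by simp_all

lemma Zp_add [simp, intro]: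
  assumes "x \<in> Zp" "y \<in> Zp" shows "x + y \<in> Zp"
proof -
  obtain a b where ab: "\<not> int p dvd b" "x = of_int a / of_int b" using assms(1) unfolding Zp_def by blast
  obtain c d where cd: "\<not> int p dvd d" "y = of_int c / of_int d" using assms(2) unfolding Zp_def by blast
  have "b \<noteq> 0" "d \<noteq> 0" using ab(1) cd(1) by auto
  then have "x + y = of_int (a * d + c * b) / of_int (b * d)"
    unfolding ab(2) cd(2) by (simp add: field_simps)
  moreover have "\<not> int p dvd b * d"
    using ab(1) cd(1) prime_dvd_mult_iff[OF prime_int] by simp
  ultimately show ?thesis unfolding Zp_def by blast
qed

lemma Zp_mult [simp, intro]:
  assumes "x \<in> Zp" "y \<in> Zp" shows "x * y \<in> Zp"
proof -
  obtain a b where ab: "\<not> int p dvd b" "x = of_int a / of_int b" using assms(1) unfolding Zp_def by blast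
  obtain c d where cd: "\<not> int p dvd d" "y = of_int c / of_int d" using assms(2) unfolding Zp_def by blast
  have "x * y = of_int (a * c) / of_int (b * d)"
    unfolding ab(2) cd(2) by simp
  moreover have "\<not> int p dvd b * d"
    using ab(1) cd(1) prime_dvd_mult_iff[OF prime_int] by simp
  ultimately show ?thesis unfolding Zp_def by blast
qed

lemma Zp_minus [simp, intro]: "x \<in> Zp \<Longrightarrow> - x \<in> Zp"
  using Zp_mult[OF Zp_of_int[of "-1"], of x] by simp

lemma Zp_diff [simp, intro]: "x \<in> Zp \<Longrightarrow> y \<in> Zp \<Longrightarrow> x - y \<in> Zp"
  using Zp_add[of x "- y"] by simp

lemma Zp_power [simp, intro]: "x \<in> Zp \<Longrightarrow> x ^ n \<in> Zp"
  by (induction n) auto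

lemma Zp_sum [intro]: "(\<And>i. i \<in> A \<Longrightarrow> f i \<in> Zp) \<Longrightarrow> sum f A \<in> Zp"
  by (induction A rule: infinite_finite_induct) auto

lemma Zp_prod [intro]: "(\<And>i. i \<in> A \<Longrightarrow> f i \<in> Zp) \<Longrightarrow> prod f A \<in> Zp"
  by (induction A rule: infinite_finite_induct) auto

lemma Zp_inverse_int: "\<not> int p dvd b \<Longrightarrow> 1 / of_int b \<in> Zp"
  unfolding Zp_def by (intro CollectI exI[of _ 1] exI[of _ b]) auto

lemma Zp_inverse_nat: "\<not> p dvd b \<Longrightarrow> 1 / of_nat b \<in> Zp"
  using Zp_inverse_int[of "int b"] by simp

lemma Zp_divide_nat: "x \<in> Zp \<Longrightarrow> \<not> p dvd b \<Longrightarrow> x / of_nat b \<in> Zp"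
  using Zp_mult[OF _ Zp_inverse_nat, of x b] by simp

lemma not_dvd_less: "0 < n \<Longrightarrow> n < p \<Longrightarrow> \<not> p dvd n"
  by (simp add: nat_dvd_not_less)

lemma not_dvd_2: "\<not> p dvd 2" and not_dvd_4: "\<not> p dvd 4"
proof -
  show "\<not> p dvd 2" using gt3 by (simp add: nat_dvd_not_less)
  then show "\<not> p dvd 4" using prime_dvd_mult_iff[OF prime, of 2 2] by simp
qed

lemma not_dvd_power: "\<not> p dvd b \<Longrightarrow> \<not> p dvd b ^ k"
  using prime prime_dvd_power by blast

lemma Zp_half [simp, intro]: "1 / 2 \<in> Zp" and Zp_quarter [simp, intro]: "1 / 4 \<in> Zp"
  using Zp_inverse_nat[OF not_dvd_2] Zp_inverse_nat[OF not_dvd_4] by simp_all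

lemma Zp_half' [simp, intro]: "x \<in> Zp \<Longrightarrow> x / 2 \<in> Zp"
  using Zp_mult[OF _ Zp_half, of x] by simp

lemma pcong_refl [simp, intro]: "pcong k x x"
  unfolding pcong_def by (intro bexI[of _ 0]) auto

lemma pcong_sym: "pcong k x y \<Longrightarrow> pcong k y x"
  unfolding pcong_def by (metis Zp_minus minus_diff_eq mult_minus_right)

lemma pcong_trans [trans]: "pcong k x y \<Longrightarrow> pcong k y z \<Longrightarrow> pcong k x z"
  unfolding pcong_def
proof (elim bexE)
  fix u v assume "u \<in> Zp" "v \<in> Zp" "x - y = of_nat p ^ k * u" "y - z = of_nat p ^ k * v"
  then show "\<exists>w\<in>Zp. x - z = of_nat p ^ k * w"
    by (intro bexI[of _ "u + v"]) (auto simp: algebra_simps)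
qed

lemma pcong_eq_trans [trans]: "pcong k x y \<Longrightarrow> y = z \<Longrightarrow> pcong k x z"
  and eq_pcong_trans [trans]: "x = y \<Longrightarrow> pcong k y z \<Longrightarrow> pcong k x z"
  by simp_all

lemma pcong_add: "pcong k x y \<Longrightarrow> pcong k x' y' \<Longrightarrow> pcong k (x + x') (y + y')"
  unfolding pcong_def
proof (elim bexE)
  fix u v assume "u \<in> Zp" "v \<in> Zp" "x - y = of_nat p ^ k * u" "x' - y' = of_nat p ^ k * v"
  then show "\<exists>w\<in>Zp. x + x' - (y + y') = of_nat p ^ k * w"
    by (intro bexI[of _ "u + v"]) (auto simp: algebra_simps)
qed

lemma pcong_scale: "c \<in> Zp \<Longrightarrow> pcong k x y \<Longrightarrow> pcong k (c * x) (c * y)"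
  unfolding pcong_def
proof (elim bexE)
  fix u assume "c \<in> Zp" "u \<in> Zp" "x - y = of_nat p ^ k * u"
  then show "\<exists>w\<in>Zp. c * x - c * y = of_nat p ^ k * w"
    by (intro bexI[of _ "c * u"]) (auto simp: right_diff_distrib [symmetric])
qed

lemma pcong_scale_right: "c \<in> Zp \<Longrightarrow> pcong k x y \<Longrightarrow> pcong k (x * c) (y * c)"
  using pcong_scale[of c k x y] by (simp add: mult.commute)

lemma pcong_minus: "pcong k x y \<Longrightarrow> pcong k (- x) (- y)"
  using pcong_scale[OF Zp_of_int[of "-1"], of k x y] by simp

lemma pcong_diff: "pcong k x y \<Longrightarrow> pcong k x' y' \<Longrightarrow> pcong k (x - x') (y - y')"
  using pcong_add[OF _ pcong_minus, of k x y x' y'] by simp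

lemma pcong_mult: "x' \<in> Zp \<Longrightarrow> y \<in> Zp \<Longrightarrow> pcong k x y \<Longrightarrow> pcong k x' y' \<Longrightarrow> pcong k (x * x') (y * y')"
  by (rule pcong_trans[OF pcong_scale_right pcong_scale])

lemma pcong_power: "x \<in> Zp \<Longrightarrow> y \<in> Zp \<Longrightarrow> pcong k x y \<Longrightarrow> pcong k (x ^ n) (y ^ n)"
  by (induction n) (auto intro!: pcong_mult)

lemma pcong_sum: "(\<And>i. i \<in> A \<Longrightarrow> pcong k (f i) (g i)) \<Longrightarrow> pcong k (sum f A) (sum g A)"
  by (induction A rule: infinite_finite_induct) (auto intro: pcong_add)

lemma pcong_sum_zero: "(\<And>i. i \<in> A \<Longrightarrow> pcong k (f i) 0) \<Longrightarrow> pcong k (sum f A) 0"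
  using pcong_sum[of A k f "\<lambda>_. 0"] by simp

lemma pcong_prod:
  "(\<And>i. i \<in> A \<Longrightarrow> f i \<in> Zp) \<Longrightarrow> (\<And>i. i \<in> A \<Longrightarrow> g i \<in> Zp) \<Longrightarrow>
    (\<And>i. i \<in> A \<Longrightarrow> pcong k (f i) (g i)) \<Longrightarrow> pcong k (prod f A) (prod g A)"
  by (induction A rule: infinite_finite_induct) (auto intro!: pcong_mult Zp_prod)

lemma pcong_prime_power: "pcong k (of_nat p ^ k * x) 0" if "x \<in> Zp"
  using that unfolding pcong_def by auto

lemma pcong_weaken: "pcong k x y \<Longrightarrow> j \<le> k \<Longrightarrow> pcong j x y"
  unfolding pcong_def
proof (elim bexE)
  fix u assume "j \<le> k" "u \<in> Zp" "x - y = of_nat p ^ k * u"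
  then show "\<exists>w\<in>Zp. x - y = of_nat p ^ j * w"
    by (intro bexI[of _ "of_nat p ^ (k - j) * u"]) (auto simp flip: power_add mult.assoc)
qed

lemma pcong_times_p: "pcong 2 (of_nat p * x) (of_nat p * y) \<longleftrightarrow> pcong 1 x y"
proof -
  have "of_nat p * x - of_nat p * y = of_nat p ^ 2 * z \<longleftrightarrow> x - y = of_nat p ^ 1 * z" for z
    using p_pos by (simp add: power2_eq_square mult.assoc flip: right_diff_distrib)
  then show ?thesis unfolding pcong_def by simp
qed

lemma pcong_cancel_int: "\<not> int p dvd b \<Longrightarrow> pcong k (of_int b * x) (of_int b * y) \<Longrightarrow> pcong k x y"
  using pcong_scale[OF Zp_inverse_int, of b k "of_int b * x" "of_int b * y"]
  by (cases "b = 0") auto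

lemma pcong_cancel_nat: "\<not> p dvd b \<Longrightarrow> pcong k (of_nat b * x) (of_nat b * y) \<Longrightarrow> pcong k x y"
  using pcong_cancel_int[of "int b" k x y] by simp

lemma pcong_of_int: "int p dvd a - b \<Longrightarrow> pcong 1 (of_int a) (of_int b)"
proof (elim dvdE)
  fix c assume "a - b = int p * c"
  then have "(of_int a - of_int b :: rat) = of_nat p ^ 1 * of_int c"
    by (metis of_int_diff of_int_mult of_int_of_nat_eq power_one_right)
  then show ?thesis unfolding pcong_def by blast
qed

lemma pcong_of_int_iff: "pcong 1 (of_int a) (of_int b) \<longleftrightarrow> int p dvd a - b"
proof
  assume "pcong 1 (of_int a) (of_int b)"
  then obtain z where z: "z \<in> Zp" "of_int a - of_int b = of_nat p * z"
    unfolding pcong_def by auto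
  then obtain c d where cd: "\<not> int p dvd d" "z = of_int c / of_int d" unfolding Zp_def by blast
  have "d \<noteq> 0" using cd(1) by auto
  then have "(of_int ((a - b) * d) :: rat) = of_int (int p * c)"
    using z(2) cd(2) by (simp add: field_simps)
  then have "(a - b) * d = int p * c" by (simp only: of_int_eq_iff)
  then have "int p dvd (a - b) * d" by simp
  then show "int p dvd a - b" using cd(1) prime_dvd_mult_iff[OF prime_int] by blast
qed (rule pcong_of_int)

lemma pcong_p_minus: "pcong 1 (of_nat p - x) (- x)"
  unfolding pcong_def by (intro bexI[of _ 1]) auto

lemma not_dvd_residue: "x \<in> {1..<p} \<Longrightarrow> \<not> p dvd x"
  using not_dvd_less by auto

lemma bij_betw_mult_mod:
  assumes "\<not> p dvd c"
  shows "bij_betw (\<lambda>x. c * x mod p) {1..<p} {1..<p}"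
proof -
  have cop: "coprime c p" using assms prime by (metis coprime_commute prime_imp_coprime)
  have inj: "inj_on (\<lambda>x. c * x mod p) {1..<p}"
  proof
    fix x y assume "x \<in> {1..<p}" "y \<in> {1..<p}" "c * x mod p = c * y mod p"
    then have "[c * x = c * y] (mod p)" by (simp add: cong_def)
    then have "[x = y] (mod p)" using cong_mult_lcancel_nat[OF cop] by blast
    then show "x = y" using \<open>x \<in> _\<close> \<open>y \<in> _\<close> by (simp add: cong_def)
  qed
  have "(\<lambda>x. c * x mod p) ` {1..<p} \<subseteq> {1..<p}"
  proof (intro image_subsetI)
    fix x assume "x \<in> {1..<p}"
    then have "\<not> p dvd c * x"
      using not_dvd_residue assms prime_dvd_mult_iff[OF prime] by blast
    then show "c * x mod p \<in> {1..<p}" using p_pos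
      by (simp add: mod_greater_zero_iff_not_dvd Suc_le_eq)
  qed
  then show ?thesis using inj endo_inj_surj[of "{1..<p}"] by (auto simp: bij_betw_def)
qed

text \<open>
Multiplication by \<open>c\<close> permutes the nonzero residues, so the product of all of them is multiplied
by \<open>c^(p-1)\<close> and at the same time unchanged.
\<close>

lemma fermat_pcong:
  assumes "\<not> p dvd c"
  shows "pcong 1 (of_nat c ^ (p - 1)) 1"
proof -
  have "of_nat c ^ (p - 1) * (\<Prod>x=1..<p. of_nat x) = (\<Prod>x=1..<p. of_nat (c * x) :: rat)"
    by (simp add: prod.distrib)
  also have "pcong 1 \<dots> (\<Prod>x=1..<p. of_nat (c * x mod p))"
  proof (intro pcong_prod)
    fix x
    have "int (c * x) - int (c * x mod p) = int (p * (c * x div p))"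
      by (metis add_diff_cancel_right' mult_div_mod_eq of_nat_add)
    then show "pcong 1 (of_nat (c * x)) (of_nat (c * x mod p))"
      using pcong_of_int[of "int (c * x)" "int (c * x mod p)"] by simp
  qed auto
  also have "\<dots> = (\<Prod>x=1..<p. of_nat x)"
    by (rule prod.reindex_bij_betw[OF bij_betw_mult_mod[OF assms]])
  finally have "pcong 1 (of_nat (fact (p - 1)) * of_nat c ^ (p - 1)) (of_nat (fact (p - 1)) * 1)"
    using p_pos by (simp add: fact_prod mult.commute atLeastLessThanSuc_atLeastAtMost [symmetric])
  moreover have "\<not> p dvd fact (p - 1)" using prime_dvd_fact_iff[OF prime] gt3 by simp
  ultimately show ?thesis using pcong_cancel_nat by blast
qed

text \<open>
The valuation in \<open>padic_val\<close> is read off from lowest terms, while a p-integral witness comes with an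
arbitrary denominator prime to \<open>p\<close>. Comparing the multiplicities in the cross-multiplied equation
makes the choice of the fraction irrelevant.
\<close>

lemma rat_cong_if_pcong: "pcong k x y \<Longrightarrow> rat_cong p k x y"
proof (cases "x = y")
  case False
  assume "pcong k x y"
  then obtain z where z: "z \<in> Zp" "x - y = of_nat p ^ k * z" unfolding pcong_def by blast
  obtain c d where cd: "\<not> int p dvd d" "z = of_int c / of_int d" using z(1) unfolding Zp_def by blast
  obtain n e where q: "quotient_of (x - y) = (n, e)" by force
  have e: "e > 0" "x - y = of_int n / of_int e"
    using quotient_of_denom_pos[OF q] quotient_of_div[OF q] by auto
  have d0: "d \<noteq> 0" using cd(1) by auto
  have n0: "n \<noteq> 0" using False e(2) by auto
  have c0: "c \<noteq> 0" using False z(2) cd(2) by auto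
  have "(of_int (n * d) :: rat) = of_int (int p ^ k * c * e)"
    using z(2) cd(2) e d0 by (simp add: field_simps)
  then have eq: "n * d = int p ^ k * c * e" by (simp only: of_int_eq_iff)
  have pe: "prime_elem (int p)" using prime_int by blast
  have "multiplicity (int p) (n * d) = multiplicity (int p) n + multiplicity (int p) d"
    using n0 d0 by (intro prime_elem_multiplicity_mult_distrib[OF pe])
  moreover have "multiplicity (int p) d = 0"
    using cd(1) by (rule not_dvd_imp_multiplicity_0)
  moreover have "multiplicity (int p) (int p ^ k * c * e)
      = k + multiplicity (int p) c + multiplicity (int p) e"
    using c0 e(1) p_pos pe
    by (simp add: prime_elem_multiplicity_mult_distrib prime_elem_multiplicity_power_distrib
        multiplicity_same_power prime_int)
  ultimately have "multiplicity (int p) n = k + multiplicity (int p) c + multiplicity (int p) e"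
    using eq by simp
  then show ?thesis unfolding rat_cong_def padic_val_def q by simp
qed (simp add: rat_cong_def)

end

section \<open>Polynomials with p-integral coefficients\<close>

lemma poly_eq_sum_le:
  fixes f :: "'a :: comm_semiring_1 poly"
  assumes "degree f \<le> d"
  shows "poly f x = (\<Sum>i\<le>d. coeff f i * x ^ i)"
  unfolding poly_altdef using assms
  by (intro sum.mono_neutral_left) (auto simp: coeff_eq_0)

context odd_prime
begin

definition Zpoly :: "rat poly \<Rightarrow> bool" where
  "Zpoly f \<longleftrightarrow> (\<forall>i. coeff f i \<in> Zp)"

lemma Zpoly_0 [simp]: "Zpoly 0"
  by (simp add: Zpoly_def)

lemma Zpoly_1 [simp]: "Zpoly 1"
  by (auto simp: Zpoly_def coeff_1)

lemma Zpoly_pCons [simp]: "Zpoly (pCons a f) \<longleftrightarrow> a \<in> Zp \<and> Zpoly f"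
  unfolding Zpoly_def by (auto simp: coeff_pCons split: nat.splits)

lemma Zpoly_add [intro]: "Zpoly f \<Longrightarrow> Zpoly g \<Longrightarrow> Zpoly (f + g)"
  by (simp add: Zpoly_def)

lemma Zpoly_diff [intro]: "Zpoly f \<Longrightarrow> Zpoly g \<Longrightarrow> Zpoly (f - g)"
  by (simp add: Zpoly_def)

lemma Zpoly_smult [intro]: "c \<in> Zp \<Longrightarrow> Zpoly f \<Longrightarrow> Zpoly (smult c f)"
  by (simp add: Zpoly_def)

lemma Zpoly_mult [intro]: "Zpoly f \<Longrightarrow> Zpoly g \<Longrightarrow> Zpoly (f * g)"
  by (auto simp: Zpoly_def coeff_mult intro!: Zp_sum)

lemma Zpoly_sum [intro]: "(\<And>i. i \<in> A \<Longrightarrow> Zpoly (f i)) \<Longrightarrow> Zpoly (sum f A)"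
  by (induction A rule: infinite_finite_induct) (auto intro: Zpoly_add)

lemma Zpoly_prod [intro]: "(\<And>i. i \<in> A \<Longrightarrow> Zpoly (f i)) \<Longrightarrow> Zpoly (prod f A)"
  by (induction A rule: infinite_finite_induct) (auto intro: Zpoly_mult)

lemma Zpoly_monom [intro]: "c \<in> Zp \<Longrightarrow> Zpoly (monom c n)"
  by (simp add: Zpoly_def)

lemma Zpoly_pcompose [intro]: "Zpoly f \<Longrightarrow> Zpoly g \<Longrightarrow> Zpoly (pcompose f g)"
  by (induction f) (auto simp: pcompose_pCons intro!: Zpoly_add Zpoly_mult)

lemma Zpoly_synthetic_div: "Zpoly f \<Longrightarrow> x \<in> Zp \<Longrightarrow> Zpoly (synthetic_div f x) \<and> poly f x \<in> Zp"
  by (induction f) auto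

lemma Zp_poly: "Zpoly f \<Longrightarrow> x \<in> Zp \<Longrightarrow> poly f x \<in> Zp"
  using Zpoly_synthetic_div by blast

lemma pcong_poly:
  assumes "Zpoly f" "x \<in> Zp" "y \<in> Zp" "pcong k x y"
  shows "pcong k (poly f x) (poly f y)"
  using assms(1)
proof (induction f)
  case (pCons a f)
  then show ?case using assms Zp_poly by (auto intro!: pcong_add pcong_mult)
qed auto

lemma pcong_coeffs_poly:
  assumes "\<And>i. pcong k (coeff f i) 0" and "x \<in> Zp"
  shows "pcong k (poly f x) 0"
  unfolding poly_altdef
proof (rule pcong_sum_zero)
  fix i
  show "pcong k (coeff f i * x ^ i) 0"
    using pcong_scale_right[OF Zp_power[OF assms(2)] assms(1), of i i] by simp
qed

text \<open>
Lagrange's bound on the number of roots modulo a prime, in the form used for uniqueness of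
interpolation. Splitting off a root \<open>x\<close> by synthetic division keeps the coefficients p-integral,
and the factor \<open>y - x\<close> can be cancelled at every other root \<open>y\<close>.
\<close>

lemma coeffs_pcong_zero_if_many_roots:
  assumes "finite X" "\<And>x. x \<in> X \<Longrightarrow> pcong 1 (poly f (of_int x)) 0"
    and "\<And>x y. x \<in> X \<Longrightarrow> y \<in> X \<Longrightarrow> x \<noteq> y \<Longrightarrow> \<not> int p dvd x - y"
    and "degree f < card X" "Zpoly f"
  shows "pcong 1 (coeff f i) 0"
  using assms
proof (induction X arbitrary: f i rule: finite_induct)
  case (insert x X)
  define q where "q = synthetic_div f (of_int x)"
  have f: "f = [:- of_int x, 1:] * q + [:poly f (of_int x):]"
    unfolding q_def by (rule synthetic_div_correct' [symmetric])
  have Zq: "Zpoly q" unfolding q_def using Zpoly_synthetic_div insert.prems by blast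
  have root: "pcong 1 (poly f (of_int x)) 0" using insert.prems by blast
  have q_root: "pcong 1 (poly q (of_int y)) 0" if "y \<in> X" for y
  proof -
    have "poly f (of_int y) = of_int (y - x) * poly q (of_int y) + poly f (of_int x)"
      using arg_cong[OF f, of "\<lambda>f. poly f (of_int y)"] by (simp add: algebra_simps)
    then have "of_int (y - x) * poly q (of_int y) = poly f (of_int y) - poly f (of_int x)" by simp
    moreover have "pcong 1 (poly f (of_int y) - poly f (of_int x)) (0 - 0)"
      using insert.prems(1) that by (intro pcong_diff) auto
    ultimately have "pcong 1 (of_int (y - x) * poly q (of_int y)) (of_int (y - x) * 0)" by simp
    moreover have "\<not> int p dvd y - x" using insert that by (intro insert.prems(2)) auto
    ultimately show ?thesis using pcong_cancel_int by blast
  qed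
  have q0: "pcong 1 (coeff q j) 0" for j
  proof (cases "q = 0")
    case False
    have "degree q = degree f - 1" by (simp add: q_def degree_synthetic_div)
    moreover have "degree f \<noteq> 0" using False by (auto simp: q_def synthetic_div_eq_0_iff)
    ultimately have "degree q < card X" using insert by simp
    then show ?thesis using insert.IH[of q] q_root insert.prems Zq by blast
  qed auto
  have "coeff f i = - of_int x * coeff q i + (if i = 0 then 0 else coeff q (i - 1))
        + (if i = 0 then poly f (of_int x) else 0)"
    by (subst f) (auto simp: coeff_pCons algebra_simps split: nat.splits)
  also have "pcong 1 \<dots> (- of_int x * 0 + 0 + 0)"
  proof (intro pcong_add pcong_scale)
    show "pcong 1 (if i = 0 then 0 else coeff q (i - 1)) 0" using q0 by auto
    show "pcong 1 (if i = 0 then poly f (rat_of_int x) else 0) 0" using root by auto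
  qed (use q0 in auto)
  finally show ?case by simp
qed simp

section \<open>Power sums modulo p\<close>

definition psum :: "nat \<Rightarrow> rat" where
  "psum k = (\<Sum>x=1..<p. of_nat x ^ k)"

lemma Zp_psum [simp]: "psum k \<in> Zp"
  unfolding psum_def by auto

lemma power_mod_p_minus_1:
  assumes "\<not> p dvd a"
  shows "pcong 1 (of_nat a ^ (q * (p - 1) + r)) (of_nat a ^ r)"
proof -
  have "pcong 1 ((of_nat a ^ (p - 1)) ^ q * of_nat a ^ r) (1 ^ q * of_nat a ^ r)"
    using assms by (intro pcong_scale_right pcong_power fermat_pcong) auto
  moreover have "(of_nat a ^ (p - 1)) ^ q * of_nat a ^ r = (of_nat a ^ (q * (p - 1) + r) :: rat)"
    by (metis power_add power_mult mult.commute)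
  ultimately show ?thesis by simp
qed

text \<open>
If every nonzero residue satisfied \<open>c^k = 1\<close>, then \<open>X^r - 1\<close> with \<open>r = k mod (p - 1)\<close> would have
\<open>p - 1 > r\<close> roots.
\<close>

lemma ex_power_not_pcong_1:
  assumes "\<not> (p - 1) dvd k"
  shows "\<exists>c. \<not> p dvd c \<and> \<not> pcong 1 (of_nat c ^ k) 1"
proof (rule ccontr)
  assume *: "\<not> ?thesis"
  define r where "r = k mod (p - 1)"
  have r: "0 < r" "r < p - 1"
    using assms gt3 by (auto simp: r_def mod_greater_zero_iff_not_dvd)
  define f :: "rat poly" where "f = monom 1 r - 1"
  have deg: "degree f \<le> r"
    unfolding f_def by (intro degree_diff_le) (auto simp: degree_monom_le)
  have roots: "pcong 1 (poly f (of_int x)) 0" if x: "x \<in> int ` {1..<p}" for x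
  proof -
    obtain a where a: "x = int a" "a \<in> {1..<p}" using x by blast
    have na: "\<not> p dvd a" using a(2) by (rule not_dvd_residue)
    have "k = (k div (p - 1)) * (p - 1) + r" by (simp only: r_def div_mult_mod_eq)
    then have "pcong 1 (of_nat a ^ k) (of_nat a ^ r)" using power_mod_p_minus_1[OF na] by metis
    moreover have "pcong 1 (of_nat a ^ k) 1" using * na by blast
    ultimately have "pcong 1 (of_nat a ^ r) 1" using pcong_sym pcong_trans by blast
    then have "pcong 1 (of_nat a ^ r - 1) (1 - 1)" by (intro pcong_diff) auto
    then show ?thesis by (simp add: f_def a(1) poly_monom)
  qed
  have "pcong 1 (coeff f r) 0"
  proof (rule coeffs_pcong_zero_if_many_roots[OF _ roots])
    show "degree f < card (int ` {1..<p})" using deg r by (subst card_image) auto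
    show "Zpoly f" unfolding f_def by (auto simp: one_pCons intro!: Zpoly_diff Zpoly_monom)
    fix x y assume "x \<in> int ` {1..<p}" "y \<in> int ` {1..<p}" "x \<noteq> y"
    then have "x - y \<noteq> 0" "\<bar>x - y\<bar> < int p" by auto
    then show "\<not> int p dvd x - y" using dvd_imp_le_int[of "x - y" "int p"] by auto
  qed auto
  then have "pcong 1 (of_int 1) (of_int 0)" using r by (simp add: f_def)
  then show False unfolding pcong_of_int_iff using gt3 by simp
qed

lemma pcong_add_p_power:
  assumes "r \<in> Zp" "t \<in> Zp"
  shows "pcong 2 ((r + of_nat p * t) ^ Suc k) (r ^ Suc k + of_nat (Suc k) * of_nat p * t * r ^ k)"
proof (induction k)
  case (Suc k)
  have "pcong 2 ((r + of_nat p * t) ^ Suc (Suc k))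
      ((r + of_nat p * t) * (r ^ Suc k + of_nat (Suc k) * of_nat p * t * r ^ k))"
    unfolding power_Suc[of _ "Suc k"] using assms by (intro pcong_scale Suc) auto
  also have "\<dots> = (r ^ Suc (Suc k) + of_nat (Suc (Suc k)) * of_nat p * t * r ^ Suc k)
      + of_nat p ^ 2 * (of_nat (Suc k) * t ^ 2 * r ^ k)"
    by (simp add: algebra_simps power2_eq_square)
  also have "pcong 2 \<dots> ((r ^ Suc (Suc k) + of_nat (Suc (Suc k)) * of_nat p * t * r ^ Suc k) + 0)"
    using assms by (intro pcong_add pcong_refl pcong_prime_power) auto
  finally show ?case by simp
qed auto

text \<open>
Voronoi's device: write \<open>cx = (cx mod p) + p (cx div p)\<close>, raise to a power modulo \<open>p^2\<close> and sum. The
residues \<open>cx mod p\<close> permute \<open>1, \<dots>, p - 1\<close>, so modulo \<open>p^2\<close> the power sum times \<open>c^k - 1\<close> equals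
\<open>p k\<close> times a sum \<open>\<tau>\<close>, which modulo \<open>p\<close> depends on \<open>k\<close> only modulo \<open>p - 1\<close>.
\<close>

lemma psum_multiplier:
  fixes c k :: nat
  assumes "\<not> p dvd c"
  defines "\<tau> \<equiv> (\<lambda>k. \<Sum>x=1..<p. of_nat (c * x div p) * of_nat (c * x mod p) ^ k :: rat)"
  shows "pcong 2 ((of_nat c ^ Suc k - 1) * psum (Suc k)) (of_nat p * (of_nat (Suc k) * \<tau> k))"
    and "pcong 1 (\<tau> (k + (p - 1))) (\<tau> k)"
proof -
  have "of_nat c ^ Suc k * psum (Suc k)
      = (\<Sum>x=1..<p. (of_nat (c * x mod p) + of_nat p * of_nat (c * x div p)) ^ Suc k)"
    unfolding psum_def sum_distrib_left
  proof (intro sum.cong refl)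
    fix x
    have "of_nat c * of_nat x = (of_nat (c * x mod p + p * (c * x div p)) :: rat)" by simp
    then show "of_nat c ^ Suc k * of_nat x ^ Suc k
        = (of_nat (c * x mod p) + of_nat p * of_nat (c * x div p) :: rat) ^ Suc k"
      by (simp only: of_nat_add of_nat_mult flip: power_mult_distrib)
  qed
  also have "pcong 2 \<dots> (\<Sum>x=1..<p. of_nat (c * x mod p) ^ Suc k
      + of_nat (Suc k) * of_nat p * of_nat (c * x div p) * of_nat (c * x mod p) ^ k)"
    by (intro pcong_sum pcong_add_p_power) auto
  also have "\<dots> = (\<Sum>x=1..<p. of_nat (c * x mod p) ^ Suc k) + of_nat p * (of_nat (Suc k) * \<tau> k)"
    by (simp add: sum.distrib \<tau>_def sum_distrib_left mult_ac)
  also have "(\<Sum>x=1..<p. of_nat (c * x mod p) ^ Suc k) = psum (Suc k)"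
    unfolding psum_def by (rule sum.reindex_bij_betw[OF bij_betw_mult_mod[OF assms(1)]])
  finally have "pcong 2 (of_nat c ^ Suc k * psum (Suc k) - psum (Suc k))
      (psum (Suc k) + of_nat p * (of_nat (Suc k) * \<tau> k) - psum (Suc k))"
    by (rule pcong_diff) auto
  then show "pcong 2 ((of_nat c ^ Suc k - 1) * psum (Suc k)) (of_nat p * (of_nat (Suc k) * \<tau> k))"
    by (simp add: left_diff_distrib)
  show "pcong 1 (\<tau> (k + (p - 1))) (\<tau> k)" unfolding \<tau>_def
  proof (intro pcong_sum pcong_scale)
    fix x assume "x \<in> {1..<p}"
    then have "c * x mod p \<in> {1..<p}" using bij_betw_mult_mod[OF assms(1)]
      by (metis (lifting) bij_betwE)
    then show "pcong 1 (of_nat (c * x mod p) ^ (k + (p - 1))) (of_nat (c * x mod p) ^ k)"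
      using power_mod_p_minus_1[OF not_dvd_residue, of "c * x mod p" 1 k] by (simp add: add.commute)
  qed auto
qed

lemma Zp_power_minus_1_unit:
  assumes "\<not> pcong 1 (of_nat c ^ k) 1"
  shows "\<not> int p dvd int c ^ k - 1"
  using assms pcong_of_int_iff[of "int c ^ k" 1] by simp

lemma psum_pcong_zero:
  assumes "\<not> (p - 1) dvd k"
  shows "pcong 1 (psum k) 0"
proof -
  obtain c where c: "\<not> p dvd c" "\<not> pcong 1 (of_nat c ^ k) 1" using ex_power_not_pcong_1[OF assms] by blast
  obtain k' where k: "k = Suc k'" using assms by (cases k) auto
  have "pcong 1 ((of_nat c ^ k - 1) * psum k)
     (of_nat p ^ 1 * (of_nat k * (\<Sum>x=1..<p. of_nat (c * x div p) * of_nat (c * x mod p) ^ k')))"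
    using pcong_weaken[OF psum_multiplier(1)[OF c(1), of k'], of 1] by (simp add: k)
  also have "pcong 1 \<dots> 0" by (intro pcong_prime_power) (auto intro!: Zp_sum)
  finally have "pcong 1 (of_int (int c ^ k - 1) * psum k) (of_int (int c ^ k - 1) * 0)" by simp
  then show ?thesis using pcong_cancel_int Zp_power_minus_1_unit[OF c(2)] by blast
qed

lemma psum_pcong_minus_1:
  assumes "(p - 1) dvd k"
  shows "pcong 1 (psum k) (- 1)"
proof -
  obtain q where q: "k = (p - 1) * q" using assms by blast
  have "pcong 1 (psum k) (\<Sum>x=1..<p. 1)"
    unfolding psum_def
  proof (intro pcong_sum)
    fix x assume "x \<in> {1..<p}"
    then show "pcong 1 (of_nat x ^ k) 1"
      using power_mod_p_minus_1[OF not_dvd_residue, of x q 0] by (simp add: q mult.commute)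
  qed
  also have "(\<Sum>x=1..<p. 1 :: rat) = of_nat p - 1" using p_pos by (simp add: of_nat_diff)
  also have "pcong 1 \<dots> (- 1)" using pcong_p_minus[of 1] .
  finally show ?thesis .
qed

text \<open>
Kummer's congruence, stated for power sums. Applying \<open>psum_multiplier\<close> to the exponents \<open>e\<close> and
\<open>K = e + (p - 1)\<close> with the same \<open>c\<close> eliminates \<open>\<tau>\<close> and yields \<open>e P(K) = K P(e)\<close> modulo \<open>p^2\<close>. As
\<open>K = e - 1\<close> modulo \<open>p\<close> and \<open>P(e) = 0\<close> modulo \<open>p\<close>, the factor \<open>K\<close> may be replaced by \<open>e - 1\<close>.
\<close>

lemma psum_kummer:
  assumes "\<not> (p - 1) dvd e"
  shows "pcong 2 (of_nat e * psum (e + (p - 1))) ((of_nat e - 1) * psum e)"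
proof -
  define K where "K = e + (p - 1)"
  obtain c where c: "\<not> p dvd c" "\<not> pcong 1 (of_nat c ^ e) 1" using ex_power_not_pcong_1[OF assms] by blast
  obtain e' where e: "e = Suc e'" using assms by (cases e) auto
  have K: "K = Suc (e' + (p - 1))" by (simp add: K_def e)
  define \<tau> where "\<tau> = (\<lambda>k. \<Sum>x=1..<p. of_nat (c * x div p) * of_nat (c * x mod p) ^ k :: rat)"
  have [simp]: "\<tau> k \<in> Zp" for k unfolding \<tau>_def by (auto intro!: Zp_sum)
  have A: "pcong 2 ((of_nat c ^ e - 1) * psum e) (of_nat p * (of_nat e * \<tau> e'))"
    using psum_multiplier(1)[OF c(1), of e'] by (simp add: e \<tau>_def)
  have B: "pcong 2 ((of_nat c ^ K - 1) * psum K) (of_nat p * (of_nat K * \<tau> (e' + (p - 1))))"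
    using psum_multiplier(1)[OF c(1), of "e' + (p - 1)"] by (simp only: K \<tau>_def)
  have psumK: "pcong 1 (psum K) 0" using assms psum_pcong_zero[of K] by (simp add: K_def dvd_add_left_iff)
  have cK: "pcong 1 (of_nat c ^ K) (of_nat c ^ e)"
    using power_mod_p_minus_1[OF c(1), of 1 e] by (simp add: K_def add.commute)
  have small: "pcong 2 (x * psum k) 0" if x: "pcong 1 x 0" and k: "pcong 1 (psum k) 0" for x k
  proof -
    obtain y where y: "y \<in> Zp" "x = of_nat p * y" using x unfolding pcong_def by auto
    obtain z where z: "z \<in> Zp" "psum k = of_nat p * z" using k unfolding pcong_def by auto
    have "x * psum k = of_nat p ^ 2 * (y * z)" by (simp add: y z power2_eq_square)
    then show ?thesis using pcong_prime_power[OF Zp_mult, of y z 2] y(1) z(1) by (simp only:)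
  qed
  \<comment> \<open>\<open>c^K\<close> and \<open>c^e\<close> agree modulo \<open>p\<close> only; the missing factor \<open>p\<close> is supplied by \<open>P(K)\<close>.\<close>
  have B': "pcong 2 ((of_nat c ^ e - 1) * psum K) (of_nat p * (of_nat K * \<tau> e'))"
  proof -
    have "pcong 1 (of_nat c ^ e - of_nat c ^ K) (of_nat c ^ K - of_nat c ^ K)"
      by (intro pcong_diff pcong_sym[OF cK]) auto
    then have "pcong 2 ((of_nat c ^ e - of_nat c ^ K) * psum K) 0"
      using psumK by (intro small) auto
    then have "pcong 2 ((of_nat c ^ K - 1) * psum K + (of_nat c ^ e - of_nat c ^ K) * psum K)
       (of_nat p * (of_nat K * \<tau> (e' + (p - 1))) + 0)" by (intro pcong_add B)
    also have "\<dots> = of_nat p * (of_nat K * \<tau> (e' + (p - 1)))" by simp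
    also have "pcong 2 \<dots> (of_nat p * (of_nat K * \<tau> e'))"
      unfolding pcong_times_p \<tau>_def by (intro pcong_scale psum_multiplier(2) c(1)) auto
    finally show ?thesis by (simp add: left_diff_distrib)
  qed
  have "pcong 2 (of_nat e * ((of_nat c ^ e - 1) * psum K) - of_nat K * ((of_nat c ^ e - 1) * psum e))
     (of_nat e * (of_nat p * (of_nat K * \<tau> e')) - of_nat K * (of_nat p * (of_nat e * \<tau> e')))"
    by (intro pcong_diff pcong_scale A B') auto
  moreover have "of_nat e * ((of_nat c ^ e - 1) * psum K) - of_nat K * ((of_nat c ^ e - 1) * psum e)
      = of_int (int c ^ e - 1) * (of_nat e * psum K - of_nat K * psum e)"
    by (simp add: right_diff_distrib)
  ultimately have "pcong 2 (of_int (int c ^ e - 1) * (of_nat e * psum K - of_nat K * psum e)) (of_int (int c ^ e - 1) * 0)"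
    by (simp add: mult_ac)
  then have "pcong 2 (of_nat e * psum K - of_nat K * psum e) 0"
    using pcong_cancel_int Zp_power_minus_1_unit[OF c(2)] by blast
  moreover have "pcong 2 ((of_nat K - of_nat e + 1) * psum e) 0"
  proof (rule small)
    have "(of_nat K - of_nat e + 1 :: rat) = of_nat p" using p_pos by (simp add: K_def of_nat_diff)
    then show "pcong 1 (of_nat K - of_nat e + 1) 0" using pcong_prime_power[of 1 1] by simp
  qed (rule psum_pcong_zero[OF assms])
  ultimately have "pcong 2 ((of_nat e * psum K - of_nat K * psum e) + (of_nat K - of_nat e + 1) * psum e
      + (of_nat e - 1) * psum e) (0 + 0 + (of_nat e - 1) * psum e)"
    by (intro pcong_add) auto
  then show ?thesis by (simp add: algebra_simps K_def)
qed

text \<open>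
Coefficient extraction by orthogonality: the power sum of exponent \<open>i + (p - 1 - j)\<close> is \<open>-1\<close> modulo
\<open>p\<close> for \<open>i = j\<close> and \<open>0\<close> for the other \<open>i \<le> p - 2\<close>. The residues are listed as \<open>2, 4, \<dots>, 2(p-1)\<close>
because the values of the remainder polynomials are known along arithmetic progressions with
difference \<open>2\<close>.
\<close>

lemma coeff_by_power_sums:
  assumes "Zpoly f" "degree f \<le> p - 2" "j \<le> p - 2"
  shows "pcong 1 (\<Sum>t=1..<p. poly f (2 * of_nat t) * (2 * of_nat t) ^ (p - 1 - j)) (- coeff f j)"
proof -
  have two: "pcong 1 (2 ^ (p - 1)) 1" using fermat_pcong[OF not_dvd_2] by simp
  have "(\<Sum>t=1..<p. poly f (2 * of_nat t) * (2 * of_nat t) ^ (p - 1 - j))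
      = (\<Sum>i\<le>p - 2. coeff f i * (2 ^ (i + (p - 1 - j)) * psum (i + (p - 1 - j))))"
    unfolding poly_eq_sum_le[OF assms(2)] psum_def sum_distrib_left sum_distrib_right
    by (subst sum.swap) (simp add: power_add power_mult_distrib mult_ac)
  also have "pcong 1 \<dots> (\<Sum>i\<le>p - 2. if i = j then - coeff f i else 0)"
  proof (rule pcong_sum)
    fix i assume i: "i \<in> {..p - 2}"
    show "pcong 1 (coeff f i * (2 ^ (i + (p - 1 - j)) * psum (i + (p - 1 - j))))
       (if i = j then - coeff f i else 0)"
    proof (cases "i = j")
      case True
      have "pcong 1 (coeff f i * (2 ^ (p - 1) * psum (p - 1))) (coeff f i * (1 * (- 1)))"
        using assms two psum_pcong_minus_1 by (intro pcong_scale pcong_mult) (auto simp: Zpoly_def)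
      moreover have "i + (p - 1 - j) = p - 1" using True assms(3) by simp
      ultimately show ?thesis using True by simp
    next
      case False
      have "\<not> (p - 1) dvd i + (p - 1 - j)"
      proof
        assume "(p - 1) dvd i + (p - 1 - j)"
        then obtain q where q: "i + (p - 1 - j) = (p - 1) * q" by blast
        consider "q = 0" | "q = 1" | "q \<ge> 2" by linarith
        then show False
        proof cases
          assume "q \<ge> 2"
          then have "(p - 1) * 2 \<le> i + (p - 1 - j)" unfolding q by (rule mult_le_mono2)
          moreover have "i + (p - 1 - j) \<le> (p - 2) + (p - 1)" using i by (intro add_mono) auto
          ultimately show False using gt3 by linarith
        qed (use q i assms(3) False gt3 in auto)
      qed
      then have "pcong 1 (coeff f i * (2 ^ (i + (p - 1 - j)) * psum (i + (p - 1 - j)))) (coeff f i * (2 ^ (i + (p - 1 - j)) * 0))"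
        using assms psum_pcong_zero by (intro pcong_scale) (auto simp: Zpoly_def)
      then show ?thesis using False by simp
    qed
  qed
  also have "\<dots> = - coeff f j" using assms(3) by simp
  finally show ?thesis .
qed

end

section \<open>Bernoulli numbers\<close>

definition bernpoly :: "nat \<Rightarrow> rat \<Rightarrow> rat" where
  "bernpoly n x = (\<Sum>j\<le>n. of_nat (n choose j) * bernoulli j * x ^ (n - j))"

lemma bernpoly_egf:
  "bernpoly n x = fact n * fps_nth (Abs_fps (\<lambda>k. bernoulli k / fact k) * fps_exp x) n"
  unfolding bernpoly_def fps_mult_nth sum_distrib_left atLeast0AtMost
  by (intro sum.cong refl) (simp add: binomial_fact)

text \<open>
Multiplying the generating function \<open>t e^(xt) / (e^t - 1)\<close> by \<open>e^t - 1\<close> leaves \<open>t e^(xt)\<close>.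
\<close>

lemma bernpoly_diff: "bernpoly n (x + 1) - bernpoly n x = of_nat n * x ^ (n - 1)"
proof -
  let ?B = "Abs_fps (\<lambda>k. bernoulli k / fact k)"
  have "bernpoly n (x + 1) - bernpoly n x
      = fact n * fps_nth (?B * (fps_exp 1 - 1) * fps_exp x) n"
    unfolding bernpoly_egf fps_exp_add_mult
    by (simp add: algebra_simps flip: fps_sub_nth right_diff_distrib)
  also have "\<dots> = of_nat n * x ^ (n - 1)"
    unfolding bernoulli_egf by (cases n) (auto simp del: of_nat_Suc)
  finally show ?thesis .
qed

lemma bernpoly_0: "bernpoly n 0 = bernoulli n"
  unfolding bernpoly_def by (subst sum.remove[of _ n]) (auto intro!: sum.neutral)

text \<open>
The difference equation at \<open>x = 0\<close> between \<open>B\<^sub>k\<^sub>+\<^sub>1(1)\<close> and \<open>B\<^sub>k\<^sub>+\<^sub>1(0)\<close>, as a recursion for \<open>B\<^sub>k\<close>. The only division is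
by \<open>k + 1\<close>, which is why \<open>B\<^sub>0, \<dots>, B\<^sub>p\<^sub>-\<^sub>2\<close> are p-integral.
\<close>

lemma bernoulli_rec:
  "of_nat (Suc k) * bernoulli k = of_nat (Suc k) * 0 ^ k - (\<Sum>j<k. of_nat (Suc k choose j) * bernoulli j)"
proof -
  have "bernpoly (Suc k) 1 = (\<Sum>j<k. of_nat (Suc k choose j) * bernoulli j)
      + of_nat (Suc k) * bernoulli k + bernoulli (Suc k)"
    by (simp add: bernpoly_def flip: lessThan_Suc_atMost)
  moreover have "bernpoly (Suc k) 1 - bernoulli (Suc k) = of_nat (Suc k) * 0 ^ k"
    using bernpoly_diff[of "Suc k" 0] by (simp add: bernpoly_0)
  ultimately show ?thesis by simp
qed

lemma sum_powers_bernpoly: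
  "of_nat (Suc k) * (\<Sum>x<n. of_nat x ^ k) = bernpoly (Suc k) (of_nat n) - bernoulli (Suc k)"
proof (induction n)
  case (Suc n)
  then show ?case using bernpoly_diff[of "Suc k" "of_nat n"]
    by (simp add: algebra_simps)
qed (simp add: bernpoly_0)

section \<open>Splitting sums by parity and by reflection\<close>

lemma sum_split_parity:
  fixes f :: "nat \<Rightarrow> 'a :: comm_monoid_add"
  shows "(\<Sum>t=1..<2 * n + 1. f t) = (\<Sum>i<n. f (2 * i + 1)) + (\<Sum>x=1..n. f (2 * x))"
proof (induction n)
  case (Suc n)
  have "(\<Sum>t=1..<2 * Suc n + 1. f t) = (\<Sum>t=1..<2 * n + 1. f t) + f (2 * n + 1) + f (2 * n + 2)"
    by (simp add: numeral_2_eq_2)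
  then show ?case unfolding Suc by (simp add: add_ac)
qed simp

lemma sum_split_reflect:
  fixes f :: "nat \<Rightarrow> 'a :: comm_monoid_add"
  shows "(\<Sum>t=1..<2 * n + 1. f t) = (\<Sum>x=1..n. f x + f (2 * n + 1 - x))"
proof -
  have "(\<Sum>t=1..<2 * n + 1. f t) = (\<Sum>t=1..n. f t) + (\<Sum>t=n + 1..<2 * n + 1. f t)"
    using sum.atLeastLessThan_concat[of 1 "n + 1" "2 * n + 1" f, symmetric]
    by (simp only: Suc_eq_plus1 [symmetric] atLeastLessThanSuc_atLeastAtMost)
  also have "(\<Sum>t=n + 1..<2 * n + 1. f t) = (\<Sum>x=1..n. f (2 * n + 1 - x))"
    by (rule sum.reindex_bij_witness[of _ "\<lambda>x. 2 * n + 1 - x" "\<lambda>x. 2 * n + 1 - x"]) auto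
  finally show ?thesis by (simp add: sum.distrib)
qed

lemma sum_odd_reflect:
  fixes f :: "nat \<Rightarrow> 'a :: comm_monoid_add"
  shows "(\<Sum>i<n. f (2 * i + 1)) = (\<Sum>x=1..n. f (2 * n + 1 - 2 * x))"
  by (rule sum.reindex_bij_witness[of _ "\<lambda>x. n - x" "\<lambda>i. n - i"])
     (auto simp: algebra_simps diff_mult_distrib2 Suc_diff_le)

context odd_prime
begin

definition N :: nat where "N = (p - 1) div 2"

lemma two_N: "2 * N + 1 = p"
  using odd_p unfolding N_def by (auto elim!: oddE)

lemma N_gt_1: "N > 1"
  using two_N gt3 by linarith

lemma Zp_bernoulli: "k \<le> p - 2 \<Longrightarrow> bernoulli k \<in> Zp"
proof (induction k rule: less_induct)
  case (less k)
  have "of_nat (Suc k) * bernoulli k \<in> Zp"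
    unfolding bernoulli_rec using less by (auto intro!: Zp_sum)
  moreover have "\<not> p dvd Suc k" using less.prems gt3 by (intro not_dvd_less) auto
  ultimately have "of_nat (Suc k) * bernoulli k / of_nat (Suc k) \<in> Zp" by (rule Zp_divide_nat)
  then show ?case by (simp del: of_nat_Suc)
qed

text \<open>
In Faulhaber's formula all terms but the linear one carry a factor \<open>p^2\<close>, and their coefficients are
p-integral because only \<open>B\<^sub>j\<close> with \<open>j \<le> p - 2\<close> occur.
\<close>

lemma psum_bernoulli:
  assumes "0 < e" "e \<le> p - 2"
  shows "pcong 2 (psum e) (of_nat p * bernoulli e)"
proof -
  have e: "\<not> p dvd Suc e" using assms gt3 by (intro not_dvd_less) auto
  have "(\<Sum>x<p. of_nat x ^ e) = psum e"
    unfolding psum_def using assms p_pos by (intro sum.mono_neutral_right) (auto simp: not_le)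
  then have "of_nat (Suc e) * psum e = bernpoly (Suc e) (of_nat p) - bernoulli (Suc e)"
    using sum_powers_bernpoly[where n = p and k = e] by simp
  also have "\<dots> = (\<Sum>j<e. of_nat p ^ 2 * (of_nat (Suc e choose j) * bernoulli j * of_nat p ^ (e - 1 - j)))
     + of_nat (Suc e) * (of_nat p * bernoulli e)"
  proof -
    have "(\<Sum>j<e. of_nat (Suc e choose j) * bernoulli j * of_nat p ^ (Suc e - j))
       = (\<Sum>j<e. of_nat p ^ 2 * (of_nat (Suc e choose j) * bernoulli j * of_nat p ^ (e - 1 - j)))"
    proof (intro sum.cong refl)
      fix j assume "j \<in> {..<e}"
      then have "Suc e - j = 2 + (e - 1 - j)" by auto
      then show "of_nat (Suc e choose j) * bernoulli j * of_nat p ^ (Suc e - j)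
          = of_nat p ^ 2 * (of_nat (Suc e choose j) * bernoulli j * of_nat p ^ (e - 1 - j))"
        by (simp only: power_add mult_ac)
    qed
    then show ?thesis by (simp add: bernpoly_def flip: lessThan_Suc_atMost)
  qed
  also have "pcong 2 \<dots> (0 + of_nat (Suc e) * (of_nat p * bernoulli e))"
    using assms by (intro pcong_add pcong_sum_zero pcong_prime_power pcong_refl Zp_mult Zp_bernoulli) auto
  finally show ?thesis using pcong_cancel_nat[OF e] by simp
qed

section \<open>Power sums modulo the square of p\<close>

lemma pcong_reflect_power:
  assumes "y \<in> Zp" "even k"
  shows "pcong 2 ((of_nat p - y) ^ k) (y ^ k - of_nat k * of_nat p * y ^ (k - 1))"
proof (cases k)
  case (Suc k')
  have "odd k'" using assms Suc by simp
  then show ?thesis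
    using pcong_add_p_power[of "- y" 1 k'] assms by (simp add: Suc algebra_simps)
qed auto

definition odd_psum :: "nat \<Rightarrow> rat" where
  "odd_psum k = (\<Sum>i<N. (2 * of_nat i + 1) ^ k)"

lemma odd_psum_alt: "odd_psum k = (\<Sum>i<N. of_nat (2 * i + 1) ^ k)"
  by (simp only: odd_psum_def of_nat_add of_nat_mult of_nat_numeral of_nat_1)

lemma odd_psum_reflect: "odd_psum k = (\<Sum>x=1..N. (of_nat p - 2 * of_nat x) ^ k)"
  unfolding odd_psum_alt sum_odd_reflect[where n = N and f = "\<lambda>n. of_nat n ^ k", unfolded two_N]
  using two_N by (intro sum.cong refl) (auto simp: of_nat_diff)

lemma psum_reflect: "psum k = (\<Sum>x=1..N. of_nat x ^ k + (of_nat p - of_nat x) ^ k)"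
  unfolding psum_def sum_split_reflect[where n = N, unfolded two_N]
  using two_N by (intro sum.cong refl) (auto simp: of_nat_diff)

lemma psum_parity: "psum k = odd_psum k + (\<Sum>x=1..N. (2 * of_nat x) ^ k)"
  unfolding psum_def odd_psum_alt sum_split_parity[where n = N, unfolded two_N]
  by (simp only: of_nat_mult of_nat_numeral)

text \<open>
The odd numbers below \<open>p\<close> are the \<open>p - 2x\<close> with \<open>1 \<le> x \<le> N\<close>, and all numbers below \<open>p\<close> are the \<open>x\<close> and
\<open>p - x\<close>. Expanding to first order in \<open>p\<close>, both sides become the same sum over \<open>x\<close> term by term.
\<close>

lemma pcong_odd_psum:
  assumes "even k" "k > 0"
  shows "pcong 2 (2 * odd_psum k) (2 ^ k * psum k)"
proof -
  have k: "2 * (2 :: rat) ^ (k - 1) = 2 ^ k" using assms by (metis power_minus_mult mult.commute)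
  have "pcong 2 (2 * odd_psum k) (2 * (\<Sum>x=1..N. (2 * of_nat x) ^ k - of_nat k * of_nat p * (2 * of_nat x) ^ (k - 1)))"
    unfolding odd_psum_reflect using assms by (intro pcong_scale pcong_sum pcong_reflect_power) auto
  also have "\<dots> = 2 ^ k * (\<Sum>x=1..N. of_nat x ^ k + (of_nat x ^ k - of_nat k * of_nat p * of_nat x ^ (k - 1)))"
    unfolding sum_distrib_left
    by (intro sum.cong refl) (simp add: power_mult_distrib algebra_simps flip: k)
  also have "pcong 2 \<dots> (2 ^ k * psum k)"
    unfolding psum_reflect using assms by (intro pcong_scale pcong_sum pcong_add pcong_sym[OF pcong_reflect_power]) auto
  finally show ?thesis .
qed

lemma pcong_odd_psum_kummer:
  assumes "even e" "\<not> (p - 1) dvd e"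
  shows "pcong 2 (of_nat e * odd_psum (e + (p - 1))) ((of_nat e - 1) * odd_psum e)"
proof -
  define K where "K = e + (p - 1)"
  have K: "even K" "K > 0" using assms odd_p gt3 by (auto simp: K_def)
  have e: "e > 0" using assms by (intro Nat.gr0I) auto
  have zero: "pcong 1 (psum K) 0"
    using assms by (intro psum_pcong_zero) (simp add: K_def)
  have "pcong 2 (of_nat e * (2 * odd_psum K)) (of_nat e * (2 ^ K * psum K))"
    by (intro pcong_scale pcong_odd_psum K) auto
  also have "pcong 2 \<dots> (of_nat e * (2 ^ e * psum K))"
  proof (rule pcong_scale)
    obtain y where y: "y \<in> Zp" "psum K = of_nat p * y" using zero unfolding pcong_def by auto
    have "pcong 1 (2 ^ K * y) (2 ^ e * y)"
      using power_mod_p_minus_1[OF not_dvd_2, of 1 e] y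
      by (intro pcong_scale_right) (auto simp: K_def add.commute)
    then show "pcong 2 (2 ^ K * psum K) (2 ^ e * psum K)"
      unfolding y(2) mult.left_commute[of _ "of_nat p"] pcong_times_p .
  qed auto
  also have "\<dots> = 2 ^ e * (of_nat e * psum K)" by simp
  also have "pcong 2 \<dots> (2 ^ e * ((of_nat e - 1) * psum e))"
    unfolding K_def by (intro pcong_scale psum_kummer assms) auto
  also have "\<dots> = (of_nat e - 1) * (2 ^ e * psum e)" by simp
  also have "pcong 2 \<dots> ((of_nat e - 1) * (2 * odd_psum e))"
    using e assms by (intro pcong_scale pcong_sym[OF pcong_odd_psum]) auto
  finally have "pcong 2 (of_nat 2 * (of_nat e * odd_psum K)) (of_nat 2 * ((of_nat e - 1) * odd_psum e))"
    by (simp add: mult_ac)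
  then show ?thesis using pcong_cancel_nat[OF not_dvd_2] by (simp add: K_def)
qed

definition alt_psum :: "nat \<Rightarrow> rat" where
  "alt_psum k = (\<Sum>t=1..<p. (- 1) ^ t * of_nat t ^ k)"

text \<open>
Let \<open>h\<close> be the sum of \<open>x^(e-1)\<close> over \<open>1 \<le> x \<le> N\<close>. Modulo \<open>p\<close> the alternating sum is \<open>2^e h\<close>, since
twice the even part minus a vanishing full power sum remains. The value of \<open>h\<close> itself comes from
exponent \<open>e\<close> modulo \<open>p^2\<close>: reflecting \<open>2x\<close> to \<open>p - 2x\<close> compares the even and the odd part of
\<open>P(e)\<close>, and the first-order term of this comparison is \<open>e p 2^(e-1) h\<close>.
\<close>

lemma alt_psum_bernoulli:
  assumes "even e" "0 < e" "e \<le> p - 2"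
  shows "pcong 1 (of_nat e * alt_psum (e - 1)) (2 * (1 - 2 ^ e) * bernoulli e)"
proof -
  define h where "h = (\<Sum>x=1..N. of_nat x ^ (e - 1) :: rat)"
  have h: "h \<in> Zp" unfolding h_def by auto
  have two: "2 * (2 :: rat) ^ (e - 1) = 2 ^ e" using assms by (metis power_minus_mult mult.commute)
  have "alt_psum (e - 1) + psum (e - 1) = (\<Sum>t=1..<p. (1 + (- 1) ^ t) * of_nat t ^ (e - 1))"
    unfolding alt_psum_def psum_def by (simp add: algebra_simps sum.distrib)
  also have "\<dots> = (\<Sum>x=1..N. 2 * (2 * of_nat x) ^ (e - 1))"
    unfolding sum_split_parity[where n = N, unfolded two_N] by simp
  also have "\<dots> = 2 ^ e * h"
    by (simp add: h_def sum_distrib_left power_mult_distrib mult.assoc flip: two)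
  finally have sum_eq: "alt_psum (e - 1) = 2 ^ e * h - psum (e - 1)" by simp
  have "\<not> (p - 1) dvd e - 1"
  proof
    assume "(p - 1) dvd e - 1"
    moreover have "even (p - 1)" using odd_p by simp
    ultimately have "even (e - 1)" using dvd_trans by blast
    then show False using assms by simp
  qed
  then have "pcong 1 (alt_psum (e - 1)) (2 ^ e * h - 0)"
    unfolding sum_eq by (intro pcong_diff psum_pcong_zero pcong_refl)
  then have alt: "pcong 1 (alt_psum (e - 1)) (2 ^ e * h)" by (simp only: diff_0_right)
  have "pcong 2 (odd_psum e) (\<Sum>x=1..N. (2 * of_nat x) ^ e - of_nat e * of_nat p * (2 * of_nat x) ^ (e - 1))"
    unfolding odd_psum_reflect using assms by (intro pcong_sum pcong_reflect_power) auto
  also have "\<dots> = (\<Sum>x=1..N. (2 * of_nat x) ^ e) - of_nat p * (of_nat e * 2 ^ (e - 1) * h)"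
    unfolding h_def sum_subtractf sum_distrib_left power_mult_distrib
    by (simp add: mult_ac)
  also have "\<dots> = psum e - odd_psum e - of_nat p * (of_nat e * 2 ^ (e - 1) * h)"
    using psum_parity[of e] by simp
  finally have "pcong 2 (psum e - odd_psum e - odd_psum e)
     (psum e - odd_psum e - (psum e - odd_psum e - of_nat p * (of_nat e * 2 ^ (e - 1) * h)))"
    by (intro pcong_diff) auto
  then have "pcong 2 (psum e - 2 * odd_psum e) (of_nat p * (of_nat e * 2 ^ (e - 1) * h))" by simp
  then have *: "pcong 2 (of_nat p * (of_nat e * 2 ^ (e - 1) * h)) (psum e - 2 * odd_psum e)"
    by (rule pcong_sym)
  have "of_nat p * (of_nat e * (2 ^ e * h)) = 2 * (of_nat p * (of_nat e * 2 ^ (e - 1) * h))"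
    by (simp flip: two)
  also have "pcong 2 \<dots> (2 * (psum e - 2 * odd_psum e))"
    using * by (rule pcong_scale[rotated]) auto
  also have "pcong 2 \<dots> (2 * (psum e - 2 ^ e * psum e))"
    using assms by (intro pcong_scale pcong_diff pcong_odd_psum) auto
  also have "\<dots> = 2 * (1 - 2 ^ e) * psum e" by (simp add: algebra_simps)
  also have "pcong 2 \<dots> (2 * (1 - 2 ^ e) * (of_nat p * bernoulli e))"
    using assms by (intro pcong_scale psum_bernoulli) auto
  also have "\<dots> = of_nat p * (2 * (1 - 2 ^ e) * bernoulli e)" by simp
  finally have "pcong 1 (of_nat e * (2 ^ e * h)) (2 * (1 - 2 ^ e) * bernoulli e)"
    unfolding pcong_times_p .
  moreover have "pcong 1 (of_nat e * alt_psum (e - 1)) (of_nat e * (2 ^ e * h))"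
    by (intro pcong_scale alt) auto
  ultimately show ?thesis using pcong_trans by blast
qed

end

section \<open>Generating polynomials of the multiple sums\<close>

lemma Hbar2_0_right: "Hbar2 k 0 = 1"
proof -
  have "{ks. length ks = 0 \<and> sorted_wrt (<) ks \<and> set ks \<subseteq> {..<k}} = {[]}" by auto
  then show ?thesis by (simp add: Hbar2_def)
qed

lemma Hbar2_0_Suc: "Hbar2 0 (Suc r) = 0"
proof -
  have "{ks. length ks = Suc r \<and> sorted_wrt (<) ks \<and> set ks \<subseteq> {..<0::nat}} = {}" by auto
  then show ?thesis by (simp only: Hbar2_def sum.empty)
qed

lemma Hbar2_Suc_Suc:
  "Hbar2 (Suc k) (Suc r) = Hbar2 k (Suc r) + Hbar2 k r / (2 * of_nat k + 1) ^ 2"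
proof -
  define I where "I = (\<lambda>k r. {ks. length ks = r \<and> sorted_wrt (<) ks \<and> set ks \<subseteq> {..<k::nat}})"
  define w where "w = (\<lambda>ks. \<Prod>k\<leftarrow>ks. 1 / (2 * of_nat k + 1) ^ 2 :: rat)"
  have H: "Hbar2 k r = sum w (I k r)" for k r by (simp add: Hbar2_def I_def w_def)
  have fin: "finite (I k r)" for k r unfolding I_def by (rule finite_Hbar2_indices)
  have eq: "I (Suc k) (Suc r) = I k (Suc r) \<union> (\<lambda>ks. ks @ [k]) ` I k r"
  proof (intro equalityI subsetI)
    fix ks assume ks: "ks \<in> I (Suc k) (Suc r)"
    then have "ks \<noteq> []" by (auto simp: I_def)
    then obtain xs x where x: "ks = xs @ [x]" by (metis append_butlast_last_id)
    show "ks \<in> I k (Suc r) \<union> (\<lambda>ks. ks @ [k]) ` I k r"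
    proof (cases "x = k")
      case True
      then show ?thesis using ks x by (auto simp: I_def sorted_wrt_append)
    next
      case False
      then show ?thesis using ks x by (fastforce simp: I_def sorted_wrt_append)
    qed
  next
    fix ks assume "ks \<in> I k (Suc r) \<union> (\<lambda>ks. ks @ [k]) ` I k r"
    then show "ks \<in> I (Suc k) (Suc r)"
      by (auto simp: I_def sorted_wrt_append less_Suc_eq)
  qed
  have "Hbar2 (Suc k) (Suc r) = sum w (I k (Suc r)) + sum w ((\<lambda>ks. ks @ [k]) ` I k r)"
    unfolding H eq by (intro sum.union_disjoint fin finite_imageI) (auto simp: I_def)
  also have "sum w ((\<lambda>ks. ks @ [k]) ` I k r) = (\<Sum>ks\<in>I k r. w (ks @ [k]))"
    by (subst sum.reindex) (auto simp: inj_on_def)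
  also have "\<dots> = Hbar2 k r / (2 * of_nat k + 1) ^ 2"
    unfolding H sum_divide_distrib by (intro sum.cong refl) (simp add: w_def)
  finally show ?thesis by (simp add: H)
qed

text \<open>
A partial product of \<open>cos (\<pi> a / 2)\<close> in the variable \<open>X = a^2\<close>.
\<close>

definition fpol :: "nat \<Rightarrow> rat poly" where
  "fpol k = (\<Prod>j<k. [:1, - (1 / (2 * of_nat j + 1) ^ 2):])"

lemma fpol_Suc: "fpol (Suc k) = fpol k * [:1, - (1 / (2 * of_nat k + 1) ^ 2):]"
  by (simp add: fpol_def mult.commute)

lemma coeff_fpol: "coeff (fpol k) r = (- 1) ^ r * Hbar2 k r"
proof (induction k arbitrary: r)
  case 0
  show ?case by (cases r) (simp_all add: fpol_def Hbar2_0_right Hbar2_0_Suc)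
next
  case (Suc k)
  show ?case
  proof (cases r)
    case 0
    then show ?thesis using Suc[of 0] by (simp add: fpol_Suc Hbar2_0_right mult_pCons_right)
  next
    case (Suc r')
    then show ?thesis using Suc.IH[of r] Suc.IH[of r']
      by (simp add: fpol_Suc Hbar2_Suc_Suc mult_pCons_right field_simps)
  qed
qed

lemma degree_fpol: "degree (fpol k) \<le> k"
proof (induction k)
  case (Suc k)
  have "degree (fpol (Suc k)) \<le> degree (fpol k) + degree [:1, - (1 / (2 * of_nat k + 1) ^ 2 :: rat):]"
    unfolding fpol_Suc by (rule degree_mult_le)
  then show ?case using Suc by simp
qed (simp add: fpol_def)

text \<open>
The polynomial quotient of \<open>fpol k\<close>, minus its value at the pole \<open>(2k+1)^2\<close>, by \<open>1 - X / (2k+1)^2\<close>;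
the factor in front converts from the monic divisor of synthetic division.
\<close>

definition gpol :: "nat \<Rightarrow> rat poly" where
  "gpol k = smult (- ((2 * of_nat k + 1) ^ 2)) (synthetic_div (fpol k) ((2 * of_nat k + 1) ^ 2))"

lemma node_nonzero [simp]: "2 * of_nat k + 1 \<noteq> (0 :: rat)"
  by (metis of_nat_numeral of_nat_mult of_nat_Suc of_nat_eq_0_iff Suc_neq_Zero add.commute)

lemma fpol_gpol:
  "fpol k = [:poly (fpol k) ((2 * of_nat k + 1) ^ 2):] + [:1, - (1 / (2 * of_nat k + 1) ^ 2):] * gpol k"
proof -
  define c :: rat where "c = (2 * of_nat k + 1) ^ 2"
  have "c \<noteq> 0" by (simp add: c_def)
  then have "[:1, - (1 / c):] * gpol k = [:- c, 1:] * synthetic_div (fpol k) c"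
    by (simp add: gpol_def smult_add_right flip: c_def)
  then show ?thesis using synthetic_div_correct'[of c "fpol k"] by (simp add: c_def add.commute)
qed

lemma degree_gpol: "degree (gpol k) \<le> k - 1"
  using degree_fpol[of k] unfolding gpol_def by (simp add: degree_synthetic_div)

text \<open>
The coefficients of the power series \<open>f / (1 - w X)\<close>: the constant \<open>v\<close> contributes a geometric
series and the rest is the polynomial \<open>g\<close>.
\<close>

lemma coeff_divide_linear:
  fixes f g :: "rat poly"
  assumes "f = [:v:] + [:1, - w:] * g"
  shows "(\<Sum>j\<le>m. coeff f (m - j) * w ^ j) = v * w ^ m + coeff g m"
proof (induction m)
  case 0
  show ?case by (subst assms) simp
next
  case (Suc m)
  have "(\<Sum>j\<le>Suc m. coeff f (Suc m - j) * w ^ j) = coeff f (Suc m) + w * (\<Sum>j\<le>m. coeff f (m - j) * w ^ j)"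
    unfolding sum.atMost_Suc_shift sum_distrib_left by (simp add: mult_ac)
  also have "coeff f (Suc m) = coeff g (Suc m) - w * coeff g m"
    by (subst assms) simp
  finally show ?case unfolding Suc by (simp add: algebra_simps)
qed

definition cbin :: "nat \<Rightarrow> rat" where
  "cbin k = of_nat ((2 * k) choose k) / 16 ^ k"

lemma cbin_fact: "cbin k = fact (2 * k) / (fact k ^ 2 * 16 ^ k)"
  using binomial_fact[of k "2 * k", where ?'a = rat] by (simp add: cbin_def power2_eq_square)

text \<open>
\<open>phi k b\<close> is the \<open>k\<close>-th weight \<open>cbin k * fpol k\<close> at \<open>b^2\<close>, and \<open>psi\<close> is its analogue with even in place
of odd nodes. The two are exchanged by the shifts \<open>b = a + 1\<close> and \<open>b = a - 1\<close>, as in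
\<open>cos (\<pi> (a \<plusminus> 1) / 2) = \<mp> sin (\<pi> a / 2)\<close>.
\<close>

definition phi :: "nat \<Rightarrow> rat \<Rightarrow> rat" where
  "phi k b = (\<Prod>j<k. (2 * of_nat j + 1) ^ 2 - b ^ 2) / (4 ^ k * fact (2 * k))"

definition psi :: "nat \<Rightarrow> rat \<Rightarrow> rat" where
  "psi k a = (\<Prod>j<k. (2 * of_nat j) ^ 2 - a ^ 2) / (4 ^ k * fact (2 * k))"

lemma fact_2_Suc: "(fact (2 * Suc k) :: rat) = (2 * of_nat k + 1) * (2 * of_nat k + 2) * fact (2 * k)"
  by (simp add: algebra_simps)

lemma phi_Suc: "phi (Suc k) b = phi k b * ((2 * of_nat k + 1) ^ 2 - b ^ 2) / (4 * (2 * of_nat k + 1) * (2 * of_nat k + 2))"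
  unfolding phi_def fact_2_Suc by simp

lemma psi_Suc: "psi (Suc k) a = psi k a * ((2 * of_nat k) ^ 2 - a ^ 2) / (4 * (2 * of_nat k + 1) * (2 * of_nat k + 2))"
  unfolding psi_def fact_2_Suc by simp

lemma cbin_Suc: "cbin (Suc k) = cbin k * (2 * of_nat k + 1) / (4 * (2 * of_nat k + 2))"
  unfolding cbin_fact fact_2_Suc
  by (simp add: divide_simps power2_eq_square) (simp add: algebra_simps)

lemma cbin_fpol: "cbin k * poly (fpol k) (b ^ 2) = phi k b"
proof (induction k)
  case (Suc k)
  define y :: rat where "y = 2 * of_nat k + 1"
  have y: "y \<noteq> 0" by (simp add: y_def)
  have "cbin (Suc k) * poly (fpol (Suc k)) (b ^ 2)
      = (cbin k * poly (fpol k) (b ^ 2)) * (y * (1 - b ^ 2 / y ^ 2)) / (4 * (2 * of_nat k + 2))"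
  proof -
    have "poly [:1, - (1 / y ^ 2):] (b ^ 2) = 1 - b ^ 2 / y ^ 2" by simp
    then show ?thesis unfolding cbin_Suc fpol_Suc poly_mult y_def [symmetric]
      by (simp only: times_divide_eq_left times_divide_eq_right mult_ac)
  qed
  also have "y * (1 - b ^ 2 / y ^ 2) = (y ^ 2 - b ^ 2) / y"
    using y by (simp add: field_simps power2_eq_square)
  finally show ?case unfolding Suc phi_Suc y_def [symmetric] by (simp add: algebra_simps)
qed (simp add: cbin_def fpol_def phi_def)

text \<open>
The product of \<open>(2j+1)^2 - (2k+1)^2 = -4 (k-j) (k+j+1)\<close> over \<open>j < k\<close> is a factorial up to a power of \<open>-4\<close>.
\<close>

lemma phi_node: "phi k (2 * of_nat k + 1) = (- 1) ^ k"
proof -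
  \<comment> \<open>A partial product, so that the induction is not on the \<open>k\<close> inside the factors.\<close>
  have aux: "(\<Prod>j<i. (2 * of_nat j + 1) ^ 2 - (2 * of_nat k + 1) ^ 2) * fact (k - i)
      = (- 4) ^ i * (fact (k + i) :: rat)" if "i \<le> k" for i
    using that
  proof (induction i)
    case (Suc i)
    have "k - i = Suc (k - Suc i)" using Suc by simp
    then have "(fact (k - i) :: rat) = (of_nat k - of_nat i) * fact (k - Suc i)"
      using Suc by (simp add: of_nat_diff)
    then have h: "(\<Prod>j<i. (2 * of_nat j + 1) ^ 2 - (2 * of_nat k + 1) ^ 2) * ((of_nat k - of_nat i) * fact (k - Suc i))
       = (- 4) ^ i * (fact (k + i) :: rat)" using Suc by simp
    have d: "(2 * of_nat i + 1) ^ 2 - (2 * of_nat k + 1) ^ 2 = (- 4) * (of_nat k - of_nat i) * (of_nat k + of_nat i + 1 :: rat)"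
      by (simp add: power2_eq_square algebra_simps)
    have "(\<Prod>j<Suc i. (2 * of_nat j + 1) ^ 2 - (2 * of_nat k + 1) ^ 2) * fact (k - Suc i)
      = (- 4) * (of_nat k + of_nat i + 1) * ((\<Prod>j<i. (2 * of_nat j + 1) ^ 2 - (2 * of_nat k + 1) ^ 2)
         * ((of_nat k - of_nat i) * (fact (k - Suc i) :: rat)))"
      unfolding prod.lessThan_Suc d by (simp only: mult_ac)
    then show ?case unfolding h by (simp add: algebra_simps)
  qed simp
  have "(- 4 :: rat) ^ k = (- 1) ^ k * 4 ^ k" by (simp flip: power_mult_distrib)
  moreover have "(\<Prod>j<k. (2 * of_nat j + 1) ^ 2 - (2 * of_nat k + 1) ^ 2) = (- 4) ^ k * (fact (2 * k) :: rat)"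
    using aux[of k] by (simp flip: mult_2)
  ultimately show ?thesis by (simp add: phi_def)
qed

lemma cbin_fpol_node: "cbin k * poly (fpol k) ((2 * of_nat k + 1) ^ 2) = (- 1) ^ k"
  unfolding cbin_fpol by (rule phi_node)

lemma phi_shift: "a * phi k (a + 1) = (2 * of_nat k + a) * psi k a"
proof (induction k)
  case (Suc k)
  have "a * phi (Suc k) (a + 1) = (a * phi k (a + 1)) * ((2 * of_nat k + 1) ^ 2 - (a + 1) ^ 2)
      / (4 * (2 * of_nat k + 1) * (2 * of_nat k + 2))"
    by (simp add: phi_Suc)
  also have "\<dots> = (2 * of_nat (Suc k) + a) * psi (Suc k) a"
    unfolding Suc psi_Suc by (simp add: power2_eq_square algebra_simps)
  finally show ?case .
qed (simp add: phi_def psi_def)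

lemma phi_shift': "a * phi k (a - 1) = (a - 2 * of_nat k) * psi k a"
proof -
  have "phi k (- a + 1) = phi k (a - 1)" "psi k (- a) = psi k a"
    by (simp_all add: phi_def psi_def power2_commute)
  then show ?thesis using phi_shift[of "- a" k] by (simp add: algebra_simps)
qed

section \<open>Exact functional equations\<close>

text \<open>
What is left of the generating functions when the simple poles are removed: the coefficients of
\<open>(\<Sum>j\<ge>1. X^j / (2k+1)^(2j)) * fpol k\<close> are those of the pole part plus those of \<open>gpol k - fpol k\<close>, to which
\<open>3/4\<close> or \<open>5/4\<close> times \<open>fpol k\<close> is added.
\<close>

definition beta_rem :: "nat \<Rightarrow> rat poly" where
  "beta_rem n = (\<Sum>k<n. smult (cbin k / (2 * of_nat k + 1)) (gpol k - smult (1 / 4) (fpol k)))"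

definition zeta_rem :: "nat \<Rightarrow> rat poly" where
  "zeta_rem n = (\<Sum>k<n. smult ((- 1) ^ k * cbin k / (2 * of_nat k + 1) ^ 2) (gpol k + smult (1 / 4) (fpol k)))"

text \<open>
The partial fraction decomposition of one term, on the level of coefficients.
\<close>

lemma coeff_sum_split:
  "(\<Sum>j=1..m. (- 1) ^ (m - j) * Hbar2 k (m - j) / ((2 * of_nat k + 1) ^ (2 * j)))
   = poly (fpol k) ((2 * of_nat k + 1) ^ 2) / (2 * of_nat k + 1) ^ (2 * m) + coeff (gpol k) m - coeff (fpol k) m"
proof -
  let ?w = "1 / (2 * of_nat k + 1) ^ 2 :: rat"
  have w: "?w ^ j = 1 / (2 * of_nat k + 1) ^ (2 * j)" for j
    by (simp add: power_mult power_one_over)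
  have "(\<Sum>j\<le>m. coeff (fpol k) (m - j) * ?w ^ j)
     = coeff (fpol k) m + (\<Sum>j=1..m. coeff (fpol k) (m - j) * ?w ^ j)"
    by (simp add: sum.atLeast_Suc_atMost flip: atLeast0AtMost)
  also have "(\<Sum>j=1..m. coeff (fpol k) (m - j) * ?w ^ j)
     = (\<Sum>j=1..m. (- 1) ^ (m - j) * Hbar2 k (m - j) / ((2 * of_nat k + 1) ^ (2 * j)))"
    by (intro sum.cong refl) (simp only: coeff_fpol w times_divide_eq_right mult_1_right)
  finally show ?thesis using coeff_divide_linear[OF fpol_gpol, of k m] unfolding w by simp
qed

lemma beta_sum_eq:
  "3 / 4 * (\<Sum>k<n. (-1) ^ m * of_nat ((2 * k) choose k) * Hbar2 k m / (16 ^ k * (2 * of_nat k + 1)))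
     + (\<Sum>j = 1..m. \<Sum>k<n. (-1) ^ (m - j) * of_nat ((2 * k) choose k) * Hbar2 k (m - j) /
       (16 ^ k * (2 * of_nat k + 1) ^ (2 * j + 1)))
   = (\<Sum>k<n. (- 1) ^ k / (2 * of_nat k + 1) ^ (2 * m + 1)) + coeff (beta_rem n) m" (is "?lhs = _")
proof -
  have "?lhs = (\<Sum>k<n. cbin k / (2 * of_nat k + 1) * (3 / 4 * coeff (fpol k) m
       + (\<Sum>j=1..m. (- 1) ^ (m - j) * Hbar2 k (m - j) / ((2 * of_nat k + 1) ^ (2 * j)))))"
    unfolding sum.swap[of _ _ "{1..m}"] sum_distrib_left sum.distrib [symmetric]
    by (intro sum.cong refl) (simp add: coeff_fpol cbin_def distrib_left sum_distrib_left mult_ac)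
  also have "\<dots> = (\<Sum>k<n. (- 1) ^ k / (2 * of_nat k + 1) ^ (2 * m + 1)
       + cbin k / (2 * of_nat k + 1) * (coeff (gpol k) m - 1 / 4 * coeff (fpol k) m))"
    unfolding coeff_sum_split
  proof (intro sum.cong refl)
    fix k
    define y F G P :: rat where "y = 2 * of_nat k + 1" and "F = coeff (fpol k) m" and "G = coeff (gpol k) m"
      and "P = poly (fpol k) ((2 * of_nat k + 1) ^ 2)"
    have "cbin k * P = (- 1) ^ k" using cbin_fpol_node[of k] by (simp add: P_def)
    moreover have "cbin k / y * (P / y ^ (2 * m)) = cbin k * P / y ^ (2 * m + 1)" by simp
    ultimately have E: "(- 1) ^ k / y ^ (2 * m + 1) = cbin k / y * (P / y ^ (2 * m))" by (simp only:)
    have "cbin k / y * (3 / 4 * F + (P / y ^ (2 * m) + G - F)) = (- 1) ^ k / y ^ (2 * m + 1) + cbin k / y * (G - 1 / 4 * F)"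
      unfolding E by (simp add: algebra_simps)
    then show "cbin k / (2 * of_nat k + 1) * (3 / 4 * coeff (fpol k) m
       + (poly (fpol k) ((2 * of_nat k + 1) ^ 2) / (2 * of_nat k + 1) ^ (2 * m) + coeff (gpol k) m - coeff (fpol k) m))
       = (- 1) ^ k / (2 * of_nat k + 1) ^ (2 * m + 1)
       + cbin k / (2 * of_nat k + 1) * (coeff (gpol k) m - 1 / 4 * coeff (fpol k) m)"
      by (simp only: y_def F_def G_def P_def)
  qed
  finally show ?thesis by (simp add: sum.distrib beta_rem_def coeff_sum)
qed

lemma zeta_sum_eq:
  "5 / 4 * (\<Sum>k<n. (-1) ^ (k + m) * of_nat ((2 * k) choose k) * Hbar2 k m / (16 ^ k * (2 * of_nat k + 1) ^ 2))
     + (\<Sum>j = 1..m. \<Sum>k<n. (-1) ^ (k + m - j) * of_nat ((2 * k) choose k) * Hbar2 k (m - j) /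
       (16 ^ k * (2 * of_nat k + 1) ^ (2 * j + 2)))
   = (\<Sum>k<n. 1 / (2 * of_nat k + 1) ^ (2 * m + 2)) + coeff (zeta_rem n) m" (is "?lhs = _")
proof -
  have "?lhs = (\<Sum>k<n. (- 1) ^ k * cbin k / (2 * of_nat k + 1) ^ 2 * (5 / 4 * coeff (fpol k) m
       + (\<Sum>j=1..m. (- 1) ^ (m - j) * Hbar2 k (m - j) / ((2 * of_nat k + 1) ^ (2 * j)))))"
    unfolding sum.swap[of _ _ "{1..m}"] sum_distrib_left sum.distrib [symmetric]
  proof (intro sum.cong refl)
    fix k assume "k \<in> {..<n}"
    have "(\<Sum>j=1..m. (-1) ^ (k + m - j) * of_nat ((2 * k) choose k) * Hbar2 k (m - j) /
       (16 ^ k * (2 * of_nat k + 1) ^ (2 * j + 2))) = (- 1) ^ k * cbin k / (2 * of_nat k + 1) ^ 2 *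
         (\<Sum>j=1..m. (- 1) ^ (m - j) * Hbar2 k (m - j) / ((2 * of_nat k + 1) ^ (2 * j)))"
      unfolding sum_distrib_left
    proof (intro sum.cong refl)
      fix j assume "j \<in> {1..m}"
      then have "k + m - j = k + (m - j)" by simp
      then show "(-1) ^ (k + m - j) * of_nat ((2 * k) choose k) * Hbar2 k (m - j) /
       (16 ^ k * (2 * of_nat k + 1) ^ (2 * j + 2)) = (- 1) ^ k * cbin k / (2 * of_nat k + 1) ^ 2 *
         ((- 1) ^ (m - j) * Hbar2 k (m - j) / ((2 * of_nat k + 1) ^ (2 * j)))"
        by (simp add: cbin_def power_add power2_eq_square mult_ac)
    qed
    then show "5 / 4 * ((-1) ^ (k + m) * of_nat ((2 * k) choose k) * Hbar2 k m / (16 ^ k * (2 * of_nat k + 1) ^ 2))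
       + (\<Sum>j=1..m. (-1) ^ (k + m - j) * of_nat ((2 * k) choose k) * Hbar2 k (m - j) /
       (16 ^ k * (2 * of_nat k + 1) ^ (2 * j + 2))) = (- 1) ^ k * cbin k / (2 * of_nat k + 1) ^ 2 * (5 / 4 * coeff (fpol k) m
       + (\<Sum>j=1..m. (- 1) ^ (m - j) * Hbar2 k (m - j) / ((2 * of_nat k + 1) ^ (2 * j))))"
      by (simp add: coeff_fpol cbin_def distrib_left power_add mult_ac)
  qed
  also have "\<dots> = (\<Sum>k<n. 1 / (2 * of_nat k + 1) ^ (2 * m + 2)
       + (- 1) ^ k * cbin k / (2 * of_nat k + 1) ^ 2 * (coeff (gpol k) m + 1 / 4 * coeff (fpol k) m))"
    unfolding coeff_sum_split
  proof (intro sum.cong refl)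
    fix k
    define y F G C :: rat where "y = 2 * of_nat k + 1" and "F = coeff (fpol k) m" and "G = coeff (gpol k) m"
      and "C = (- 1) ^ k * cbin k"
    define P where "P = poly (fpol k) (y ^ 2)"
    have "C * P = 1" using cbin_fpol_node[of k] by (simp add: C_def P_def y_def mult.assoc flip: power_mult_distrib)
    then have "C / y ^ 2 * (P / y ^ (2 * m)) = 1 / y ^ (2 * m + 2)"
      by (simp add: power_add power2_eq_square)
    then have "C / y ^ 2 * (5 / 4 * F + (P / y ^ (2 * m) + G - F)) = 1 / y ^ (2 * m + 2) + C / y ^ 2 * (G + 1 / 4 * F)"
      by (simp add: algebra_simps)
    then show "(- 1) ^ k * cbin k / (2 * of_nat k + 1) ^ 2 * (5 / 4 * coeff (fpol k) m
       + (poly (fpol k) ((2 * of_nat k + 1) ^ 2) / (2 * of_nat k + 1) ^ (2 * m) + coeff (gpol k) m - coeff (fpol k) m))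
       = 1 / (2 * of_nat k + 1) ^ (2 * m + 2)
       + (- 1) ^ k * cbin k / (2 * of_nat k + 1) ^ 2 * (coeff (gpol k) m + 1 / 4 * coeff (fpol k) m)"
      by (simp only: y_def F_def G_def C_def P_def)
  qed
  finally show ?thesis by (simp add: sum.distrib zeta_rem_def coeff_sum)
qed

lemma node_nonzero': "2 * of_nat k + 2 \<noteq> (0 :: rat)"
proof -
  have "2 * of_nat k + 2 = (of_nat (2 * k + 2) :: rat)" by simp
  then show ?thesis by (simp only: of_nat_eq_0_iff)
qed

lemma poly_gpol:
  assumes "(2 * of_nat k + 1) ^ 2 \<noteq> b ^ 2"
  shows "cbin k * poly (gpol k) (b ^ 2)
    = (2 * of_nat k + 1) ^ 2 * (phi k b - (- 1) ^ k) / ((2 * of_nat k + 1) ^ 2 - b ^ 2)"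
proof -
  define y :: rat where "y = 2 * of_nat k + 1"
  have y: "y \<noteq> 0" "y ^ 2 - b ^ 2 \<noteq> 0" using assms by (simp_all add: y_def)
  have "poly (fpol k) (b ^ 2) = poly (fpol k) (y ^ 2) + (1 - b ^ 2 / y ^ 2) * poly (gpol k) (b ^ 2)"
    using arg_cong[OF fpol_gpol[of k], of "\<lambda>f. poly f (b ^ 2)"] by (simp add: y_def left_diff_distrib)
  then have "cbin k * poly (fpol k) (b ^ 2) = cbin k * poly (fpol k) (y ^ 2)
      + (1 - b ^ 2 / y ^ 2) * (cbin k * poly (gpol k) (b ^ 2))"
    by (simp only: distrib_left mult.left_commute)
  then have "phi k b = (- 1) ^ k + (y ^ 2 - b ^ 2) / y ^ 2 * (cbin k * poly (gpol k) (b ^ 2))"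
    using y by (simp add: y_def cbin_fpol phi_node diff_divide_distrib)
  then show ?thesis unfolding y_def [symmetric] using y by (simp add: field_simps)
qed

text \<open>
The four rational identities behind the telescoping, with \<open>x = 2k\<close>. In each the right-hand side is
a difference (or, for alternating signs, a sum) of one expression at \<open>x\<close> and at \<open>x + 2\<close>; the factor
\<open>(x - a) (x + a) / (4 (x + 1) (x + 2))\<close> is the quotient of \<open>psi (k + 1) a\<close> by \<open>psi k a\<close>.
\<close>

lemma beta_pole_identity:
  fixes x a :: rat
  assumes "x - a \<noteq> 0" "x + a \<noteq> 0" "x + 2 - a \<noteq> 0" "x + 2 + a \<noteq> 0"
  shows "(x + 1) / ((x - a) * (x + 2 + a)) + (x + 1) / ((x + 2 - a) * (x + a))
    = x / ((x - a) * (x + a)) + (x + 2) / ((x + 2 - a) * (x + 2 + a))"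
  using assms by (simp add: divide_simps) (simp add: algebra_simps)

lemma beta_psi_identity:
  fixes x a :: rat
  assumes "x - a \<noteq> 0" "x + a \<noteq> 0" "x + 2 - a \<noteq> 0" "x + 2 + a \<noteq> 0" "a \<noteq> 0" "x + 1 \<noteq> 0" "x + 2 \<noteq> 0"
  shows "(x + a) / a * ((x + 1) / ((x - a) * (x + 2 + a)) - 1 / (4 * (x + 1)))
      + (a - x) / a * ((x + 1) / ((x + 2 - a) * (x + a)) - 1 / (4 * (x + 1)))
    = 2 * (x / ((x - a) * (x + a)))
      - 2 * ((x + 2) / ((x + 2 - a) * (x + 2 + a))) * ((x - a) * (x + a) / (4 * (x + 1) * (x + 2)))"
  using assms by (simp add: divide_simps) (simp add: algebra_simps power2_eq_square)

lemma zeta_pole_identity: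
  fixes x a :: rat
  assumes "x - a \<noteq> 0" "x + a \<noteq> 0" "x + 2 - a \<noteq> 0" "x + 2 + a \<noteq> 0"
  shows "(a + 1) / ((x - a) * (x + 2 + a)) - (a - 1) / ((x + 2 - a) * (x + a))
    = x / ((x - a) * (x + a)) - (x + 2) / ((x + 2 - a) * (x + 2 + a))"
  using assms by (simp add: divide_simps) (simp add: algebra_simps)

lemma zeta_psi_identity:
  fixes x a :: rat
  assumes "x - a \<noteq> 0" "x + a \<noteq> 0" "x + 2 - a \<noteq> 0" "x + 2 + a \<noteq> 0" "a \<noteq> 0" "x + 1 \<noteq> 0" "x + 2 \<noteq> 0"
  shows "(a + 1) * ((x + a) / a) * (1 / ((x - a) * (x + 2 + a)) + 1 / (4 * (x + 1) ^ 2))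
      - (a - 1) * ((a - x) / a) * (1 / ((x + 2 - a) * (x + a)) + 1 / (4 * (x + 1) ^ 2))
    = 2 * (x / ((x - a) * (x + a)))
      + 2 * ((x + 2) / ((x + 2 - a) * (x + 2 + a))) * ((x - a) * (x + a) / (4 * (x + 1) * (x + 2)))"
  using assms by (simp add: divide_simps) (simp add: algebra_simps power2_eq_square)

lemma beta_term:
  assumes "(2 * of_nat k + 1) ^ 2 \<noteq> b ^ 2"
  defines "y \<equiv> 2 * of_nat k + 1"
  shows "poly (smult (cbin k / y) (gpol k - smult (1 / 4) (fpol k))) (b ^ 2)
    = phi k b * (y / (y ^ 2 - b ^ 2) - 1 / (4 * y)) - (- 1) ^ k * (y / (y ^ 2 - b ^ 2))"
proof -
  have y: "y \<noteq> 0" "y ^ 2 - b ^ 2 \<noteq> 0" using assms by (simp_all add: y_def)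
  define D where "D = y ^ 2 - b ^ 2"
  have "poly (smult (cbin k / y) (gpol k - smult (1 / 4) (fpol k))) (b ^ 2)
      = (cbin k * poly (gpol k) (b ^ 2)) / y - (cbin k * poly (fpol k) (b ^ 2)) / (4 * y)"
    by (simp add: right_diff_distrib)
  also have "\<dots> = y ^ 2 * (phi k b - (- 1) ^ k) / (y ^ 2 - b ^ 2) / y - phi k b / (4 * y)"
    using poly_gpol[of k b] assms(1) by (simp add: cbin_fpol y_def)
  also have "\<dots> = phi k b * (y / (y ^ 2 - b ^ 2) - 1 / (4 * y)) - (- 1) ^ k * (y / (y ^ 2 - b ^ 2))"
    unfolding D_def [symmetric] using y(1)
    by (simp add: power2_eq_square diff_divide_distrib right_diff_distrib left_diff_distrib mult_ac)
  finally show ?thesis .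
qed

lemma zeta_term:
  assumes "(2 * of_nat k + 1) ^ 2 \<noteq> b ^ 2"
  defines "y \<equiv> 2 * of_nat k + 1"
  shows "poly (smult ((- 1) ^ k * cbin k / y ^ 2) (gpol k + smult (1 / 4) (fpol k))) (b ^ 2)
    = (- 1) ^ k * phi k b * (1 / (y ^ 2 - b ^ 2) + 1 / (4 * y ^ 2)) - 1 / (y ^ 2 - b ^ 2)"
proof -
  have y: "y \<noteq> 0" "y ^ 2 - b ^ 2 \<noteq> 0" using assms by (simp_all add: y_def)
  have "poly (smult ((- 1) ^ k * cbin k / y ^ 2) (gpol k + smult (1 / 4) (fpol k))) (b ^ 2)
      = (- 1) ^ k * ((cbin k * poly (gpol k) (b ^ 2)) / y ^ 2 + (cbin k * poly (fpol k) (b ^ 2)) / (4 * y ^ 2))"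
    by (simp add: distrib_left)
  also have "\<dots> = (- 1) ^ k * (y ^ 2 * (phi k b - (- 1) ^ k) / (y ^ 2 - b ^ 2) / y ^ 2 + phi k b / (4 * y ^ 2))"
    using poly_gpol[of k b] assms(1) by (simp add: cbin_fpol y_def)
  also have "y ^ 2 * (phi k b - (- 1) ^ k) / (y ^ 2 - b ^ 2) / y ^ 2 = (phi k b - (- 1) ^ k) / (y ^ 2 - b ^ 2)"
    using y by simp
  also have "(- 1) ^ k * ((phi k b - (- 1) ^ k) / (y ^ 2 - b ^ 2) + phi k b / (4 * y ^ 2))
      = (- 1) ^ k * phi k b * (1 / (y ^ 2 - b ^ 2) + 1 / (4 * y ^ 2)) - ((- 1) ^ k * (- 1) ^ k) / (y ^ 2 - b ^ 2)"
    by (simp add: diff_divide_distrib right_diff_distrib distrib_left del: power_mult_distrib)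
  finally show ?thesis by (simp flip: power_mult_distrib)
qed

text \<open>
For non-integral \<open>a\<close> no pole is met, and both functional equations follow by induction on the number
of terms.
\<close>

context
  fixes a :: rat
  assumes a: "a \<notin> \<int>"
begin

lemma a_nonzero: "a \<noteq> 0"
  using a by auto

lemma shift_nonzero:
  "2 * of_nat k - a \<noteq> 0" "2 * of_nat k + a \<noteq> 0"
  "2 * of_nat k + 2 - a \<noteq> 0" "2 * of_nat k + 2 + a \<noteq> 0"
proof -
  have *: "a \<noteq> of_int i" for i using a by auto
  show "2 * of_nat k - a \<noteq> 0" using *[of "2 * int k"] by auto
  show "2 * of_nat k + a \<noteq> 0" using *[of "- 2 * int k"] by (auto simp: add_eq_0_iff)
  show "2 * of_nat k + 2 - a \<noteq> 0" using *[of "2 * int k + 2"] by auto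
  show "2 * of_nat k + 2 + a \<noteq> 0" using *[of "- (2 * int k + 2)"] by (auto simp: add_eq_0_iff)
qed

lemma node_factor:
  "(2 * of_nat k + 1) ^ 2 - (a + 1) ^ 2 = (2 * of_nat k - a) * (2 * of_nat k + 2 + a)"
  "(2 * of_nat k + 1) ^ 2 - (a - 1) ^ 2 = (2 * of_nat k + 2 - a) * (2 * of_nat k + a)"
  by (simp_all add: power2_eq_square algebra_simps)

lemma node_neq:
  "(2 * of_nat k + 1) ^ 2 \<noteq> (a + 1) ^ 2" "(2 * of_nat k + 1) ^ 2 \<noteq> (a - 1) ^ 2"
  using node_factor[of k] shift_nonzero[of k] by (metis diff_self mult_eq_0_iff)+

lemma phi_plus: "phi k (a + 1) = (2 * of_nat k + a) / a * psi k a"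
  and phi_minus: "phi k (a - 1) = (a - 2 * of_nat k) / a * psi k a"
  using phi_shift[of a k] phi_shift'[of a k] a_nonzero by (simp_all add: field_simps)

lemma beta_functional_nonint:
  "poly (beta_rem n) ((a + 1) ^ 2) + poly (beta_rem n) ((a - 1) ^ 2)
    = 2 * of_nat n / ((2 * of_nat n - a) * (2 * of_nat n + a)) * ((- 1) ^ n - 2 * psi n a)"
proof (induction n)
  case 0
  show ?case by (simp add: beta_rem_def)
next
  case (Suc n)
  define x s P :: rat where "x = 2 * of_nat n" and "s = (- 1) ^ n" and "P = psi n a"
  define u v q where "u = x / ((x - a) * (x + a))" and "v = (x + 2) / ((x + 2 - a) * (x + 2 + a))"
    and "q = (x - a) * (x + a) / (4 * (x + 1) * (x + 2))"
  note nz = shift_nonzero[of n, folded x_def]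
  have x: "x + 1 \<noteq> 0" "x + 2 \<noteq> 0" using node_nonzero[of n] node_nonzero'[of n] by (simp_all add: x_def)
  have "poly (beta_rem (Suc n)) ((a + 1) ^ 2) + poly (beta_rem (Suc n)) ((a - 1) ^ 2)
     = u * (s - 2 * P)
      + (((x + a) / a * P) * ((x + 1) / ((x - a) * (x + 2 + a)) - 1 / (4 * (x + 1))) - s * ((x + 1) / ((x - a) * (x + 2 + a))))
      + (((a - x) / a * P) * ((x + 1) / ((x + 2 - a) * (x + a)) - 1 / (4 * (x + 1))) - s * ((x + 1) / ((x + 2 - a) * (x + a))))"
    using Suc unfolding beta_rem_def sum.lessThan_Suc poly_add
      beta_term[OF node_neq(1)] beta_term[OF node_neq(2)] phi_plus phi_minus node_factor
    by (simp add: u_def s_def P_def x_def)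
  also have "\<dots> = u * (s - 2 * P) + P * ((x + a) / a * ((x + 1) / ((x - a) * (x + 2 + a)) - 1 / (4 * (x + 1)))
      + (a - x) / a * ((x + 1) / ((x + 2 - a) * (x + a)) - 1 / (4 * (x + 1))))
     - s * ((x + 1) / ((x - a) * (x + 2 + a)) + (x + 1) / ((x + 2 - a) * (x + a)))"
    by (simp only: distrib_left mult_ac)
  also have "\<dots> = u * (s - 2 * P) + P * (2 * u - 2 * v * q) - s * (u + v)"
    unfolding beta_psi_identity[OF nz a_nonzero x] beta_pole_identity[OF nz] u_def v_def q_def ..
  also have "\<dots> = v * (- s - 2 * (P * q))" by (simp add: algebra_simps)
  also have "\<dots> = 2 * of_nat (Suc n) / ((2 * of_nat (Suc n) - a) * (2 * of_nat (Suc n) + a)) * ((- 1) ^ Suc n - 2 * psi (Suc n) a)"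
  proof -
    have "2 * of_nat (Suc n) = x + 2" by (simp add: x_def)
    moreover have "psi (Suc n) a = P * q"
      by (simp add: psi_Suc P_def q_def x_def power2_eq_square algebra_simps)
    ultimately show ?thesis by (simp only: v_def s_def power_Suc mult_minus1)
  qed
  finally show ?case .
qed

lemma zeta_functional_nonint:
  "(a + 1) * poly (zeta_rem n) ((a + 1) ^ 2) - (a - 1) * poly (zeta_rem n) ((a - 1) ^ 2)
    = 2 * of_nat n / ((2 * of_nat n - a) * (2 * of_nat n + a)) * (1 - 2 * (- 1) ^ n * psi n a)"
proof (induction n)
  case 0
  show ?case by (simp add: zeta_rem_def)
next
  case (Suc n)
  define x s P :: rat where "x = 2 * of_nat n" and "s = (- 1) ^ n" and "P = psi n a"
  define u v q where "u = x / ((x - a) * (x + a))" and "v = (x + 2) / ((x + 2 - a) * (x + 2 + a))"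
    and "q = (x - a) * (x + a) / (4 * (x + 1) * (x + 2))"
  note nz = shift_nonzero[of n, folded x_def]
  have x: "x + 1 \<noteq> 0" "x + 2 \<noteq> 0" using node_nonzero[of n] node_nonzero'[of n] by (simp_all add: x_def)
  have "(a + 1) * poly (zeta_rem (Suc n)) ((a + 1) ^ 2) - (a - 1) * poly (zeta_rem (Suc n)) ((a - 1) ^ 2)
     = u * (1 - 2 * s * P)
      + (a + 1) * (s * ((x + a) / a * P) * (1 / ((x - a) * (x + 2 + a)) + 1 / (4 * (x + 1) ^ 2)) - 1 / ((x - a) * (x + 2 + a)))
      - (a - 1) * (s * ((a - x) / a * P) * (1 / ((x + 2 - a) * (x + a)) + 1 / (4 * (x + 1) ^ 2)) - 1 / ((x + 2 - a) * (x + a)))"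
    using Suc unfolding zeta_rem_def sum.lessThan_Suc poly_add
      zeta_term[OF node_neq(1)] zeta_term[OF node_neq(2)] phi_plus phi_minus node_factor distrib_left[of "a + 1"] distrib_left[of "a - 1"]
    by (simp add: u_def s_def P_def x_def)
  also have "\<dots> = u * (1 - 2 * s * P) + s * P * ((a + 1) * ((x + a) / a) * (1 / ((x - a) * (x + 2 + a)) + 1 / (4 * (x + 1) ^ 2))
      - (a - 1) * ((a - x) / a) * (1 / ((x + 2 - a) * (x + a)) + 1 / (4 * (x + 1) ^ 2)))
     - ((a + 1) / ((x - a) * (x + 2 + a)) - (a - 1) / ((x + 2 - a) * (x + a)))"
    by (simp add: algebra_simps)
  also have "\<dots> = u * (1 - 2 * s * P) + s * P * (2 * u + 2 * v * q) - (u - v)"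
    unfolding zeta_psi_identity[OF nz a_nonzero x] zeta_pole_identity[OF nz] u_def v_def q_def ..
  also have "\<dots> = v * (1 - 2 * - s * (P * q))" by (simp add: algebra_simps)
  also have "\<dots> = 2 * of_nat (Suc n) / ((2 * of_nat (Suc n) - a) * (2 * of_nat (Suc n) + a)) * (1 - 2 * (- 1) ^ Suc n * psi (Suc n) a)"
  proof -
    have "2 * of_nat (Suc n) = x + 2" by (simp add: x_def)
    moreover have "psi (Suc n) a = P * q"
      by (simp add: psi_Suc P_def q_def x_def power2_eq_square algebra_simps)
    ultimately show ?thesis by (simp only: v_def s_def power_Suc mult_minus1)
  qed
  finally show ?case .
qed

end

text \<open>
Transfers the functional equations to integral \<open>a\<close>, where the individual terms have poles but the
remainders do not.
\<close>

lemma poly_eq_if_eq_nonint: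
  fixes f g :: "rat poly"
  assumes "\<And>a. a \<notin> \<int> \<Longrightarrow> poly f a = poly g a"
  shows "f = g"
proof (rule ccontr)
  assume "f \<noteq> g"
  then have "finite {a. poly (f - g) a = 0}" by (intro poly_roots_finite) auto
  moreover have "range (\<lambda>n :: nat. of_nat n + 1 / 2 :: rat) \<subseteq> {a. poly (f - g) a = 0}"
  proof
    fix a :: rat assume "a \<in> range (\<lambda>n :: nat. of_nat n + 1 / 2)"
    then obtain n :: nat where a: "a = of_nat n + 1 / 2" by blast
    have "a \<notin> \<int>"
    proof
      assume "a \<in> \<int>"
      then obtain i where "a = of_int i" by (rule Ints_cases)
      then have "(of_int (2 * i) :: rat) = of_int (2 * int n + 1)" by (simp add: a)
      then have "2 * i = 2 * int n + 1" by (simp only: of_int_eq_iff)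
      then show False by presburger
    qed
    then show "a \<in> {a. poly (f - g) a = 0}" using assms by simp
  qed
  ultimately have "finite (range (\<lambda>n :: nat. of_nat n + 1 / 2 :: rat))" by (rule finite_subset[rotated])
  moreover have "inj (\<lambda>n :: nat. of_nat n + 1 / 2 :: rat)" by (simp add: inj_on_def)
  ultimately show False using finite_imageD infinite_UNIV_nat by blast
qed

definition psi_pol :: "nat \<Rightarrow> rat poly" where
  "psi_pol n = smult (1 / (4 ^ n * fact (2 * n))) (\<Prod>j<n. [:(2 * of_nat j) ^ 2, 0, - 1:])"

lemma poly_psi_pol: "poly (psi_pol n) a = psi n a"
  by (simp add: psi_pol_def psi_def poly_prod power2_eq_square)

lemma psi_even_eq_0: "l < n \<Longrightarrow> psi n (2 * of_nat l) = 0"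
  by (auto simp: psi_def intro!: prod_zero bexI[of _ l])

definition sqr_pol :: "rat poly \<Rightarrow> rat poly" where
  "sqr_pol f = pcompose f [:0, 0, 1:]"

lemma poly_sqr_pol [simp]: "poly (sqr_pol f) x = poly f (x ^ 2)"
  by (simp add: sqr_pol_def poly_pcompose power2_eq_square)

text \<open>
At \<open>a = 2l\<close> with \<open>l < n\<close> the product \<open>psi n a\<close> contains a zero factor, which leaves an elementary
right-hand side.
\<close>

lemma beta_functional:
  assumes "l < n"
  shows "(4 * of_nat n ^ 2 - 4 * of_nat l ^ 2) *
      (poly (beta_rem n) ((2 * of_nat l + 1) ^ 2) + poly (beta_rem n) ((2 * of_nat l - 1) ^ 2))
    = (- 1) ^ n * (2 * of_nat n)"
proof -
  define F where "F = [:4 * of_nat n ^ 2, 0, - 1:] *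
     (pcompose (sqr_pol (beta_rem n)) [:1, 1:] + pcompose (sqr_pol (beta_rem n)) [:- 1, 1:])"
  define G where "G = smult (2 * of_nat n) ([:(- 1) ^ n:] - smult 2 (psi_pol n))"
  have "F = G"
  proof (rule poly_eq_if_eq_nonint)
    fix a :: rat assume a: "a \<notin> \<int>"
    define v :: rat where "v = (2 * of_nat n - a) * (2 * of_nat n + a)"
    have v: "v \<noteq> 0" using shift_nonzero[OF a, of n] by (simp add: v_def)
    have "poly F a = v * (poly (beta_rem n) ((a + 1) ^ 2) + poly (beta_rem n) ((a - 1) ^ 2))"
      by (simp add: F_def poly_pcompose v_def power2_eq_square algebra_simps)
    also have "\<dots> = 2 * of_nat n * ((- 1) ^ n - 2 * psi n a)"
      unfolding beta_functional_nonint[OF a] v_def [symmetric] using v by simp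
    finally show "poly F a = poly G a" by (simp add: G_def poly_psi_pol)
  qed
  then have "poly F (2 * of_nat l) = poly G (2 * of_nat l)" by simp
  then show ?thesis using psi_even_eq_0[OF assms]
    by (simp add: F_def G_def poly_pcompose poly_psi_pol power2_eq_square algebra_simps)
qed

text \<open>
The factor \<open>a\<close> makes the difference equation of the even values one with constant coefficients.
\<close>

definition zeta_odd :: "nat \<Rightarrow> rat poly" where
  "zeta_odd n = [:0, 1:] * sqr_pol (zeta_rem n)"

lemma zeta_functional:
  assumes "l < n"
  shows "(4 * of_nat n ^ 2 - 4 * of_nat l ^ 2) *
      (poly (zeta_odd n) (2 * of_nat l + 1) - poly (zeta_odd n) (2 * of_nat l - 1))
    = 2 * of_nat n"
proof -
  define F where "F = [:4 * of_nat n ^ 2, 0, - 1:] *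
     (pcompose (zeta_odd n) [:1, 1:] - pcompose (zeta_odd n) [:- 1, 1:])"
  define G where "G = smult (2 * of_nat n) ([:1:] - smult (2 * (- 1) ^ n) (psi_pol n))"
  have "F = G"
  proof (rule poly_eq_if_eq_nonint)
    fix a :: rat assume a: "a \<notin> \<int>"
    define v :: rat where "v = (2 * of_nat n - a) * (2 * of_nat n + a)"
    have v: "v \<noteq> 0" using shift_nonzero[OF a, of n] by (simp add: v_def)
    have "poly F a = v * ((a + 1) * poly (zeta_rem n) ((a + 1) ^ 2) - (a - 1) * poly (zeta_rem n) ((a - 1) ^ 2))"
      by (simp add: F_def zeta_odd_def poly_pcompose v_def power2_eq_square algebra_simps)
    also have "\<dots> = 2 * of_nat n * (1 - 2 * (- 1) ^ n * psi n a)"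
      unfolding zeta_functional_nonint[OF a] v_def [symmetric] using v by simp
    finally show "poly F a = poly G a" by (simp add: G_def poly_psi_pol)
  qed
  then have "poly F (2 * of_nat l) = poly G (2 * of_nat l)" by simp
  then show ?thesis using psi_even_eq_0[OF assms]
    by (simp add: F_def G_def poly_pcompose poly_psi_pol power2_eq_square algebra_simps)
qed

section \<open>Degrees and p-integrality of the remainders\<close>

lemma pderiv_sum: "pderiv (\<Sum>i\<in>A. f i) = (\<Sum>i\<in>A. pderiv (f i))"
  using higher_pderiv_sum[of 1 f A] by simp

text \<open>
As a function on the residues modulo \<open>p = 2n + 1\<close> this is zero except at \<open>1\<close> and \<open>-1\<close>, because
\<open>(1 - x^2)\<close> times it is \<open>x - x^p\<close>. Its derivative agrees with \<open>1 / (1 - x^2)\<close> at the other residues.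
\<close>

definition odd_geom :: "nat \<Rightarrow> rat poly" where
  "odd_geom n = (\<Sum>j<n. monom 1 (2 * j + 1))"

lemma poly_odd_geom: "poly (odd_geom n) x = (\<Sum>j<n. x ^ (2 * j + 1))"
  by (simp add: odd_geom_def poly_sum poly_monom)

lemma odd_geom_eq: "[:1, 0, - 1:] * odd_geom n = monom 1 1 - monom 1 (2 * n + 1)"
proof -
  have "poly ([:1, 0, - 1:] * odd_geom n) x = poly (monom 1 1 - monom 1 (2 * n + 1)) x" for x
  proof (induction n)
    case (Suc n)
    then show ?case by (simp add: odd_geom_def poly_monom algebra_simps power2_eq_square)
  qed (simp add: odd_geom_def)
  then show ?thesis by (metis poly_eq_poly_eq_iff ext)
qed

lemma odd_geom_values:
  "(1 - x ^ 2) * poly (odd_geom n) x = x - x ^ (2 * n + 1)"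
  "(1 - x ^ 2) * poly (pderiv (odd_geom n)) x = 1 - of_nat (2 * n + 1) * x ^ (2 * n) + 2 * x * poly (odd_geom n) x"
proof -
  show "(1 - x ^ 2) * poly (odd_geom n) x = x - x ^ (2 * n + 1)"
    using arg_cong[OF odd_geom_eq[of n], of "\<lambda>f. poly f x"]
    by (simp add: poly_monom power2_eq_square left_diff_distrib mult.assoc)
  have "poly ([:1, 0, - 1:] * pderiv (odd_geom n) + odd_geom n * pderiv [:1, 0, - 1:]) x
      = poly (pderiv (monom 1 1 - monom 1 (2 * n + 1))) x"
    by (simp only: odd_geom_eq flip: pderiv_mult)
  then have "(1 - x ^ 2) * poly (pderiv (odd_geom n)) x + poly (odd_geom n) x * (- 2 * x)
      = 1 - of_nat (2 * n + 1) * x ^ (2 * n)"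
    unfolding poly_add poly_mult by (simp add: pderiv_diff pderiv_monom pderiv_pCons poly_monom power2_eq_square)
  then show "(1 - x ^ 2) * poly (pderiv (odd_geom n)) x = 1 - of_nat (2 * n + 1) * x ^ (2 * n) + 2 * x * poly (odd_geom n) x"
    by (simp add: algebra_simps)
qed

lemma degree_odd_geom: "degree (odd_geom n) \<le> 2 * n - 1"
  unfolding odd_geom_def by (intro degree_sum_le) (auto intro: order.trans[OF degree_monom_le])

lemma degree_beta_rem: "degree (beta_rem n) \<le> n - 1"
  unfolding beta_rem_def
proof (intro degree_sum_le)
  fix k assume "k \<in> {..<n}"
  then have k: "k \<le> n - 1" by auto
  have "degree (gpol k - smult (1 / 4) (fpol k)) \<le> n - 1"
    using degree_fpol[of k] degree_gpol[of k] k by (intro degree_diff_le) (auto intro: order.trans)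
  then show "degree (smult (cbin k / (2 * of_nat k + 1)) (gpol k - smult (1 / 4) (fpol k))) \<le> n - 1"
    by (auto simp: degree_smult_eq)
qed simp

lemma degree_zeta_rem: "degree (zeta_rem n) \<le> n - 1"
  unfolding zeta_rem_def
proof (intro degree_sum_le)
  fix k assume "k \<in> {..<n}"
  then have k: "k \<le> n - 1" by auto
  have "degree (gpol k + smult (1 / 4) (fpol k)) \<le> n - 1"
    using degree_fpol[of k] degree_gpol[of k] k by (intro degree_add_le) (auto intro: order.trans)
  then show "degree (smult ((- 1) ^ k * cbin k / (2 * of_nat k + 1) ^ 2) (gpol k + smult (1 / 4) (fpol k))) \<le> n - 1"
    by (auto simp: degree_smult_eq)
qed simp

lemma degree_pcompose_linear: "degree (pcompose f [:c, 1:]) \<le> degree (f :: rat poly)"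
  by (simp add: degree_pcompose)

context odd_prime
begin

lemma not_dvd_node: "k < N \<Longrightarrow> \<not> p dvd 2 * k + 1"
  using two_N by (intro not_dvd_less) auto

lemma Zp_inverse_node: "k < N \<Longrightarrow> 1 / (2 * of_nat k + 1) \<in> Zp"
  using Zp_inverse_nat[OF not_dvd_node[of k]] by (simp add: add.commute)

lemma Zp_cbin: "cbin k \<in> Zp"
proof -
  have "\<not> p dvd 2 ^ (4 * k)" by (rule not_dvd_power[OF not_dvd_2])
  then have "of_nat ((2 * k) choose k) / of_nat (2 ^ (4 * k)) \<in> Zp" by (intro Zp_divide_nat) auto
  then show ?thesis by (simp add: cbin_def power_mult)
qed

lemma Zpoly_fpol: "k \<le> N \<Longrightarrow> Zpoly (fpol k)"
  unfolding fpol_def using Zp_power[OF Zp_inverse_node, of _ 2]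
  by (intro Zpoly_prod) (auto simp: power_one_over)

lemma Zpoly_gpol: "k \<le> N \<Longrightarrow> Zpoly (gpol k)"
  unfolding gpol_def using Zpoly_synthetic_div[OF Zpoly_fpol, of k "(2 * of_nat k + 1) ^ 2"]
  by (intro Zpoly_smult) auto

lemma Zpoly_beta_rem: "Zpoly (beta_rem N)"
  unfolding beta_rem_def
proof (intro Zpoly_sum Zpoly_smult Zpoly_diff)
  fix k assume k: "k \<in> {..<N}"
  show "cbin k / (2 * of_nat k + 1) \<in> Zp"
    using Zp_mult[OF Zp_cbin Zp_inverse_node, of k k] k by simp
qed (auto intro: Zpoly_fpol Zpoly_gpol)

lemma Zpoly_zeta_rem: "Zpoly (zeta_rem N)"
  unfolding zeta_rem_def
proof (intro Zpoly_sum Zpoly_smult Zpoly_add)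
  fix k assume k: "k \<in> {..<N}"
  have "(- 1) ^ k * cbin k * (1 / (2 * of_nat k + 1)) ^ 2 \<in> Zp"
    using k by (intro Zp_mult Zp_power Zp_cbin Zp_inverse_node) auto
  then show "(- 1) ^ k * cbin k / (2 * of_nat k + 1) ^ 2 \<in> Zp"
    by (simp add: power_one_over)
qed (auto intro: Zpoly_fpol Zpoly_gpol)

lemma fermat_pcong': "pcong 1 (of_nat a ^ p) (of_nat a)"
proof (cases "p dvd a")
  case True
  then obtain b where b: "a = p * b" by blast
  have *: "pcong 1 (of_nat a ^ Suc k) 0" for k
    using pcong_prime_power[of "of_nat b * of_nat a ^ k" 1] by (simp add: b mult.assoc)
  have "pcong 1 (of_nat a ^ Suc (p - 1)) (of_nat a ^ Suc 0)" using pcong_trans[OF * pcong_sym[OF *]] .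
  then show ?thesis using p_pos by simp
next
  case False
  have "pcong 1 (of_nat a * of_nat a ^ (p - 1)) (of_nat a * 1)"
    by (intro pcong_scale fermat_pcong False) auto
  then show ?thesis using p_pos by (simp flip: power_Suc)
qed

lemma inverse_power_pcong:
  assumes "\<not> p dvd a" "s \<le> p - 1"
  shows "pcong 1 (1 / of_nat a ^ s) (of_nat a ^ (p - 1 - s))"
proof -
  have a: "(of_nat a :: rat) \<noteq> 0" using assms(1) by (intro notI) auto
  have "1 / of_nat (a ^ s) \<in> Zp" using assms(1) by (intro Zp_inverse_nat not_dvd_power)
  then have "pcong 1 (1 / of_nat a ^ s * of_nat a ^ (p - 1)) (1 / of_nat a ^ s * 1)"
    using assms(1) by (intro pcong_scale fermat_pcong) auto
  moreover have "1 / of_nat a ^ s * of_nat a ^ (p - 1) = (of_nat a ^ (p - 1 - s) :: rat)"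
    by (simp only: power_diff[OF a assms(2)] times_divide_eq_left mult_1_left)
  ultimately show ?thesis using pcong_sym by simp
qed

section \<open>The odd values\<close>

abbreviation eps :: rat where "eps \<equiv> (- 1) ^ Suc N"

lemma pcong_N: "pcong 1 (2 * of_nat N) (- 1)"
proof -
  have "(of_nat (2 * N + 1) :: rat) = of_nat p" by (simp only: two_N)
  then have "(2 * of_nat N :: rat) = of_nat p - 1" by simp
  then show ?thesis using pcong_p_minus[of 1] by simp
qed

lemma pcong_N_sqr: "pcong 1 (4 * of_nat N ^ 2) 1"
  using pcong_power[OF _ _ pcong_N, of 2] by (simp add: power_mult_distrib)

text \<open>
The antiderivative of the remainder in the variable \<open>a\<close> (not \<open>a^2\<close>), with constant term \<open>0\<close> so that it
is odd. The denominators \<open>2j + 1\<close> are below \<open>p\<close>.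
\<close>

definition beta_anti :: "rat poly" where
  "beta_anti = (\<Sum>j<N. monom (coeff (beta_rem N) j / of_nat (2 * j + 1)) (2 * j + 1))"

lemma poly_pderiv_beta_anti: "poly (pderiv beta_anti) x = poly (beta_rem N) (x ^ 2)"
proof -
  have "pderiv beta_anti = (\<Sum>j<N. monom (coeff (beta_rem N) j) (2 * j))"
    unfolding beta_anti_def pderiv_sum pderiv_monom by (intro sum.cong refl) (simp del: of_nat_add of_nat_mult of_nat_Suc)
  then have "poly (pderiv beta_anti) x = (\<Sum>j<N. coeff (beta_rem N) j * (x ^ 2) ^ j)"
    by (simp add: poly_sum poly_monom power_mult)
  also have "{..<N} = {..N - 1}" using N_gt_1 by auto
  also have "(\<Sum>j\<le>N - 1. coeff (beta_rem N) j * (x ^ 2) ^ j) = poly (beta_rem N) (x ^ 2)"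
    by (rule poly_eq_sum_le[OF degree_beta_rem, symmetric])
  finally show ?thesis .
qed

lemma beta_anti_odd: "poly beta_anti (- x) = - poly beta_anti x"
  by (simp add: beta_anti_def poly_sum poly_monom sum_negf)

lemma Zpoly_beta_anti: "Zpoly beta_anti"
  unfolding beta_anti_def
proof (intro Zpoly_sum Zpoly_monom Zp_divide_nat)
  fix j assume "j \<in> {..<N}"
  then show "\<not> p dvd 2 * j + 1" by (intro not_dvd_node) auto
qed (use Zpoly_beta_rem in \<open>auto simp: Zpoly_def\<close>)

lemma degree_beta_anti: "degree beta_anti \<le> p - 2"
  unfolding beta_anti_def using two_N
  by (intro degree_sum_le) (auto intro: order.trans[OF degree_monom_le])

lemma coeff_beta_anti: "m < N \<Longrightarrow> of_nat (2 * m + 1) * coeff beta_anti (2 * m + 1) = coeff (beta_rem N) m"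
  unfolding beta_anti_def by (simp add: coeff_sum sum.delta' del: of_nat_add of_nat_mult of_nat_Suc)

text \<open>
Modulo \<open>p\<close> we have \<open>4 N^2 = 1\<close> and \<open>2 N = -1\<close>, so the exact equation reads \<open>\<plusminus> 1 / (1 - a^2)\<close> with
\<open>a = 2l\<close>, and this is the value of the derivative of \<open>odd_geom\<close>.
\<close>

lemma beta_rem_shift_pcong:
  assumes "l < N"
  shows "pcong 1 (poly (beta_rem N) ((2 * of_nat l + 1) ^ 2) + poly (beta_rem N) ((2 * of_nat l - 1) ^ 2))
     (eps * poly (pderiv (odd_geom N)) (2 * of_nat l))"
proof -
  define S where "S = poly (beta_rem N) ((2 * of_nat l + 1) ^ 2) + poly (beta_rem N) ((2 * of_nat l - 1) ^ 2)"
  define a where "a = 2 * l"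
  define G G' where "G = poly (odd_geom N) (of_nat a)" and "G' = poly (pderiv (odd_geom N)) (of_nat a)"
  have Zgeom: "Zpoly (odd_geom N)" unfolding odd_geom_def by (intro Zpoly_sum Zpoly_monom) auto
  have Z: "S \<in> Zp" "G \<in> Zp" "G' \<in> Zp" unfolding S_def G_def G'_def using Zpoly_beta_rem Zgeom
    by (auto intro!: Zp_poly simp: Zpoly_def coeff_pderiv)
  have unit: "\<not> int p dvd 1 - int a ^ 2"
  proof
    assume "int p dvd 1 - int a ^ 2"
    moreover have "1 - int a ^ 2 = (1 - int a) * (1 + int a)" by (simp add: power2_eq_square algebra_simps)
    ultimately have "int p dvd 1 - int a \<or> int p dvd 1 + int a"
      using prime_dvd_mult_iff[OF prime_int] by simp
    moreover have "1 - int a \<noteq> 0" "\<bar>1 - int a\<bar> < int p" "1 + int a \<noteq> 0" "\<bar>1 + int a\<bar> < int p"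
      using assms two_N unfolding a_def by presburger+
    ultimately show False using dvd_imp_le_int[of "1 - int a" "int p"] dvd_imp_le_int[of "1 + int a" "int p"]
      by auto
  qed
  have G0: "pcong 1 G 0"
  proof -
    have "(1 - of_nat a ^ 2) * G = of_nat a - of_nat a ^ p"
      using odd_geom_values(1)[of "of_nat a" N, unfolded two_N] by (simp add: G_def)
    moreover have "pcong 1 (of_nat a - of_nat a ^ p) (of_nat a - of_nat a)"
      by (intro pcong_diff fermat_pcong') auto
    ultimately have "pcong 1 (of_int (1 - int a ^ 2) * G) (of_int (1 - int a ^ 2) * 0)" by simp
    then show ?thesis by (rule pcong_cancel_int[OF unit])
  qed
  have G'1: "pcong 1 ((1 - of_nat a ^ 2) * G') 1"
  proof -
    have "(1 - of_nat a ^ 2) * G' = 1 - of_nat p * of_nat a ^ (2 * N) + 2 * of_nat a * G"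
      using odd_geom_values(2)[of "of_nat a" N, unfolded two_N] by (simp add: G_def G'_def)
    also have "pcong 1 \<dots> (1 - 0 + 2 * of_nat a * 0)"
      using pcong_prime_power[of "of_nat a ^ (2 * N)" 1]
      by (intro pcong_add pcong_diff pcong_scale G0) auto
    finally show ?thesis by simp
  qed
  have c: "pcong 1 (1 - of_nat a ^ 2) (4 * of_nat N ^ 2 - of_nat a ^ 2)"
    by (intro pcong_diff pcong_sym[OF pcong_N_sqr]) auto
  have "pcong 1 ((1 - of_nat a ^ 2) * S) ((4 * of_nat N ^ 2 - of_nat a ^ 2) * S)"
    by (intro pcong_scale_right c Z)
  also have "(4 * of_nat N ^ 2 - of_nat a ^ 2) * S = (- 1) ^ N * (2 * of_nat N)"
    using beta_functional[OF assms] by (simp add: S_def a_def power_mult_distrib)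
  also have "pcong 1 \<dots> ((- 1) ^ N * (- 1))" by (intro pcong_scale pcong_N) auto
  also have "\<dots> = eps * 1" by simp
  also have "pcong 1 \<dots> (eps * ((1 - of_nat a ^ 2) * G'))" by (intro pcong_scale pcong_sym[OF G'1]) auto
  also have "\<dots> = (1 - of_nat a ^ 2) * (eps * G')" by simp
  finally have "pcong 1 (of_int (1 - int a ^ 2) * S) (of_int (1 - int a ^ 2) * (eps * G'))" by simp
  then show ?thesis using pcong_cancel_int[OF unit] by (simp add: S_def G'_def a_def)
qed

text \<open>
The derivative of the claimed identity has degree at most \<open>p - 3\<close> and holds at the \<open>p - 2\<close> even numbers
\<open>2l\<close> with \<open>\<bar>l\<bar> < N\<close>, hence coefficientwise. Integration is harmless modulo \<open>p\<close> for exponents up to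
\<open>p - 2\<close>, and the constant of integration vanishes by oddness.
\<close>

lemma beta_anti_functional:
  assumes "x \<in> Zp"
  shows "pcong 1 (poly beta_anti (x + 1) + poly beta_anti (x - 1)) (eps * poly (odd_geom N) x)"
proof -
  define D where "D = pcompose beta_anti [:1, 1:] + pcompose beta_anti [:- 1, 1:] - smult eps (odd_geom N)"
  have D: "poly D x = poly beta_anti (x + 1) + poly beta_anti (x - 1) - eps * poly (odd_geom N) x" for x
    by (simp add: D_def poly_pcompose add.commute)
  have ZD: "Zpoly D" unfolding D_def odd_geom_def
    by (intro Zpoly_diff Zpoly_add Zpoly_pcompose Zpoly_smult Zpoly_sum Zpoly_monom Zpoly_beta_anti) auto
  have degD: "degree D \<le> p - 2" unfolding D_def
    using degree_beta_anti degree_odd_geom[of N] two_N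
    by (intro degree_diff_le degree_add_le order.trans[OF degree_pcompose_linear]) auto
  define K where "K = pderiv D"
  have K: "poly K x = poly (beta_rem N) ((x + 1) ^ 2) + poly (beta_rem N) ((x - 1) ^ 2) - eps * poly (pderiv (odd_geom N)) x" for x
    unfolding K_def D_def
    by (simp add: pderiv_diff pderiv_add pderiv_smult pderiv_pcompose pderiv_pCons poly_pcompose
        poly_pderiv_beta_anti add.commute)
  have geom_even: "poly (pderiv (odd_geom N)) (- x) = poly (pderiv (odd_geom N)) x" for x
    by (simp add: odd_geom_def pderiv_sum pderiv_monom poly_sum poly_monom)
  have K_even: "poly K (- x) = poly K x" for x
  proof -
    have "(- x + 1) ^ 2 = (x - 1) ^ 2" "(- x - 1) ^ 2 = (x + 1) ^ 2" by (simp_all add: power2_eq_square algebra_simps)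
    then show ?thesis unfolding K geom_even by simp
  qed
  define X where "X = (\<lambda>l. 2 * l) ` {- int (N - 1)..int (N - 1)}"
  have K0: "pcong 1 (coeff K i) 0" for i
  proof (rule coeffs_pcong_zero_if_many_roots)
    show "finite X" by (simp add: X_def)
    show "pcong 1 (poly K (of_int x)) 0" if x: "x \<in> X" for x
    proof -
      obtain i where i: "x = 2 * i" "i \<in> {- int (N - 1)..int (N - 1)}" using x unfolding X_def by blast
      define l where "l = nat \<bar>i\<bar>"
      have l: "l < N" using i(2) N_gt_1 by (auto simp: l_def)
      have "poly K (of_int x) = poly K (2 * of_nat l)"
        using K_even[of "of_int x"] by (cases "i \<ge> 0") (simp_all add: l_def i(1))
      moreover have "pcong 1 (poly K (2 * of_nat l)) (eps * poly (pderiv (odd_geom N)) (2 * of_nat l) - eps * poly (pderiv (odd_geom N)) (2 * of_nat l))"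
        unfolding K by (intro pcong_diff beta_rem_shift_pcong[OF l] pcong_refl)
      ultimately show ?thesis by simp
    qed
    show "\<not> int p dvd x - y" if xy: "x \<in> X" "y \<in> X" "x \<noteq> y" for x y
    proof
      obtain i j where ij: "x = 2 * i" "y = 2 * j" "\<bar>i\<bar> \<le> int (N - 1)" "\<bar>j\<bar> \<le> int (N - 1)"
        using xy unfolding X_def by auto
      assume "int p dvd x - y"
      then have "int p dvd 2 * (i - j)" by (simp add: ij algebra_simps)
      moreover have "\<not> int p dvd 2" using not_dvd_2 by (metis int_dvd_int_iff of_nat_numeral)
      ultimately have "int p dvd i - j" using prime_dvd_mult_iff[OF prime_int] by blast
      moreover have "i - j \<noteq> 0" "\<bar>i - j\<bar> < int p" using ij xy(3) two_N N_gt_1 by linarith+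
      ultimately show False using dvd_imp_le_int[of "i - j" "int p"] by simp
    qed
    have "card X = 2 * N - 1" unfolding X_def using N_gt_1
      by (subst card_image) (auto simp: inj_on_def)
    moreover have "degree K \<le> p - 3" unfolding K_def using degD by (simp add: degree_pderiv)
    ultimately show "degree K < card X" using two_N N_gt_1 by linarith
    show "Zpoly K" using ZD by (auto simp: K_def Zpoly_def coeff_pderiv)
  qed
  have "pcong 1 (coeff D i) 0" for i
  proof (cases i)
    case 0
    have "poly D 0 = 0" using beta_anti_odd[of 1] by (simp add: D poly_odd_geom)
    then show ?thesis using 0 by (simp add: poly_0_coeff_0)
  next
    case (Suc j)
    show ?thesis
    proof (cases "i \<le> p - 2")
      case True
      have "pcong 1 (of_nat i * coeff D i) (of_nat i * 0)"
        using K0[of j] by (simp add: K_def coeff_pderiv Suc)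
      moreover have "\<not> p dvd i" using True Suc gt3 by (intro not_dvd_less) auto
      ultimately show ?thesis by (rule pcong_cancel_nat[rotated])
    next
      case False
      then show ?thesis using degD by (simp add: coeff_eq_0)
    qed
  qed
  then have "pcong 1 (poly D x) 0" by (rule pcong_coeffs_poly[OF _ assms])
  then have "pcong 1 (poly D x + eps * poly (odd_geom N) x) (0 + eps * poly (odd_geom N) x)"
    by (intro pcong_add pcong_refl)
  then show ?thesis by (simp add: D)
qed

text \<open>
Starting from \<open>V(0) = 0\<close>, the step from \<open>0\<close> to \<open>2\<close> crosses \<open>x = 1\<close>, where \<open>odd_geom\<close> has the value
\<open>N = -1/2\<close>. The later steps cross \<open>x = 2t + 1\<close> with \<open>1 \<le> t < p - 1\<close>, where it is zero.
\<close>

lemma beta_anti_values: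
  assumes "1 \<le> t" "t \<le> p - 1"
  shows "pcong 1 (poly beta_anti (2 * of_nat t)) ((- 1) ^ t * (eps / 2))"
  using assms
proof (induction t rule: dec_induct)
  case base
  have "poly beta_anti 0 = 0" using beta_anti_odd[of 0] by simp
  then have "pcong 1 (poly beta_anti 2) (eps * of_nat N)"
    using beta_anti_functional[of 1] by (simp add: poly_odd_geom)
  also have "\<dots> = (eps / 2) * (2 * of_nat N)" by simp
  also have "pcong 1 \<dots> ((eps / 2) * (- 1))" by (intro pcong_scale pcong_N) auto
  finally show ?case by simp
next
  case (step t)
  define x :: rat where "x = 2 * of_nat t + 1"
  have xnat: "x = of_nat (2 * t + 1)" by (simp add: x_def)
  have unit: "\<not> int p dvd 1 - int (2 * t + 1) ^ 2"
  proof
    assume "int p dvd 1 - int (2 * t + 1) ^ 2"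
    moreover have "1 - int (2 * t + 1) ^ 2 = - int (4 * (t * (t + 1)))" by (simp add: power2_eq_square algebra_simps)
    ultimately have "p dvd 4 * (t * (t + 1))" by (simp only: dvd_minus_iff int_dvd_int_iff)
    moreover have "\<not> p dvd t" "\<not> p dvd t + 1" using step by (intro not_dvd_less; simp)+
    ultimately show False using not_dvd_4 prime_dvd_mult_iff[OF prime] by blast
  qed
  have "pcong 1 (poly (odd_geom N) x) 0"
  proof -
    have "(1 - x ^ 2) * poly (odd_geom N) x = x - x ^ p"
      using odd_geom_values(1)[of x N, unfolded two_N] .
    moreover have "pcong 1 (x - x ^ p) (x - x)" unfolding xnat by (intro pcong_diff fermat_pcong') auto
    ultimately have "pcong 1 (of_int (1 - int (2 * t + 1) ^ 2) * poly (odd_geom N) x) (of_int (1 - int (2 * t + 1) ^ 2) * 0)"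
      by (simp add: x_def add.commute)
    then show ?thesis by (rule pcong_cancel_int[OF unit])
  qed
  then have "pcong 1 (eps * poly (odd_geom N) x) (eps * 0)" by (intro pcong_scale) auto
  then have "pcong 1 (poly beta_anti (x + 1) + poly beta_anti (x - 1)) 0"
    using pcong_trans[OF beta_anti_functional[of x]] by (simp add: xnat)
  then have "pcong 1 (poly beta_anti (x + 1) + poly beta_anti (x - 1) - poly beta_anti (x - 1)) (0 - (- 1) ^ t * (eps / 2))"
    using step by (intro pcong_diff) (auto simp: x_def)
  then show ?case by (simp add: x_def algebra_simps)
qed

lemma coeff_beta_rem_pcong:
  assumes "m < N"
  shows "pcong 1 (coeff (beta_rem N) m) (- (of_nat (2 * m + 1) * (eps / 2 * 2 ^ (p - 2 - 2 * m) * alt_psum (p - 2 - 2 * m))))"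
proof -
  define u where "u = p - 2 - 2 * m"
  have u: "p - 1 - (2 * m + 1) = u" and m: "2 * m + 1 \<le> p - 2" using assms two_N by (simp_all add: u_def)
  have "pcong 1 (- coeff beta_anti (2 * m + 1)) (\<Sum>t=1..<p. poly beta_anti (2 * of_nat t) * (2 * of_nat t) ^ u)"
    using pcong_sym[OF coeff_by_power_sums[OF Zpoly_beta_anti degree_beta_anti m]] unfolding u .
  also have "pcong 1 \<dots> (\<Sum>t=1..<p. ((- 1) ^ t * (eps / 2)) * (2 * of_nat t) ^ u)"
    by (intro pcong_sum pcong_scale_right beta_anti_values) auto
  also have "\<dots> = eps / 2 * 2 ^ u * alt_psum u"
    unfolding alt_psum_def sum_distrib_left by (intro sum.cong refl) (simp add: power_mult_distrib mult_ac)
  finally have "pcong 1 (- of_nat (2 * m + 1) * (- coeff beta_anti (2 * m + 1))) (- of_nat (2 * m + 1) * (eps / 2 * 2 ^ u * alt_psum u))"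
    by (rule pcong_scale[rotated]) (intro Zp_minus Zp_of_nat)
  then show ?thesis using coeff_beta_anti[OF assms] by (simp only: minus_mult_minus minus_mult_left u_def)
qed

text \<open>
Substituting \<open>2k + 1 = p - 2x\<close> turns the sum over odd numbers into half of an alternating power sum:
the exponent is odd and \<open>p\<close> is odd, so \<open>x\<close> and \<open>p - x\<close> contribute equally.
\<close>

lemma alternating_inverse_sum_pcong:
  assumes "m < N"
  shows "pcong 1 (\<Sum>k<N. (- 1) ^ k / (2 * of_nat k + 1) ^ (2 * m + 1)) (eps / 2 * 2 ^ (p - 2 - 2 * m) * alt_psum (p - 2 - 2 * m))"
proof -
  define u where "u = p - 2 - 2 * m"
  have u: "p - 1 - (2 * m + 1) = u" "2 * m + 1 \<le> p - 1" and odd_u: "odd u" using assms odd_p two_N by (auto simp: u_def)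
  have neg: "pcong 1 ((of_nat p - x) ^ u) (- (x ^ u))" if "x \<in> Zp" for x
    using pcong_power[OF _ _ pcong_p_minus, of x u] that odd_u by auto
  define A where "A = (\<Sum>x=1..N. (- 1) ^ x * of_nat x ^ u :: rat)"
  have alt: "pcong 1 (alt_psum u) (2 * A)"
  proof -
    have "alt_psum u = (\<Sum>x=1..N. (- 1) ^ x * of_nat x ^ u + (- 1) ^ (p - x) * of_nat (p - x) ^ u)"
      unfolding alt_psum_def by (rule sum_split_reflect[where n = N, unfolded two_N])
    also have "\<dots> = (\<Sum>x=1..N. (- 1) ^ x * of_nat x ^ u + (- ((- 1) ^ x)) * (of_nat p - of_nat x) ^ u)"
    proof (intro sum.cong refl)
      fix x assume x: "x \<in> {1..N}"
      then have "x \<le> p" using two_N by simp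
      then have "(- 1 :: rat) ^ (p - x) = - ((- 1) ^ x)" using odd_p by (auto simp: minus_one_power_iff)
      then show "(- 1) ^ x * of_nat x ^ u + (- 1) ^ (p - x) * of_nat (p - x) ^ u
         = (- 1) ^ x * of_nat x ^ u + (- ((- 1) ^ x)) * (of_nat p - of_nat x :: rat) ^ u"
        using \<open>x \<le> p\<close> by (simp add: of_nat_diff)
    qed
    also have "pcong 1 \<dots> (\<Sum>x=1..N. (- 1) ^ x * of_nat x ^ u + (- ((- 1) ^ x)) * (- (of_nat x ^ u)))"
      by (intro pcong_sum pcong_add pcong_scale neg pcong_refl) auto
    also have "\<dots> = 2 * A" by (simp add: A_def sum.distrib flip: sum_distrib_left)
    finally show ?thesis .
  qed
  have "pcong 1 (\<Sum>k<N. (- 1) ^ k / (2 * of_nat k + 1) ^ (2 * m + 1)) (\<Sum>k<N. (- 1) ^ k * of_nat (2 * k + 1) ^ u)"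
  proof (rule pcong_sum)
    fix k assume "k \<in> {..<N}"
    then have "pcong 1 (1 / of_nat (2 * k + 1) ^ (2 * m + 1)) (of_nat (2 * k + 1) ^ u)"
      using inverse_power_pcong[OF not_dvd_node u(2)] u(1) by simp
    then have "pcong 1 ((- 1) ^ k * (1 / of_nat (2 * k + 1) ^ (2 * m + 1))) ((- 1) ^ k * of_nat (2 * k + 1) ^ u)"
      by (intro pcong_scale) auto
    then show "pcong 1 ((- 1) ^ k / (2 * of_nat k + 1) ^ (2 * m + 1)) ((- 1) ^ k * of_nat (2 * k + 1) ^ u)" by (simp add: add.commute)
  qed
  also have "(\<Sum>k<N. (- 1) ^ k * of_nat (2 * k + 1) ^ u) = (\<Sum>x=1..N. (- 1) ^ (N - x) * (of_nat p - 2 * of_nat x) ^ u :: rat)"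
  proof -
    have "(\<Sum>k<N. (- 1) ^ k * of_nat (2 * k + 1) ^ u) = (\<Sum>x=1..N. (- 1) ^ ((p - 2 * x - 1) div 2) * of_nat (p - 2 * x) ^ u :: rat)"
      using sum_odd_reflect[where n = N and f = "\<lambda>n. (- 1) ^ ((n - 1) div 2) * of_nat n ^ u :: rat", unfolded two_N]
      by simp
    also have "\<dots> = (\<Sum>x=1..N. (- 1) ^ (N - x) * (of_nat p - 2 * of_nat x) ^ u)"
    proof (intro sum.cong refl)
      fix x assume "x \<in> {1..N}"
      then have "(p - 2 * x - 1) div 2 = N - x" "2 * x \<le> p" using two_N by auto
      then show "(- 1) ^ ((p - 2 * x - 1) div 2) * of_nat (p - 2 * x) ^ u = (- 1) ^ (N - x) * (of_nat p - 2 * of_nat x :: rat) ^ u"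
        by (simp add: of_nat_diff)
    qed
    finally show ?thesis .
  qed
  also have "pcong 1 \<dots> (\<Sum>x=1..N. (- 1) ^ (N - x) * (- ((2 * of_nat x) ^ u)))"
    by (intro pcong_sum pcong_scale neg) auto
  also have "\<dots> = eps / 2 * 2 ^ u * (2 * A)"
    unfolding A_def sum_distrib_left
  proof (intro sum.cong refl)
    fix x assume "x \<in> {1..N}"
    then have "(- 1 :: rat) ^ (N - x) = (- 1) ^ N * (- 1) ^ x" by (auto simp: minus_one_power_iff)
    then show "(- 1) ^ (N - x) * (- ((2 * of_nat x) ^ u)) = eps / 2 * 2 ^ u * (2 * ((- 1) ^ x * of_nat x ^ u))"
      by (simp add: power_mult_distrib)
  qed
  also have "pcong 1 \<dots> (eps / 2 * 2 ^ u * alt_psum u)"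
    by (intro pcong_scale pcong_sym[OF alt]) auto
  finally show ?thesis unfolding u_def .
qed

lemma half_range: "{0..(p - 3) div 2} = {..<N}"
  using two_N N_gt_1 by auto

lemma beta_odd_pcong_alt_psum:
  assumes "m < N"
  shows "pcong 1 (beta_odd p m) (- (of_nat m * eps * 2 ^ (p - 2 - 2 * m) * alt_psum (p - 2 - 2 * m)))"
proof -
  define W where "W = eps / 2 * 2 ^ (p - 2 - 2 * m) * alt_psum (p - 2 - 2 * m)"
  have "beta_odd p m = (\<Sum>k<N. (- 1) ^ k / (2 * of_nat k + 1) ^ (2 * m + 1)) + coeff (beta_rem N) m"
    unfolding beta_odd_def half_range by (rule beta_sum_eq)
  also have "pcong 1 \<dots> (W + - (of_nat (2 * m + 1) * W))"
    unfolding W_def by (intro pcong_add alternating_inverse_sum_pcong coeff_beta_rem_pcong assms)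
  also have "\<dots> = - (of_nat m * eps * 2 ^ (p - 2 - 2 * m) * alt_psum (p - 2 - 2 * m))"
    by (simp add: W_def algebra_simps)
  finally show ?thesis .
qed

text \<open>
The exponent \<open>e = p - 1 - 2m\<close> satisfies \<open>e = - (2m + 1)\<close> and \<open>4^m 2^e = 1\<close> modulo \<open>p\<close>. For \<open>m = 0\<close>
both sides are zero; this case is separate because \<open>B\<^sub>p\<^sub>-\<^sub>1\<close> is not p-integral.
\<close>

theorem beta_odd_pcong:
  assumes "p > 2 * m + 3"
  shows "pcong 1 (beta_odd p m)
    ((- 1) ^ ((p + 1) div 2) * of_nat m * (4 ^ m - 1) / (16 ^ m * (2 * of_nat m + 1)) * bernoulli (p - 2 * m - 1))"
proof (cases "m = 0")
  case True
  then show ?thesis using beta_odd_pcong_alt_psum[of 0] N_gt_1 by simp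
next
  case False
  define e where "e = p - 2 * m - 1"
  define B where "B = bernoulli e"
  have e: "even e" "0 < e" "e \<le> p - 2" "p - 2 - 2 * m = e - 1" "e + 2 * m = p - 1" "e + (2 * m + 1) = p"
  proof -
    show p: "e + (2 * m + 1) = p" using assms by (simp add: e_def)
    then show "even e" using odd_p by presburger
    show "0 < e" "e \<le> p - 2" "p - 2 - 2 * m = e - 1" "e + 2 * m = p - 1"
      using p assms False by linarith+
  qed
  have m: "m < N" using assms two_N by linarith
  have ZB: "B \<in> Zp" unfolding B_def by (rule Zp_bernoulli[OF e(3)])
  have eps: "(p + 1) div 2 = Suc N" using two_N by presburger
  have two: "2 * (2 :: rat) ^ (e - 1) = 2 ^ e" using e(2) by (metis power_minus_mult mult.commute)
  have four: "pcong 1 (4 ^ m * 2 ^ e) (1 :: rat)"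
  proof -
    have "(4 :: rat) ^ m * 2 ^ e = 2 ^ (p - 1)"
      unfolding e(5) [symmetric] by (simp add: power_add power_mult)
    then show ?thesis using fermat_pcong[OF not_dvd_2] by simp
  qed
  have minus_e: "pcong 1 (- of_nat (2 * m + 1)) (of_nat e)"
  proof -
    have "(of_nat p :: rat) = of_nat e + of_nat (2 * m + 1)" unfolding e(6) [symmetric] by (rule of_nat_add)
    then have "of_nat e = (of_nat p - of_nat (2 * m + 1) :: rat)" by simp
    then show ?thesis using pcong_sym[OF pcong_p_minus[of "of_nat (2 * m + 1)"]] by (simp only:)
  qed
  define W where "W = alt_psum (e - 1)"
  have ZW: "W \<in> Zp" unfolding W_def alt_psum_def by (auto intro!: Zp_sum)
  have "pcong 1 (of_nat (16 ^ m * (2 * m + 1)) * beta_odd p m)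
     (of_nat (16 ^ m * (2 * m + 1)) * (- (of_nat m * eps * 2 ^ (e - 1) * W)))"
    unfolding W_def using beta_odd_pcong_alt_psum[OF m, unfolded e(4)] by (intro pcong_scale) auto
  also have "\<dots> = (16 ^ m * of_nat m * eps * 2 ^ (e - 1) * W) * (- of_nat (2 * m + 1))" by (simp add: algebra_simps)
  also have "pcong 1 \<dots> ((16 ^ m * of_nat m * eps * 2 ^ (e - 1) * W) * of_nat e)"
    using ZW by (intro pcong_scale minus_e) auto
  also have "\<dots> = (16 ^ m * of_nat m * eps * 2 ^ (e - 1)) * (of_nat e * W)" by simp
  also have "pcong 1 \<dots> ((16 ^ m * of_nat m * eps * 2 ^ (e - 1)) * (2 * (1 - 2 ^ e) * B))"
    unfolding W_def B_def by (intro pcong_scale alt_psum_bernoulli e) auto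
  also have "\<dots> = (of_nat m * eps * B) * ((4 ^ m * 2 ^ e) * (4 ^ m - 4 ^ m * 2 ^ e))"
  proof -
    have "(16 :: rat) ^ m = 4 ^ m * 4 ^ m" by (simp flip: power_mult_distrib)
    then show ?thesis by (simp add: algebra_simps flip: two)
  qed
  also have "pcong 1 \<dots> ((of_nat m * eps * B) * (1 * (4 ^ m - 1)))"
    using ZB four by (intro pcong_scale pcong_mult pcong_diff) auto
  also have "\<dots> = of_nat (16 ^ m * (2 * m + 1)) * (eps * of_nat m * (4 ^ m - 1) / (16 ^ m * (2 * of_nat m + 1)) * B)"
  proof -
    define K :: rat where "K = of_nat (16 ^ m * (2 * m + 1))"
    have "16 ^ m * (2 * of_nat m + 1) = K" by (simp add: K_def algebra_simps)
    moreover have "K \<noteq> 0" unfolding K_def of_nat_eq_0_iff by simp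
    ultimately show ?thesis unfolding K_def [symmetric] by simp
  qed
  finally have *: "pcong 1 (of_nat (16 ^ m * (2 * m + 1)) * beta_odd p m)
     (of_nat (16 ^ m * (2 * m + 1)) * (eps * of_nat m * (4 ^ m - 1) / (16 ^ m * (2 * of_nat m + 1)) * B))" .
  have "\<not> p dvd 16 ^ m * (2 * m + 1)"
  proof -
    have "\<not> p dvd 16 ^ m" using not_dvd_power[OF not_dvd_2, of "4 * m"] by (simp add: power_mult)
    then show ?thesis using prime_dvd_mult_iff[OF prime] not_dvd_node[OF m] by blast
  qed
  then show ?thesis unfolding eps using pcong_cancel_nat[OF _ *] unfolding B_def e_def by blast
qed

end

section \<open>The even values\<close>

lemma sqr_pol_pCons: "sqr_pol (pCons a f) = pCons a (pCons 0 (sqr_pol f))"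
  by (simp add: sqr_pol_def pcompose_pCons)

lemma coeff_sqr_pol: "coeff (sqr_pol f) (2 * i) = coeff f i"
proof (induction f arbitrary: i)
  case (pCons a f)
  then show ?case by (cases i) (simp_all add: sqr_pol_pCons)
qed (simp add: sqr_pol_def)

lemma coeff_zeta_odd: "coeff (zeta_odd n) (2 * m + 1) = coeff (zeta_rem n) m"
  by (simp add: zeta_odd_def coeff_sqr_pol)

lemma zeta_odd_minus: "poly (zeta_odd n) (- x) = - poly (zeta_odd n) x"
  by (simp add: zeta_odd_def)

lemma degree_zeta_odd: "degree (zeta_odd n) \<le> 2 * (n - 1) + 1"
proof -
  have "degree (zeta_odd n) \<le> degree [:0, 1 :: rat:] + degree (sqr_pol (zeta_rem n))"
    unfolding zeta_odd_def by (rule degree_mult_le)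
  also have "degree (sqr_pol (zeta_rem n)) = degree (zeta_rem n) * 2"
    by (simp add: sqr_pol_def degree_pcompose)
  finally show ?thesis using degree_zeta_rem[of n] by simp
qed

text \<open>
The odd part of \<open>2^(n-1) B\<^sub>n(x/2) / n\<close>, where \<open>B\<^sub>n(x)\<close> is the Bernoulli polynomial. By
\<open>bern_trapezoid_diff\<close>, for odd \<open>n\<close> it sums \<open>x^(n-1)\<close> over steps of length \<open>2\<close> by the trapezoidal rule. Taking the odd
part makes the sum symmetric about \<open>0\<close> and removes the constant term.
\<close>

definition bern_trapezoid :: "nat \<Rightarrow> rat poly" where
  "bern_trapezoid n = (\<Sum>j\<le>n. monom ((1 - (- 1) ^ (n - j)) * of_nat (n choose j) * 2 ^ j * bernoulli j / (4 * of_nat n)) (n - j))"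

lemma poly_bern_trapezoid:
  "poly (bern_trapezoid n) x = 2 ^ n * (bernpoly n (x / 2) - bernpoly n (- x / 2)) / (4 * of_nat n)"
proof -
  have "2 ^ n * (bernpoly n (x / 2) - bernpoly n (- x / 2))
      = (\<Sum>j\<le>n. (1 - (- 1) ^ (n - j)) * of_nat (n choose j) * 2 ^ j * bernoulli j * x ^ (n - j))"
    unfolding bernpoly_def sum_subtractf [symmetric] sum_distrib_left
  proof (intro sum.cong refl)
    fix j assume "j \<in> {..n}"
    then have "(2 :: rat) ^ n = 2 ^ j * 2 ^ (n - j)" by (simp flip: power_add)
    moreover have "(- x / 2) ^ (n - j) = (- 1) ^ (n - j) * (x / 2) ^ (n - j)"
      by (simp flip: power_mult_distrib)
    ultimately show "2 ^ n * (of_nat (n choose j) * bernoulli j * (x / 2) ^ (n - j) - of_nat (n choose j) * bernoulli j * (- x / 2) ^ (n - j))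
        = (1 - (- 1) ^ (n - j)) * of_nat (n choose j) * 2 ^ j * bernoulli j * x ^ (n - j)"
      by (simp add: power_divide algebra_simps)
  qed
  then show ?thesis
    by (simp add: bern_trapezoid_def poly_sum poly_monom sum_divide_distrib)
qed

lemma bern_trapezoid_minus: "poly (bern_trapezoid n) (- x) = - poly (bern_trapezoid n) x"
  unfolding poly_bern_trapezoid by (simp add: algebra_simps diff_divide_distrib)

lemma bern_trapezoid_diff:
  assumes "odd n"
  shows "poly (bern_trapezoid n) (x + 1) - poly (bern_trapezoid n) (x - 1) = ((x + 1) ^ (n - 1) + (x - 1) ^ (n - 1)) / 2"
proof -
  obtain k where n: "n = Suc k" "even k" using assms by (cases n) auto
  have "bernpoly n ((x + 1) / 2) - bernpoly n ((x - 1) / 2) = of_nat n * ((x - 1) / 2) ^ k"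
    using bernpoly_diff[of n "(x - 1) / 2"] by (simp add: n field_simps)
  moreover have "bernpoly n (- (x - 1) / 2) - bernpoly n (- (x + 1) / 2) = of_nat n * ((x + 1) / 2) ^ k"
  proof -
    have "- (x + 1) / 2 + 1 = - (x - 1) / 2" by (simp add: field_simps)
    moreover have "(- (x + 1) / 2) ^ k = ((x + 1) / 2) ^ k"
      using n(2) by (simp only: minus_divide_left [symmetric] power_minus_even)
    ultimately show ?thesis using bernpoly_diff[of n "- (x + 1) / 2"] by (simp only: n(1) diff_Suc_1)
  qed
  ultimately have "(bernpoly n ((x + 1) / 2) - bernpoly n (- (x + 1) / 2)) - (bernpoly n ((x - 1) / 2) - bernpoly n (- (x - 1) / 2))
      = of_nat n * (((x - 1) / 2) ^ k + ((x + 1) / 2) ^ k)"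
    by (simp add: algebra_simps)
  then have "poly (bern_trapezoid n) (x + 1) - poly (bern_trapezoid n) (x - 1)
     = 2 ^ n * (of_nat n * (((x - 1) / 2) ^ k + ((x + 1) / 2) ^ k)) / (4 * of_nat n)"
    unfolding poly_bern_trapezoid by (simp only: flip: diff_divide_distrib right_diff_distrib)
  also have "\<dots> = 2 ^ k * (((x - 1) / 2) ^ k + ((x + 1) / 2) ^ k) / 2"
    by (simp add: n(1) del: of_nat_Suc)
  also have "2 ^ k * (((x - 1) / 2) ^ k + ((x + 1) / 2) ^ k) = (x - 1) ^ k + (x + 1) ^ k"
    by (simp add: power_divide distrib_left)
  finally show ?thesis by (simp add: n(1) add.commute)
qed

lemma coeff_bern_trapezoid:
  assumes "odd i" "i \<le> n"
  shows "coeff (bern_trapezoid n) i = of_nat (n choose i) * 2 ^ (n - i) * bernoulli (n - i) / (2 * of_nat n)"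
proof -
  have "coeff (bern_trapezoid n) i = (\<Sum>j\<le>n. if j = n - i then of_nat (n choose j) * 2 ^ j * bernoulli j / (2 * of_nat n) else 0)"
    unfolding bern_trapezoid_def coeff_sum
    using assms by (intro sum.cong refl) (auto simp: field_simps)
  also have "\<dots> = of_nat (n choose (n - i)) * 2 ^ (n - i) * bernoulli (n - i) / (2 * of_nat n)" by simp
  finally show ?thesis using binomial_symmetric[OF assms(2)] by simp
qed

context odd_prime
begin

lemma odd_p2: "odd (p - 2)" using odd_p gt3 by simp

abbreviation trap :: "rat poly" where "trap \<equiv> bern_trapezoid (p - 2)"

lemma Zpoly_trap: "Zpoly trap"
  unfolding bern_trapezoid_def
proof (intro Zpoly_sum Zpoly_monom)
  fix j assume j: "j \<in> {..p - 2}"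
  have "\<not> p dvd 4 * (p - 2)"
    using not_dvd_4 not_dvd_less[of "p - 2"] gt3 prime_dvd_mult_iff[OF prime, of 4 "p - 2"] by simp
  then have "(1 - (- 1) ^ (p - 2 - j)) * of_nat (p - 2 choose j) * 2 ^ j * bernoulli j / of_nat (4 * (p - 2)) \<in> Zp"
    using j by (intro Zp_divide_nat Zp_mult Zp_bernoulli) auto
  then show "(1 - (- 1) ^ (p - 2 - j)) * of_nat (p - 2 choose j) * 2 ^ j * bernoulli j / (4 * of_nat (p - 2)) \<in> Zp"
    by simp
qed

lemma degree_trap: "degree trap \<le> p - 2"
  unfolding bern_trapezoid_def
  by (intro degree_sum_le) (auto intro: order.trans[OF degree_monom_le])

lemma Zpoly_zeta_odd: "Zpoly (zeta_odd N)"
  unfolding zeta_odd_def sqr_pol_def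
  by (intro Zpoly_mult Zpoly_pcompose Zpoly_zeta_rem) auto

lemma inverse_power_pcong_int:
  assumes "\<not> int p dvd b" "s \<le> p - 1"
  shows "pcong 1 (1 / of_int b ^ s) (of_int b ^ (p - 1 - s))"
proof (cases b rule: int_cases2)
  case (nonneg a)
  then show ?thesis using inverse_power_pcong[of a s] assms by simp
next
  case (nonpos a)
  then have a: "of_int b = (- of_nat a :: rat)" by simp
  have "\<not> p dvd a" using assms(1) nonpos by simp
  then have "pcong 1 ((- 1) ^ s * (1 / of_nat a ^ s)) ((- 1) ^ s * of_nat a ^ (p - 1 - s))"
    using inverse_power_pcong[of a s] assms(2) by (intro pcong_scale) auto
  moreover have "1 / of_int b ^ s = (- 1) ^ s * (1 / of_nat a ^ s :: rat)"
    unfolding a by (cases "even s") simp_all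
  moreover have "of_int b ^ (p - 1 - s) = (- 1) ^ s * (of_nat a ^ (p - 1 - s) :: rat)"
  proof -
    have "even (p - 1)" using odd_p by simp
    then have par: "even (p - 1 - s) \<longleftrightarrow> even s" using even_diff_nat[of "p - 1" s] assms(2) by auto
    show ?thesis
    proof (cases "even s")
      case True
      then show ?thesis unfolding a using par by (subst power_minus_even) auto
    next
      case False
      then show ?thesis unfolding a using par by (subst power_minus_odd) auto
    qed
  qed
  ultimately show ?thesis by (simp only:)
qed

text \<open>
The error is exactly \<open>p^2 / ((p - b) b^2)\<close>.
\<close>

lemma inverse_p_minus_pcong:
  assumes "\<not> int p dvd b"
  shows "pcong 2 (1 / (of_nat p - of_int b)) (- 1 / of_int b - of_nat p / of_int b ^ 2)"
proof -
  have b: "(of_int b :: rat) \<noteq> 0" using assms by (intro notI) simp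
  have pb: "\<not> int p dvd int p - b" using assms by (simp add: dvd_diff_right_iff)
  then have "int p - b \<noteq> 0" by (intro notI) simp
  then have pb0: "(of_nat p - of_int b :: rat) \<noteq> 0"
    by (metis of_int_diff of_int_eq_0_iff of_int_of_nat_eq)
  have "1 / (of_nat p - of_int b) - (- 1 / of_int b - of_nat p / of_int b ^ 2)
      = of_nat p ^ 2 * (1 / (of_nat p - of_int b) * (1 / of_int b) * (1 / of_int b) :: rat)"
    using b pb0 by (simp add: field_simps power2_eq_square)
  moreover have "1 / (of_nat p - of_int b) * (1 / of_int b) * (1 / of_int b) \<in> Zp"
    using Zp_inverse_int[OF pb] Zp_inverse_int[OF assms] by (intro Zp_mult) auto
  ultimately show ?thesis unfolding pcong_def by blast
qed

text \<open>
The value of \<open>zeta_odd N\<close> modulo \<open>p^2\<close> at odd \<open>x\<close> (see \<open>zeta_odd_values\<close>), extended to an odd function.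
\<close>

definition zeta_val :: "rat \<Rightarrow> rat" where
  "zeta_val x = - 1 / (2 * x) - of_nat p * poly trap x"

lemma zeta_val_minus: "zeta_val (- x) = - zeta_val x"
  by (simp add: zeta_val_def bern_trapezoid_minus)

text \<open>
With \<open>Q = 2l + 1\<close> and \<open>Q' = 2l - 1\<close> the exact difference is half of \<open>1 / (p - Q) + 1 / (p + Q')\<close>. Its
expansion modulo \<open>p^2\<close> has the leading part \<open>- 1/Q + 1/Q'\<close> and the first-order part
\<open>1/Q^2 + 1/Q'^2\<close>, which is the step of the trapezoidal sum of \<open>x^(p-3)\<close>.
\<close>

lemma zeta_odd_shift_pcong:
  assumes "l < N"
  shows "pcong 2 (poly (zeta_odd N) (2 * of_nat l + 1) - poly (zeta_odd N) (2 * of_nat l - 1))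
     (zeta_val (2 * of_nat l + 1) - zeta_val (2 * of_nat l - 1))"
proof -
  define q q' where "q = 2 * int l + 1" and "q' = 2 * int l - 1"
  define Q Q' :: rat where "Q = of_int q" and "Q' = of_int q'"
  have QQ: "Q = 2 * of_nat l + 1" "Q' = 2 * of_nat l - 1" by (simp_all add: Q_def Q'_def q_def q'_def)
  have nd: "\<not> int p dvd q" "\<not> int p dvd q'" "\<not> int p dvd - q'"
  proof -
    have "q \<noteq> 0" "\<bar>q\<bar> < int p" "q' \<noteq> 0" "\<bar>q'\<bar> < int p" using assms two_N unfolding q_def q'_def by presburger+
    then show "\<not> int p dvd q" "\<not> int p dvd q'" "\<not> int p dvd - q'"
      using dvd_imp_le_int[of q "int p"] dvd_imp_le_int[of q' "int p"] by auto
  qed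
  have NN: "(2 * of_nat N :: rat) = of_nat p - 1"
  proof -
    have "(of_nat (2 * N + 1) :: rat) = of_nat p" by (simp only: two_N)
    then show ?thesis by simp
  qed
  have ne: "(of_nat p - Q) \<noteq> 0" "(of_nat p + Q') \<noteq> 0"
  proof -
    have "int p - q \<noteq> 0" "int p + q' \<noteq> 0" using nd by (metis add.commute add_eq_0_iff dvd_minus_iff dvd_refl eq_iff_diff_eq_0)+
    then show "(of_nat p - Q) \<noteq> 0" "(of_nat p + Q') \<noteq> 0" unfolding Q_def Q'_def
      by (metis of_int_diff of_int_add of_int_eq_0_iff of_int_of_nat_eq)+
  qed
  have f: "4 * of_nat N ^ 2 - 4 * of_nat l ^ 2 = (of_nat p - Q) * (of_nat p + Q')"
  proof -
    have "4 * of_nat N ^ 2 - 4 * of_nat l ^ 2 = (2 * of_nat N - 2 * of_nat l) * (2 * of_nat N + 2 * of_nat l :: rat)"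
      by (simp add: power2_eq_square algebra_simps)
    then show ?thesis by (simp only: NN QQ) (simp add: algebra_simps)
  qed
  have s: "2 * of_nat N = ((of_nat p - Q) + (of_nat p + Q')) / 2" by (simp add: NN QQ)
  have "poly (zeta_odd N) Q - poly (zeta_odd N) Q' = (1 / (of_nat p - Q) + 1 / (of_nat p + Q')) / 2"
  proof -
    define A C D where "A = of_nat p - Q" and "C = of_nat p + Q'" and "D = poly (zeta_odd N) Q - poly (zeta_odd N) Q'"
    have AC: "A \<noteq> 0" "C \<noteq> 0" using ne by (simp_all add: A_def C_def)
    have "A * C * D = (A + C) / 2"
      using zeta_functional[OF assms] unfolding f s QQ [symmetric] A_def C_def D_def .
    then have "D = (A + C) / 2 / (A * C)" using AC by (simp add: eq_divide_eq mult_ac)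
    also have "\<dots> = (1 / A + 1 / C) / 2" using AC by (simp add: field_simps)
    finally show ?thesis unfolding A_def C_def D_def .
  qed
  also have "\<dots> = 1 / 2 * (1 / (of_nat p - of_int q) + 1 / (of_nat p - of_int (- q')))" by (simp add: Q_def Q'_def)
  also have "pcong 2 \<dots> (1 / 2 * ((- 1 / of_int q - of_nat p / of_int q ^ 2) + (- 1 / of_int (- q') - of_nat p / of_int (- q') ^ 2)))"
    by (intro pcong_scale pcong_add inverse_p_minus_pcong nd) auto
  also have "\<dots> = (- 1 / (2 * Q) + 1 / (2 * Q')) - of_nat p * (1 / 2 * (1 / Q ^ 2 + 1 / Q' ^ 2))"
    by (simp add: Q_def Q'_def algebra_simps)
  also have "pcong 2 \<dots> ((- 1 / (2 * Q) + 1 / (2 * Q')) - of_nat p * (1 / 2 * (Q ^ (p - 3) + Q' ^ (p - 3))))"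
  proof (intro pcong_diff pcong_refl, unfold pcong_times_p, intro pcong_scale pcong_add)
    have p3: "p - 1 - 2 = p - 3" "2 \<le> p - 1" using gt3 by auto
    show "pcong 1 (1 / Q ^ 2) (Q ^ (p - 3))" "pcong 1 (1 / Q' ^ 2) (Q' ^ (p - 3))"
      using inverse_power_pcong_int[OF nd(1) p3(2)] inverse_power_pcong_int[OF nd(2) p3(2)]
      unfolding p3(1) Q_def Q'_def by blast+
  qed auto
  also have "1 / 2 * (Q ^ (p - 3) + Q' ^ (p - 3)) = poly trap Q - poly trap Q'"
  proof -
    have "p - 2 - 1 = p - 3" by simp
    then show ?thesis using bern_trapezoid_diff[OF odd_p2, of "2 * of_nat l"] by (simp add: QQ)
  qed
  also have "(- 1 / (2 * Q) + 1 / (2 * Q')) - of_nat p * (poly trap Q - poly trap Q') = zeta_val Q - zeta_val Q'"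
    by (simp add: zeta_val_def algebra_simps)
  finally show ?thesis unfolding QQ .
qed

text \<open>
Summing the differences; the starting value comes from \<open>l = 0\<close>, where both sides of the difference
are twice the value at \<open>1\<close> by oddness.
\<close>

lemma zeta_odd_values:
  assumes "l < N"
  shows "pcong 2 (poly (zeta_odd N) (2 * of_nat l + 1)) (zeta_val (2 * of_nat l + 1))"
  using assms
proof (induction l)
  case 0
  have "pcong 2 (of_nat 2 * poly (zeta_odd N) 1) (of_nat 2 * zeta_val 1)"
    using zeta_odd_shift_pcong[OF 0] zeta_odd_minus[of N 1] zeta_val_minus[of 1] by simp
  then show ?case using pcong_cancel_nat[OF not_dvd_2] by simp
next
  case (Suc l)
  have "pcong 2 (poly (zeta_odd N) (2 * of_nat (Suc l) + 1) - poly (zeta_odd N) (2 * of_nat (Suc l) - 1) + poly (zeta_odd N) (2 * of_nat l + 1))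
     (zeta_val (2 * of_nat (Suc l) + 1) - zeta_val (2 * of_nat (Suc l) - 1) + zeta_val (2 * of_nat l + 1))"
    using Suc by (intro pcong_add zeta_odd_shift_pcong) auto
  moreover have "2 * of_nat (Suc l) - 1 = (2 * of_nat l + 1 :: rat)" by simp
  ultimately show ?case by (simp only: diff_add_cancel)
qed

text \<open>
Modulo \<open>p\<close> the values at the odd \<open>q\<close> are \<open>- 1/(2q) = - q^(p-2) / 2\<close>. These are \<open>p - 1\<close> points and the
degree is at most \<open>p - 2\<close>.
\<close>

lemma zeta_odd_top_pcong: "pcong 1 (coeff (zeta_odd N + monom (1 / 2) (p - 2)) i) 0"
proof -
  define F where "F = zeta_odd N + monom (1 / 2) (p - 2)"
  define X where "X = (\<lambda>l. 2 * l + 1) ` {- int N..int N - 1}"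
  have F_odd: "poly F (- x) = - poly F x" for x
    using odd_p2 by (simp add: F_def zeta_odd_minus poly_monom)
  have pos: "pcong 1 (poly F (2 * of_nat l + 1)) 0" if l: "l < N" for l
  proof -
    define Q :: rat where "Q = 2 * of_nat l + 1"
    have Q: "Q = of_nat (2 * l + 1)" by (simp add: Q_def)
    have p2: "p - 1 - 1 = p - 2" "1 \<le> p - 1" using gt3 by auto
    have i: "pcong 1 (1 / Q) (Q ^ (p - 2))"
      using inverse_power_pcong[OF not_dvd_node[OF l] p2(2)] unfolding p2(1) Q by simp
    have "pcong 1 (poly F Q) (zeta_val Q + 1 / 2 * Q ^ (p - 2))"
      using pcong_add[OF pcong_weaken[OF zeta_odd_values[OF l]] pcong_refl, of 1 "1 / 2 * Q ^ (p - 2)"]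
      by (simp add: F_def poly_monom Q_def)
    also have "\<dots> = (1 / 2 * (Q ^ (p - 2)) - 1 / 2 * (1 / Q)) - of_nat p ^ 1 * poly trap Q"
      by (simp add: zeta_val_def)
    also have "pcong 1 \<dots> ((1 / 2 * (Q ^ (p - 2)) - 1 / 2 * (Q ^ (p - 2))) - 0)"
      using Q by (intro pcong_diff pcong_scale i pcong_prime_power Zp_poly Zpoly_trap pcong_refl) auto
    finally show ?thesis by (simp add: Q_def)
  qed
  have "pcong 1 (coeff F i) 0"
  proof (rule coeffs_pcong_zero_if_many_roots)
    show "finite X" by (simp add: X_def)
    show "pcong 1 (poly F (of_int x)) 0" if x: "x \<in> X" for x
    proof -
      obtain i where i: "x = 2 * i + 1" "- int N \<le> i" "i \<le> int N - 1" using x unfolding X_def by auto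
      show ?thesis
      proof (cases "i \<ge> 0")
        case True
        then show ?thesis using pos[of "nat i"] i by simp
      next
        case False
        define l where "l = nat (- i - 1)"
        have "of_int x = (- (2 * of_nat l + 1) :: rat)" "l < N" using False i by (simp_all add: l_def)
        then show ?thesis using pos[of l] pcong_minus[of 1 "poly F (2 * of_nat l + 1)" 0]
          by (simp only: F_odd minus_zero)
      qed
    qed
    show "\<not> int p dvd x - y" if xy: "x \<in> X" "y \<in> X" "x \<noteq> y" for x y
    proof
      obtain i j where ij: "x = 2 * i + 1" "y = 2 * j + 1" "- int N \<le> i" "i \<le> int N - 1" "- int N \<le> j" "j \<le> int N - 1"
        using xy unfolding X_def by auto
      assume "int p dvd x - y"
      then have "int p dvd 2 * (i - j)" by (simp add: ij algebra_simps)
      moreover have "\<not> int p dvd 2" using not_dvd_2 by (metis int_dvd_int_iff of_nat_numeral)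
      ultimately have "int p dvd i - j" using prime_dvd_mult_iff[OF prime_int] by blast
      moreover have "i - j \<noteq> 0" "\<bar>i - j\<bar> < int p" using ij xy(3) two_N N_gt_1 by linarith+
      ultimately show False using dvd_imp_le_int[of "i - j" "int p"] by simp
    qed
    have "card X = 2 * N" unfolding X_def by (subst card_image) (auto simp: inj_on_def)
    moreover have "degree F \<le> p - 2" unfolding F_def using degree_zeta_odd[of N] two_N N_gt_1
      by (intro degree_add_le degree_monom_le) linarith
    ultimately show "degree F < card X" using two_N N_gt_1 by linarith
    show "Zpoly F" unfolding F_def by (intro Zpoly_add Zpoly_zeta_odd Zpoly_monom) auto
  qed
  then show ?thesis by (simp add: F_def)
qed

text \<open>
Adding \<open>trap\<close> cancels the Bernoulli part of the values, which leaves the Fermat quotients of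
\<open>zeta_quot_values\<close>.
\<close>

definition zeta_quot :: "rat poly" where
  "zeta_quot = smult (1 / of_nat p) (zeta_odd N + monom (1 / 2) (p - 2)) + trap"

lemma Zpoly_zeta_quot: "Zpoly zeta_quot"
  unfolding zeta_quot_def
proof (rule Zpoly_add[OF _ Zpoly_trap])
  show "Zpoly (smult (1 / of_nat p) (zeta_odd N + monom (1 / 2) (p - 2)))"
    unfolding Zpoly_def
  proof
    fix i
    obtain z where "z \<in> Zp" "coeff (zeta_odd N + monom (1 / 2) (p - 2)) i = of_nat p * z"
      using zeta_odd_top_pcong[of i] unfolding pcong_def by auto
    then show "coeff (smult (1 / of_nat p) (zeta_odd N + monom (1 / 2) (p - 2))) i \<in> Zp"
      using p_pos by (simp only: coeff_smult) simp
  qed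
qed

lemma degree_zeta_quot: "degree zeta_quot \<le> p - 2"
  unfolding zeta_quot_def using degree_zeta_odd[of N] two_N N_gt_1
  by (intro degree_add_le degree_trap order.trans[OF degree_smult_le] degree_monom_le) linarith

lemma zeta_quot_minus: "poly zeta_quot (- x) = - poly zeta_quot x"
  using odd_p2 by (simp add: zeta_quot_def zeta_odd_minus bern_trapezoid_minus poly_monom algebra_simps)

lemma zeta_quot_values:
  assumes "l < N"
  shows "pcong 2 (of_nat p * poly zeta_quot (2 * of_nat l + 1))
    (1 / 2 * ((2 * of_nat l + 1) ^ (p - 2) - 1 / (2 * of_nat l + 1)))"
proof -
  define Q :: rat where "Q = 2 * of_nat l + 1"
  have "of_nat p * poly zeta_quot Q = poly (zeta_odd N) Q + (1 / 2 * Q ^ (p - 2) + of_nat p * poly trap Q)"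
    using p_pos by (simp add: zeta_quot_def poly_monom distrib_left)
  also have "pcong 2 \<dots> (zeta_val Q + (1 / 2 * Q ^ (p - 2) + of_nat p * poly trap Q))"
    unfolding Q_def by (intro pcong_add zeta_odd_values assms pcong_refl)
  also have "\<dots> = 1 / 2 * (Q ^ (p - 2) - 1 / Q)" by (simp add: zeta_val_def algebra_simps)
  finally show ?thesis unfolding Q_def .
qed

text \<open>
Extraction with the residue system \<open>2t - p\<close> (\<open>0 < t < p\<close>), which consists of the odd \<open>q\<close> with
\<open>\<bar>q\<bar> < p\<close>. Values at these integers are needed, and not merely at integers congruent to them,
because a Fermat quotient is not determined by the residue class.
\<close>

lemma coeff_zeta_quot_pcong:
  assumes "2 * m + 3 < p"
  defines "e \<equiv> p - 3 - 2 * m"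
  shows "pcong 2 (of_nat p * coeff zeta_quot (2 * m + 1)) (odd_psum e - odd_psum (e + (p - 1)))"
proof -
  define u where "u = Suc e"
  have u: "p - 1 - (2 * m + 1) = u" "2 * m + 1 \<le> p - 2" "odd u"
    using assms odd_p by (auto simp: u_def e_def)
  define \<phi> where "\<phi> = (\<lambda>x. poly zeta_quot x * x ^ u)"
  have \<phi>_minus: "\<phi> (- x) = \<phi> x" for x using u(3) by (simp add: \<phi>_def zeta_quot_minus)
  have "pcong 1 (- coeff zeta_quot (2 * m + 1)) (\<Sum>t=1..<p. \<phi> (2 * of_nat t))"
    using pcong_sym[OF coeff_by_power_sums[OF Zpoly_zeta_quot degree_zeta_quot u(2)]] unfolding u(1) \<phi>_def .
  also have "pcong 1 \<dots> (\<Sum>t=1..<p. \<phi> (of_nat p - 2 * of_nat t))"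
    unfolding \<phi>_minus[of "_ - _", symmetric]
  proof (rule pcong_sum)
    fix t
    have c: "pcong 1 (2 * of_nat t) (- (of_nat p - 2 * of_nat t))"
      using pcong_sym[OF pcong_minus[OF pcong_p_minus[of "2 * of_nat t"]]] by simp
    show "pcong 1 (\<phi> (2 * of_nat t)) (\<phi> (- (of_nat p - 2 * of_nat t)))"
      unfolding \<phi>_def using c
      by (intro pcong_mult pcong_poly pcong_power Zpoly_zeta_quot Zp_power Zp_poly) auto
  qed
  also have "\<dots> = (\<Sum>x=1..N. \<phi> (of_nat p - 2 * of_nat x) + \<phi> (of_nat p - 2 * of_nat (p - x)))"
    by (rule sum_split_reflect[where n = N, unfolded two_N])
  also have "\<dots> = (\<Sum>x=1..N. 2 * \<phi> (of_nat (p - 2 * x)))"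
  proof (intro sum.cong refl)
    fix x assume "x \<in> {1..N}"
    then have x: "2 * x \<le> p" "x \<le> p" using two_N by auto
    have "of_nat p - 2 * of_nat (p - x) = - (of_nat p - 2 * of_nat x :: rat)"
      using x by (simp add: of_nat_diff)
    then show "\<phi> (of_nat p - 2 * of_nat x) + \<phi> (of_nat p - 2 * of_nat (p - x)) = 2 * \<phi> (of_nat (p - 2 * x))"
      using x by (simp only: \<phi>_minus) (simp add: of_nat_diff)
  qed
  also have "\<dots> = (\<Sum>i<N. 2 * \<phi> (of_nat (2 * i + 1)))"
    by (rule sum_odd_reflect[where n = N, unfolded two_N, symmetric])
  finally have "pcong 2 (of_nat p * (- coeff zeta_quot (2 * m + 1))) (of_nat p * (\<Sum>i<N. 2 * \<phi> (of_nat (2 * i + 1))))"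
    unfolding pcong_times_p .
  also have "\<dots> = (\<Sum>i<N. 2 * (2 * of_nat i + 1) ^ u * (of_nat p * poly zeta_quot (2 * of_nat i + 1)))"
    unfolding sum_distrib_left by (intro sum.cong refl) (simp add: \<phi>_def algebra_simps)
  also have "pcong 2 \<dots> (\<Sum>i<N. 2 * (2 * of_nat i + 1) ^ u * (1 / 2 * ((2 * of_nat i + 1) ^ (p - 2) - 1 / (2 * of_nat i + 1))))"
    by (intro pcong_sum pcong_scale zeta_quot_values) auto
  also have "\<dots> = (\<Sum>i<N. (2 * of_nat i + 1) ^ (e + (p - 1)) - (2 * of_nat i + 1) ^ e)"
  proof (intro sum.cong refl)
    fix i
    define Q :: rat where "Q = 2 * of_nat i + 1"
    have "Q \<noteq> 0" by (simp add: Q_def)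
    moreover have "u + (p - 2) = e + (p - 1)" using gt3 by (simp add: u_def)
    then have "Q ^ u * Q ^ (p - 2) = Q ^ (e + (p - 1))" by (simp flip: power_add)
    ultimately have "2 * Q ^ u * (1 / 2 * (Q ^ (p - 2) - 1 / Q)) = Q ^ (e + (p - 1)) - Q ^ e"
      by (simp add: right_diff_distrib u_def)
    then show "2 * (2 * of_nat i + 1) ^ u * (1 / 2 * ((2 * of_nat i + 1) ^ (p - 2) - 1 / (2 * of_nat i + 1)))
       = (2 * of_nat i + 1) ^ (e + (p - 1)) - (2 * of_nat i + 1 :: rat) ^ e"
      by (simp only: Q_def)
  qed
  also have "\<dots> = odd_psum (e + (p - 1)) - odd_psum e"
    by (simp add: odd_psum_def sum_subtractf)
  finally have "pcong 2 (- (of_nat p * (- coeff zeta_quot (2 * m + 1)))) (- (odd_psum (e + (p - 1)) - odd_psum e))"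
    by (rule pcong_minus)
  then show ?thesis by simp
qed

text \<open>
Modulo \<open>p\<close> this is the binomial series of \<open>(1 + x)^(-2)\<close>.
\<close>

lemma choose_pcong: "i \<le> p - 2 \<Longrightarrow> pcong 1 (of_nat (p - 2 choose i)) ((- 1) ^ i * of_nat (i + 1))"
proof (induction i)
  case (Suc i)
  have "Suc i * (p - 2 choose Suc i) = (p - 2 - i) * (p - 2 choose i)"
    using binomial_absorption[of i "p - 2"] binomial_absorb_comp[of "p - 2" i] by (simp only:)
  then have "of_nat (Suc i) * of_nat (p - 2 choose Suc i) = (of_nat (p - 2 - i) * of_nat (p - 2 choose i) :: rat)"
    by (simp only: flip: of_nat_mult)
  also have "of_nat (p - 2 - i) = (of_nat p - of_nat (i + 2) :: rat)" using Suc.prems by (simp add: of_nat_diff)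
  also have "pcong 1 ((of_nat p - of_nat (i + 2)) * of_nat (p - 2 choose i)) (- of_nat (i + 2) * ((- 1) ^ i * of_nat (i + 1)))"
    using Suc by (intro pcong_mult pcong_p_minus) auto
  also have "\<dots> = of_nat (Suc i) * ((- 1) ^ Suc i * of_nat (Suc i + 1))" by (simp add: algebra_simps)
  finally show ?case
    by (rule pcong_cancel_nat[rotated]) (use Suc.prems gt3 in \<open>auto dest: dvd_imp_le\<close>)
qed auto

lemma coeff_trap_pcong:
  assumes "2 * m + 3 < p"
  defines "e \<equiv> p - 3 - 2 * m"
  shows "pcong 1 (2 * coeff trap (2 * m + 1)) (of_nat (m + 1) * 2 ^ e * bernoulli e)"
proof -
  have e: "p - 2 - (2 * m + 1) = e" and m: "2 * m + 1 \<le> p - 2" and e2: "e \<le> p - 2"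
    using assms by (auto simp: e_def)
  have n: "\<not> p dvd p - 2" using gt3 by (intro not_dvd_less) auto
  have n0: "(of_nat (p - 2) :: rat) \<noteq> 0" using n by (intro notI) simp
  have ZB: "bernoulli e \<in> Zp" by (rule Zp_bernoulli[OF e2])
  have "of_nat (p - 2) * (2 * coeff trap (2 * m + 1)) = of_nat (p - 2 choose (2 * m + 1)) * (2 ^ e * bernoulli e)"
  proof -
    define M :: rat where "M = of_nat (p - 2)"
    have "coeff trap (2 * m + 1) = of_nat (p - 2 choose (2 * m + 1)) * 2 ^ e * bernoulli e / (2 * M)"
      unfolding M_def by (rule coeff_bern_trapezoid[OF _ m, unfolded e]) simp
    then show ?thesis using n0 unfolding M_def [symmetric] by simp
  qed
  also have "pcong 1 \<dots> (((- 1) ^ (2 * m + 1) * of_nat (2 * m + 1 + 1)) * (2 ^ e * bernoulli e))"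
    using ZB by (intro pcong_scale_right choose_pcong m) auto
  also have "\<dots> = (- 2) * (of_nat (m + 1) * 2 ^ e * bernoulli e)" by (simp add: algebra_simps)
  also have "pcong 1 \<dots> (of_nat (p - 2) * (of_nat (m + 1) * 2 ^ e * bernoulli e))"
  proof (rule pcong_scale_right)
    have "of_nat (p - 2) = (of_nat p - 2 :: rat)" using gt3 by (simp add: of_nat_diff)
    then show "pcong 1 (- 2) (of_nat (p - 2))" using pcong_sym[OF pcong_p_minus[of 2]] by simp
  qed (use ZB in auto)
  finally show ?thesis by (rule pcong_cancel_nat[OF n])
qed

text \<open>
Linear extrapolation from the exponents \<open>e\<close> and \<open>e + (p-1)\<close> to \<open>e - (p-1) = - (2m+2)\<close>: the error at
\<open>q\<close> is \<open>q^(e-(p-1)) (q^(p-1) - 1)^2\<close>.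
\<close>

lemma inverse_even_sum_pcong:
  assumes "2 * m + 3 < p"
  defines "e \<equiv> p - 3 - 2 * m"
  shows "pcong 2 (\<Sum>k<N. 1 / (2 * of_nat k + 1) ^ (2 * m + 2)) (2 * odd_psum e - odd_psum (e + (p - 1)))"
proof -
  have "2 * odd_psum e - odd_psum (e + (p - 1)) = (\<Sum>k<N. 2 * (2 * of_nat k + 1) ^ e - (2 * of_nat k + 1) ^ (e + (p - 1)))"
    by (simp add: odd_psum_def sum_subtractf sum_distrib_left)
  moreover have "pcong 2 (\<Sum>k<N. 1 / (2 * of_nat k + 1) ^ (2 * m + 2)) (\<Sum>k<N. 2 * (2 * of_nat k + 1) ^ e - (2 * of_nat k + 1) ^ (e + (p - 1)))"
  proof (rule pcong_sum)
    fix k assume k: "k \<in> {..<N}"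
    define Q :: rat where "Q = 2 * of_nat k + 1"
    have Q: "Q = of_nat (2 * k + 1)" "Q \<noteq> 0" by (simp_all add: Q_def)
    have nd: "\<not> p dvd 2 * k + 1" using k by (intro not_dvd_node) auto
    have e: "e + (2 * m + 2) = p - 1" using assms by (simp add: e_def)
    obtain z where z: "z \<in> Zp" "Q ^ (p - 1) - 1 = of_nat p * z"
      using fermat_pcong[OF nd] unfolding pcong_def Q by auto
    have "1 / Q ^ (2 * m + 2) - (2 * Q ^ e - Q ^ (e + (p - 1))) = (Q ^ (p - 1) - 1) ^ 2 * (1 / Q ^ (2 * m + 2))"
    proof -
      define R where "R = Q ^ (2 * m + 2)"
      have "R \<noteq> 0" using Q(2) by (simp add: R_def)
      moreover have "Q ^ (p - 1) = Q ^ e * R" by (simp only: R_def power_add flip: e)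
      ultimately have "Q ^ e = Q ^ (p - 1) * (1 / R)" by simp
      then have "1 / R - (2 * Q ^ e - Q ^ e * Q ^ (p - 1)) = (Q ^ (p - 1) - 1) ^ 2 * (1 / R)"
        by (simp add: power2_eq_square algebra_simps)
      then show ?thesis by (simp only: R_def power_add[of Q e])
    qed
    also have "\<dots> = of_nat p ^ 2 * (z ^ 2 * (1 / of_nat ((2 * k + 1) ^ (2 * m + 2))))"
      unfolding z(2) unfolding Q(1) power_mult_distrib of_nat_power by (simp only: mult.assoc)
    finally have "1 / Q ^ (2 * m + 2) - (2 * Q ^ e - Q ^ (e + (p - 1)))
        = of_nat p ^ 2 * (z ^ 2 * (1 / of_nat ((2 * k + 1) ^ (2 * m + 2))))" .
    moreover have "z ^ 2 * (1 / of_nat ((2 * k + 1) ^ (2 * m + 2))) \<in> Zp"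
      using z(1) by (intro Zp_mult Zp_power Zp_inverse_nat not_dvd_power nd)
    ultimately show "pcong 2 (1 / (2 * of_nat k + 1) ^ (2 * m + 2)) (2 * (2 * of_nat k + 1) ^ e - (2 * of_nat k + 1) ^ (e + (p - 1)))"
      unfolding pcong_def Q_def by blast
  qed
  ultimately show ?thesis by simp
qed

lemma zeta_even_pcong_odd_psum:
  assumes "2 * m + 3 < p"
  defines "e \<equiv> p - 3 - 2 * m"
  shows "pcong 2 (zeta_even p m) (3 * odd_psum e - 2 * odd_psum (e + (p - 1)) - of_nat p * coeff trap (2 * m + 1))"
proof -
  have "coeff zeta_quot (2 * m + 1) = 1 / of_nat p * coeff (zeta_rem N) m + coeff trap (2 * m + 1)"
    using assms(1) coeff_zeta_odd[of N m] by (simp add: zeta_quot_def)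
  then have r: "coeff (zeta_rem N) m = of_nat p * coeff zeta_quot (2 * m + 1) - of_nat p * coeff trap (2 * m + 1)"
    using p_pos by (simp add: algebra_simps)
  have "zeta_even p m = (\<Sum>k<N. 1 / (2 * of_nat k + 1) ^ (2 * m + 2)) + coeff (zeta_rem N) m"
    unfolding zeta_even_def half_range by (rule zeta_sum_eq)
  also have "pcong 2 \<dots> ((2 * odd_psum e - odd_psum (e + (p - 1))) + ((odd_psum e - odd_psum (e + (p - 1))) - of_nat p * coeff trap (2 * m + 1)))"
    unfolding r e_def by (intro pcong_add pcong_diff inverse_even_sum_pcong coeff_zeta_quot_pcong assms(1) pcong_refl)
  finally show ?thesis by (simp add: algebra_simps)
qed

text \<open>
The contributions \<open>3 O(e) - 2 O(e + p - 1)\<close> of the power sums over odd numbers become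
\<open>(e + 2) / e * O(e)\<close> by Kummer's congruence, and \<open>2 O(e) = 2^e p B\<^sub>e\<close> modulo \<open>p^2\<close>. The trapezoidal polynomial contributes
\<open>- p (m + 1) 2^e B\<^sub>e / 2\<close>. After multiplication by \<open>2e\<close> everything is \<open>p 2^e B\<^sub>e\<close> times \<open>(e + 2) - e (m + 1)\<close>, and \<open>e = - (2m + 3)\<close> modulo \<open>p\<close> turns the last
factor into \<open>2m^2 + 3m + 2\<close>.
\<close>

theorem zeta_even_pcong:
  assumes "2 * m + 3 < p"
  shows "pcong 2 (zeta_even p m)
    (- ((2 * of_nat m ^ 2 + 3 * of_nat m + 2) / (2 ^ (2 * m + 3) * (2 * of_nat m + 3)))
      * of_nat p * bernoulli (p - 2 * m - 3))"
proof -
  define e where "e = p - 3 - 2 * m"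
  define B where "B = bernoulli e"
  define c :: rat where "c = 2 * of_nat m ^ 2 + 3 * of_nat m + 2"
  have e: "even e" "0 < e" "e < p - 1" "e \<le> p - 2" "e + (2 * m + 2) = p - 1" "e + (2 * m + 3) = p" "p - 2 * m - 3 = e"
    using assms odd_p by (auto simp: e_def elim!: oddE)
  have ZB: "B \<in> Zp" unfolding B_def by (rule Zp_bernoulli[OF e(4)])
  have nd: "\<not> (p - 1) dvd e" using e by (auto dest: dvd_imp_le)
  have ce: "pcong 1 (of_nat e) (- of_nat (2 * m + 3))"
    using pcong_p_minus[of "of_nat (2 * m + 3)"] e(6) by (metis of_nat_add add_diff_cancel_right')
  define h where "h = coeff trap (2 * m + 1)"
  have "of_nat (2 * e) * zeta_even p m = 2 * (of_nat e * zeta_even p m)" by simp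
  also have "pcong 2 \<dots> (2 * (of_nat e * (3 * odd_psum e - 2 * odd_psum (e + (p - 1)) - of_nat p * h)))"
    unfolding h_def e_def by (intro pcong_scale zeta_even_pcong_odd_psum assms) auto
  also have "\<dots> = 6 * of_nat e * odd_psum e - 4 * (of_nat e * odd_psum (e + (p - 1))) - of_nat p * (of_nat e * (2 * h))"
    by (simp add: algebra_simps)
  also have "pcong 2 \<dots> (6 * of_nat e * odd_psum e - 4 * ((of_nat e - 1) * odd_psum e) - of_nat p * (of_nat e * (of_nat (m + 1) * 2 ^ e * B)))"
  proof (intro pcong_diff pcong_refl)
    show "pcong 2 (4 * (of_nat e * odd_psum (e + (p - 1)))) (4 * ((of_nat e - 1) * odd_psum e))"
      by (intro pcong_scale pcong_odd_psum_kummer e(1) nd) auto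
    show "pcong 2 (of_nat p * (of_nat e * (2 * h))) (of_nat p * (of_nat e * (of_nat (m + 1) * 2 ^ e * B)))"
      unfolding pcong_times_p h_def B_def e_def by (intro pcong_scale coeff_trap_pcong assms) auto
  qed
  also have "\<dots> = of_nat (e + 2) * (2 * odd_psum e) - of_nat p * (of_nat e * (of_nat (m + 1) * 2 ^ e * B))"
    by (simp add: algebra_simps)
  also have "pcong 2 \<dots> (of_nat (e + 2) * (2 ^ e * psum e) - of_nat p * (of_nat e * (of_nat (m + 1) * 2 ^ e * B)))"
    by (intro pcong_diff pcong_refl pcong_scale pcong_odd_psum e) auto
  also have "pcong 2 \<dots> (of_nat (e + 2) * (2 ^ e * (of_nat p * B)) - of_nat p * (of_nat e * (of_nat (m + 1) * 2 ^ e * B)))"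
    unfolding B_def by (intro pcong_diff pcong_refl pcong_scale psum_bernoulli e) auto
  also have "\<dots> = of_nat p * ((2 ^ e * B) * (of_nat e * (- of_nat m) + 2))"
    by (simp add: algebra_simps)
  also have "pcong 2 \<dots> (of_nat p * ((2 ^ e * B) * (- of_nat (2 * m + 3) * (- of_nat m) + 2)))"
    unfolding pcong_times_p using ZB by (intro pcong_scale pcong_add pcong_scale_right ce pcong_refl) auto
  also have "(- of_nat (2 * m + 3) * (- of_nat m) + 2) = c"
    by (simp add: c_def algebra_simps power2_eq_square)
  finally have main: "pcong 2 (of_nat (2 * e) * zeta_even p m) (of_nat p * ((2 ^ e * B) * c))" .
  define M where "M = 2 ^ (2 * m + 3) * (2 * m + 3)"
  have Zc: "c \<in> Zp" unfolding c_def by auto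
  have "of_nat (2 * e * M) * zeta_even p m = of_nat M * (of_nat (2 * e) * zeta_even p m)" by simp
  also have "pcong 2 \<dots> (of_nat M * (of_nat p * ((2 ^ e * B) * c)))"
    by (intro pcong_scale main) auto
  also have "\<dots> = of_nat p * ((2 * B * c) * (2 ^ (p - 1) * of_nat (2 * m + 3)))"
  proof -
    have "(2 :: rat) ^ (2 * m + 3) * 2 ^ e = 2 * 2 ^ (p - 1)"
    proof -
      have "(2 * m + 3) + e = Suc (p - 1)" using e(5) by simp
      then show ?thesis by (simp only: power_add [symmetric] power_Suc)
    qed
    moreover have "of_nat M * (of_nat p * ((2 ^ e * B) * c))
       = of_nat p * (B * c * (2 ^ (2 * m + 3) * 2 ^ e) * of_nat (2 * m + 3))" by (simp add: M_def)
    ultimately show ?thesis by (simp only: mult_ac)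
  qed
  also have "pcong 2 \<dots> (of_nat p * ((2 * B * c) * (1 * (- of_nat e))))"
    unfolding pcong_times_p using ZB Zc fermat_pcong[OF not_dvd_2]
    by (intro pcong_scale pcong_mult pcong_sym[OF pcong_minus[OF ce], unfolded minus_minus]) auto
  also have "\<dots> = of_nat (2 * e * M) * (- (c / of_nat M) * of_nat p * B)"
  proof -
    have "(of_nat M :: rat) \<noteq> 0" by (simp add: M_def)
    then show ?thesis by simp
  qed
  finally have "pcong 2 (of_nat (2 * e * M) * zeta_even p m) (of_nat (2 * e * M) * (- (c / of_nat M) * of_nat p * B))" .
  moreover have "\<not> p dvd 2 * e * M"
  proof -
    have "\<not> p dvd e" using e(2,3) by (intro not_dvd_less) auto
    moreover have "\<not> p dvd 2 * m + 3" using assms by (intro not_dvd_less) auto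
    ultimately show ?thesis unfolding M_def
      using not_dvd_2 not_dvd_power[OF not_dvd_2, of "2 * m + 3"] prime_dvd_mult_iff[OF prime] by blast
  qed
  ultimately have "pcong 2 (zeta_even p m) (- (c / of_nat M) * of_nat p * B)" by (rule pcong_cancel_nat[rotated])
  then show ?thesis unfolding e(7) by (simp add: c_def M_def B_def add.commute)
qed

end

theorem theorem6p2:
  fixes m p :: nat
  assumes "prime p" and "p > 2 * m + 3"
  shows "rat_cong p 1 (beta_odd p m)
           ((-1) ^ ((p + 1) div 2) * of_nat m * (4 ^ m - 1) / (16 ^ m * (2 * of_nat m + 1))
            * bernoulli (p - 2 * m - 1))
       \<and> rat_cong p 2 (zeta_even p m)
           (- ((2 * of_nat m ^ 2 + 3 * of_nat m + 2) / (2 ^ (2 * m + 3) * (2 * of_nat m + 3)))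
            * of_nat p * bernoulli (p - 2 * m - 3))"
proof -
  interpret odd_prime p using assms by unfold_locales auto
  show ?thesis
    using beta_odd_pcong[OF assms(2)] zeta_even_pcong[OF assms(2)] by (intro conjI rat_cong_if_pcong)
qed

end
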